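(* Let $n,N$ be integers with $2\le n\le N\le 2n-2$. Let $M=\{(z,w)\in\mathbb{C}^n\times\mathbb{C} : p(z,\overline z)+q(w,\overline w)=0\}$ be a real hypersurface of revolution in $\mathbb{C}^{n+1}$, with $p$, $q$, the domain $D_0=\{w\in\mathbb{C}: q(w,\overline w)<0\}$, the open set $U_0\subset D_0$ over which $M$ is strongly pseudoconvex, the Gauss curvature $K$ on $U_0$, and the connected open piece $M_0\subset M$ lying over $U_0$ as described in the context. Suppose that $K\ge -2$ on $U_0$ and that there is a non-constant smooth CR map $F: M_0\to\partial\mathbb{B}^{N+1}$. Then $K\equiv -2$ on $U_0$, and the image $F(M_0)$ in $\partial\mathbb{B}^{N+1}$ is totally geodesic, namely, it is an open piece of a CR transversal intersection of a complex affine subspace of $\mathbb{C}^{N+1}$ of dimension $n+1$ with $\partial\mathbb{B}^{N+1}$.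
   Context: $\mathbb{B}^{m}$ denotes the open unit ball in $\mathbb{C}^m$ and $\partial\mathbb{B}^m$ its boundary, the unit sphere. A real hypersurface of revolution is $M=\{(z,w)\in\mathbb{C}^n\times\mathbb{C}: r=0\}$ with $r=p(z,\overline z)+q(w,\overline w)$, where $p(z,\overline z)=\sum_{1\le\alpha,\beta\le n}h_{\alpha\overline\beta}z^\alpha\overline{z^\beta}$ with $(h_{\alpha\overline\beta})$ a (constant) positive definite Hermitian matrix, and $q=q(w,\overline w)$ is a smooth real-valued function of the complex variable $w$ with $dq\neq 0$ at every point where $q=0$. Put $D_0=\{w\in\mathbb{C}: q(w,\overline w)<0\}$. Let $U_0\subset D_0$ be an open neighborhood of a point $w_0\in D_0$ such that $M$ is strongly pseudoconvex at all of its points $(z,w)$ with $w\in U_0$. Then (an observation of Webster) the function $$h:=-(\log |q|)_{w\overline w}=\frac{q_wq_{\overline w}-q\,q_{w\overline w}}{q^2}$$ is positive on $U_0$, so $ds^2=h\,dw\,d\overline w$ is a Hermitian metric on $U_0$. Its Gauss curvature is normalized as $$K=-\frac1h\,\frac{\partial^2}{\partial w\,\partial\overline w}\log h .$$ $M_0$ denotes a connected open piece of $M$ whose projection to the $w$-space is $U_0$. The intersection of a complex affine subspace $E\subset\mathbb{C}^{N+1}$ with the sphere $\partial\mathbb{B}^{N+1}$ is CR transversal if, at every intersection point $x$, the tangent space of $E$ is not contained in the complex tangent space $T_x\partial\mathbb{B}^{N+1}\cap i\,T_x\partial\mathbb{B}^{N+1}$ of the sphere. *)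

theory Defs
  imports "HOL-Analysis.Analysis"
begin

class complex_normed_space = real_normed_vector +
  fixes scaleC :: "complex \<Rightarrow> 'a \<Rightarrow> 'a"  (infixr \<open>*\<^sub>C\<close> 75)
  assumes scaleC_add_right: "c *\<^sub>C (x + y) = c *\<^sub>C x + c *\<^sub>C y"
    and scaleC_add_left: "(c + d) *\<^sub>C x = c *\<^sub>C x + d *\<^sub>C x"
    and scaleC_scaleC: "c *\<^sub>C (d *\<^sub>C x) = (c * d) *\<^sub>C x"
    and scaleC_of_real: "of_real t *\<^sub>C x = t *\<^sub>R x"
    and norm_scaleC: "norm (c *\<^sub>C x) = cmod c * norm x"

instantiation complex :: complex_normed_space
begin

definition scaleC_complex :: "complex \<Rightarrow> complex \<Rightarrow> complex"
  where "c *\<^sub>C x = c * x"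

instance
  by standard (simp_all add: scaleC_complex_def algebra_simps scaleR_conv_of_real norm_mult)

end

instantiation vec :: (complex_normed_space, finite) complex_normed_space
begin

definition scaleC_vec :: "complex \<Rightarrow> 'a ^ 'b \<Rightarrow> 'a ^ 'b"
  where "c *\<^sub>C x = (\<chi> i. c *\<^sub>C (x $ i))"

instance
  by standard
    (simp_all add: scaleC_vec_def vec_eq_iff scaleC_add_right scaleC_add_left
      scaleC_scaleC scaleC_of_real norm_scaleC norm_vec_def L2_set_right_distrib)

end

instantiation prod :: (complex_normed_space, complex_normed_space) complex_normed_space
begin

definition scaleC_prod :: "complex \<Rightarrow> 'a \<times> 'b \<Rightarrow> 'a \<times> 'b"
  where "c *\<^sub>C x = (c *\<^sub>C fst x, c *\<^sub>C snd x)"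

instance
  by standard
    (simp_all add: scaleC_prod_def prod_eq_iff scaleC_add_right scaleC_add_left
      scaleC_scaleC scaleC_of_real norm_scaleC norm_prod_def
      power_mult_distrib real_sqrt_mult flip: distrib_left)

end

lemma scaleC_eq_vector_scalar_mult: "c *\<^sub>C (x :: complex ^ 'm) = c *s x"
  by (simp add: scaleC_vec_def scaleC_complex_def vector_scalar_mult_def)

text \<open>Intended for open sets in finite-dimensional spaces, where existence and continuity of all
  iterated directional derivatives (together with differentiability) is the usual
  \<open>C\<^sup>k\<close> condition.\<close>

primrec Ck_on :: "nat \<Rightarrow> ('a::real_normed_vector \<Rightarrow> 'b::real_normed_vector) \<Rightarrow> 'a set \<Rightarrow> bool"
where
  "Ck_on 0 f U \<longleftrightarrow> continuous_on U f"
| "Ck_on (Suc k) f U \<longleftrightarrow>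
     (\<forall>x\<in>U. f differentiable (at x)) \<and> (\<forall>v. Ck_on k (\<lambda>x. frechet_derivative f (at x) v) U)"

definition smooth_on :: "('a::real_normed_vector \<Rightarrow> 'b::real_normed_vector) \<Rightarrow> 'a set \<Rightarrow> bool"
  where "smooth_on f U \<longleftrightarrow> (\<forall>k. Ck_on k f U)"

text \<open>Smoothness on a subset that need not be open (here: a piece of a hypersurface), by local
  smooth extension to the ambient space.\<close>

definition smooth_on_subset ::
    "('a::real_normed_vector \<Rightarrow> 'b::real_normed_vector) \<Rightarrow> 'a set \<Rightarrow> bool"
  where "smooth_on_subset F S \<longleftrightarrow>
    (\<forall>x\<in>S. \<exists>V G. open V \<and> x \<in> V \<and> smooth_on G V \<and> (\<forall>y\<in>V \<inter> S. G y = F y))"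

text \<open>In coordinates, \<open>dhol v = (\<Sum>j. v\<^sub>j \<partial>/\<partial>z\<^sub>j)\<close> and
  \<open>dbar v = (\<Sum>j. cnj v\<^sub>j \<partial>/\<partial>(cnj z\<^sub>j))\<close>. On \<^typ>\<open>complex\<close>,
  \<open>v = 1\<close> gives the usual \<open>\<partial>/\<partial>w\<close> and \<open>\<partial>/\<partial>(cnj w)\<close>.\<close>

definition dhol :: "'a::complex_normed_space \<Rightarrow> ('a \<Rightarrow> complex) \<Rightarrow> 'a \<Rightarrow> complex"
  where "dhol v f x =
    (frechet_derivative f (at x) v - \<i> * frechet_derivative f (at x) (\<i> *\<^sub>C v)) / 2"

definition dbar :: "'a::complex_normed_space \<Rightarrow> ('a \<Rightarrow> complex) \<Rightarrow> 'a \<Rightarrow> complex"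
  where "dbar v f x =
    (frechet_derivative f (at x) v + \<i> * frechet_derivative f (at x) (\<i> *\<^sub>C v)) / 2"

definition tangent_space :: "('a::real_normed_vector \<Rightarrow> real) \<Rightarrow> 'a \<Rightarrow> 'a set"
  where "tangent_space r x = {v. frechet_derivative r (at x) v = 0}"

text \<open>\<open>T \<inter> \<i> T\<close>, where \<open>T\<close> is the real tangent space.\<close>

definition complex_tangent_space :: "('a::complex_normed_space \<Rightarrow> real) \<Rightarrow> 'a \<Rightarrow> 'a set"
  where "complex_tangent_space r x =
    tangent_space r x \<inter> (\<lambda>v. \<i> *\<^sub>C v) ` tangent_space r x"

text \<open>\<open>levi_form r x v = (\<Sum>j k. r\<^sub>j\<^sub>k v\<^sub>j (cnj v\<^sub>k))\<close>, with
  \<open>r\<^sub>j\<^sub>k\<close> the mixed derivative in \<open>z\<^sub>j\<close> and \<open>cnj z\<^sub>k\<close>. It is real when \<open>r\<close> is \<open>C\<^sup>2\<close>.\<close>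

definition levi_form :: "('a::complex_normed_space \<Rightarrow> real) \<Rightarrow> 'a \<Rightarrow> 'a \<Rightarrow> complex"
  where "levi_form r x v = dhol v (dbar v (\<lambda>y. of_real (r y))) x"

text \<open>The sign refers to the side \<open>r < 0\<close>. For hypersurfaces of revolution with \<open>n \<ge> 2\<close>
  the Levi form always has a positive direction (with vanishing \<open>w\<close>-component), so it is
  definite if and only if it is positive definite.\<close>

definition strongly_pseudoconvex_at :: "('a::complex_normed_space \<Rightarrow> real) \<Rightarrow> 'a \<Rightarrow> bool"
  where "strongly_pseudoconvex_at r x \<longleftrightarrow>
    (\<forall>v\<in>complex_tangent_space r x. v \<noteq> 0 \<longrightarrow> Re (levi_form r x v) > 0)"

text \<open>A smooth CR map from a relatively open piece \<open>S\<close> of \<open>r = 0\<close> into \<open>r' = 0\<close>: its differential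
  maps complex tangent spaces into complex tangent spaces and commutes there with multiplication
  by \<open>\<i>\<close>. A derivative \<open>D\<close> within \<open>S\<close> is determined on the tangent space of \<open>S\<close>.\<close>

definition smooth_CR_map ::
    "('a::complex_normed_space \<Rightarrow> real) \<Rightarrow> 'a set \<Rightarrow> ('b::complex_normed_space \<Rightarrow> real) \<Rightarrow> ('a \<Rightarrow> 'b) \<Rightarrow> bool"
  where "smooth_CR_map r S r' F \<longleftrightarrow>
    smooth_on_subset F S \<and> (\<forall>x\<in>S. r' (F x) = 0) \<and>
    (\<forall>x\<in>S. \<exists>D. (F has_derivative D) (at x within S) \<and>
      (\<forall>v\<in>complex_tangent_space r x.
        D v \<in> complex_tangent_space r' (F x) \<and> D (\<i> *\<^sub>C v) = \<i> *\<^sub>C D v))"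

definition hermitian_form :: "complex ^ 'n ^ 'n \<Rightarrow> complex ^ 'n \<Rightarrow> complex"
  where "hermitian_form H z = (\<Sum>\<alpha>\<in>UNIV. \<Sum>\<beta>\<in>UNIV. H $ \<alpha> $ \<beta> * z $ \<alpha> * cnj (z $ \<beta>))"

definition positive_definite_hermitian :: "complex ^ 'n ^ 'n \<Rightarrow> bool"
  where "positive_definite_hermitian H \<longleftrightarrow>
    (\<forall>\<alpha> \<beta>. H $ \<beta> $ \<alpha> = cnj (H $ \<alpha> $ \<beta>)) \<and> (\<forall>z. z \<noteq> 0 \<longrightarrow> Re (hermitian_form H z) > 0)"

text \<open>\<open>r = p + q\<close>; \<open>p\<close> is real because \<open>H\<close> is Hermitian.\<close>

definition revolution_function ::
    "complex ^ 'n ^ 'n \<Rightarrow> (complex \<Rightarrow> real) \<Rightarrow> (complex ^ 'n) \<times> complex \<Rightarrow> real"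
  where "revolution_function H q = (\<lambda>(z, w). Re (hermitian_form H z) + q w)"

definition revolution_hypersurface ::
    "complex ^ 'n ^ 'n \<Rightarrow> (complex \<Rightarrow> real) \<Rightarrow> ((complex ^ 'n) \<times> complex) set"
  where "revolution_hypersurface H q = {x. revolution_function H q x = 0}"

text \<open>Mixed derivatives \<open>\<partial>\<^sup>2/\<partial>w\<partial>(cnj w)\<close> of smooth real functions are real, so
  \<^const>\<open>Re\<close> only changes the type.\<close>

definition metric_density :: "(complex \<Rightarrow> real) \<Rightarrow> complex \<Rightarrow> real"
  where "metric_density q w = - Re (dhol 1 (dbar 1 (\<lambda>u. of_real (ln \<bar>q u\<bar>))) w)"

definition gauss_curvature :: "(complex \<Rightarrow> real) \<Rightarrow> complex \<Rightarrow> real"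
  where "gauss_curvature h w = - (1 / h w) * Re (dhol 1 (dbar 1 (\<lambda>u. of_real (ln (h u)))) w)"

definition sphere_function :: "complex ^ 'm \<Rightarrow> real"
  where "sphere_function x = (norm x)\<^sup>2 - 1"

text \<open>\<open>V\<close> is the direction, hence the tangent space, of the complex affine subspace \<open>E\<close>.\<close>

definition complex_affine_subspace :: "(complex ^ 'm) set \<Rightarrow> (complex ^ 'm) set \<Rightarrow> bool"
  where "complex_affine_subspace E V \<longleftrightarrow> vec.subspace V \<and> (\<exists>a. E = (\<lambda>v. a + v) ` V)"

definition CR_transversal_sphere :: "(complex ^ 'm) set \<Rightarrow> (complex ^ 'm) set \<Rightarrow> bool"
  where "CR_transversal_sphere E V \<longleftrightarrow>
    (\<forall>x\<in>E \<inter> sphere 0 1. \<not> V \<subseteq> complex_tangent_space sphere_function x)"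

definition totally_geodesic_in_sphere :: "nat \<Rightarrow> (complex ^ 'm) set \<Rightarrow> bool"
  where "totally_geodesic_in_sphere d S \<longleftrightarrow>
    (\<exists>E V. complex_affine_subspace E V \<and> vec.dim V = d \<and> CR_transversal_sphere E V \<and>
      openin (top_of_set (E \<inter> sphere 0 1)) S)"

end

theory Submission imports Defs begin

text \<open>
  Over \<open>U\<^sub>0\<close> the hypersurface is parametrized by the trivial circle bundle of the Kaehler
  potential \<open>\<Psi> = ln p(y) + \<psi>(w)\<close>, \<open>\<psi> = - ln (- q)\<close>, through
  \<open>((y, w), t) \<mapsto> (exp (\<i> t - \<Psi> / 2) y, w)\<close>; its base metric is the sum of the
  Fubini-Study metric and \<open>h\<close>. For a CR map \<open>f\<close> into the sphere, the Gauss equation for the part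
  \<open>\<phi>(X)\<close> of \<open>L\<^sub>X L\<^sub>X f\<close> normal to \<open>f\<close> and to the \<open>L\<^sub>Y f\<close> reads: \<open>\<langle>\<phi>(X), \<phi>(Y)\<rangle>\<close> is a multiple of
  \<open>- (K + 2) x\<^sup>2 (cnj y)\<^sup>2\<close> whenever \<open>X\<close> and \<open>Y\<close> are orthogonal (\<open>x\<close>, \<open>y\<close> their \<open>w\<close>-components). If
  \<open>K \<ge> - 2\<close>, adding one dimension with the component \<open>s x\<^sup>2\<close> makes the extended \<open>\<phi>\<close> map orthogonal vectors
  to orthogonal vectors, and since \<open>N \<le> 2 n - 2\<close> there is no room for such a quadratic map
  except \<open>0\<close>. Hence \<open>K = - 2\<close> and the second fundamental form vanishes. The structure equations then
  form a closed linear system, so the complex span of the \<open>L\<^sub>X f\<close> and the characteristic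
  direction is parallel; the energy built from the equations also prevents the transversality factor
  of \<open>f\<close> from vanishing somewhere without vanishing everywhere.\<close>

section \<open>Smooth functions\<close>

text \<open>The coordinate \<open>y\<close> stays homogeneous, in \<open>C^n\<close> minus the
  origin. This gives one global frame \<open>L X\<close>, complex linear in the constant vector
  \<open>X\<close>, at the price of a degenerate radial direction in which \<open>L\<close> kills
  \<open>f\<close>. The only noncommuting pair is \<open>Lb Y\<close>, \<open>L X\<close>, with
  commutator \<open>g X Y\<close> times i d/dt. The count behind N <= 2n - 2: in the enlarged space
  of dimension N + 2, the vector \<open>f\<close> and the n tangent directions leave N + 1 - n <= n
  - 1 dimensions for the values of \<open>\<phi>\<close>, fewer than the n members of an orthogonal
  basis of the tangent space. The obstacle is that the structure equations divide by
  \<open>lam\<close>, whose zero set is unknown, while \<open>M0\<close> is only connected. The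
  quantities \<open>rho\<close> (minus the logarithmic derivative of \<open>lam\<close>) and
  \<open>tau\<close> satisfy equations of Riccati type, which could blow up. With the weight
  1/\<open>lam\<close> the cubic terms in the derivatives of their squares cancel, as if (1,
  \<open>tau\<close>, \<open>rho\<close>)/sqrt(\<open>lam\<close>) solved a linear system, so
  1/\<open>lam\<close> stays bounded along segments.\<close>

lemma Ck_on_imp_continuous_on: "Ck_on k f U \<Longrightarrow> continuous_on U f"
  by (cases k) (auto intro: differentiable_imp_continuous_within continuous_at_imp_continuous_on)

lemma Ck_on_Suc_imp: "Ck_on (Suc k) f U \<Longrightarrow> Ck_on k f U"
proof (induction k arbitrary: f)
  case 0
  then show ?case using Ck_on_imp_continuous_on[OF 0] by simp
next
  case (Suc k)
  then show ?case by (simp only: Ck_on.simps) blast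
qed

lemma frechet_derivative_cong_open:
  assumes "open U" "x \<in> U" "\<And>y. y \<in> U \<Longrightarrow> f y = g y"
  shows "frechet_derivative f (at x) = frechet_derivative g (at x)"
proof -
  have "(f has_derivative D) (at x) = (g has_derivative D) (at x)" for D
    using assms has_derivative_transform_within_open[of f D x UNIV U g]
      has_derivative_transform_within_open[of g D x UNIV U f] by auto
  then show ?thesis unfolding frechet_derivative_def by simp
qed

lemma differentiable_cong_open:
  assumes "open U" "x \<in> U" "\<And>y. y \<in> U \<Longrightarrow> f y = g y" "f differentiable (at x)"
  shows "g differentiable (at x)"
  using assms has_derivative_transform_within_open[of f _ x UNIV U g]
  unfolding differentiable_def by blast

lemma Ck_on_cong:
  assumes "open U" "\<And>y. y \<in> U \<Longrightarrow> f y = g y" "Ck_on k f U"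
  shows "Ck_on k g U"
  using assms(2,3)
proof (induction k arbitrary: f g)
  case 0
  then show ?case using continuous_on_cong[of U U f g] by simp
next
  case (Suc k)
  have "g differentiable at x" if "x \<in> U" for x
    using differentiable_cong_open[OF assms(1) that Suc.prems(1)] Suc.prems(2) that by auto
  moreover have "Ck_on k (\<lambda>x. frechet_derivative g (at x) v) U" for v
  proof (rule Suc.IH)
    show "frechet_derivative f (at y) v = frechet_derivative g (at y) v" if "y \<in> U" for y
      using frechet_derivative_cong_open[OF assms(1) that Suc.prems(1)] by simp
    show "Ck_on k (\<lambda>x. frechet_derivative f (at x) v) U"
      using Suc.prems(2) by simp
  qed
  ultimately show ?case by simp
qed

lemma Ck_on_subset: "Ck_on k f U \<Longrightarrow> V \<subseteq> U \<Longrightarrow> Ck_on k f V"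
  by (induction k arbitrary: f) (auto intro: continuous_on_subset)

text \<open>\<open>Ck_on\<close> refers to \<open>frechet_derivative\<close>; this rule accepts any
  formula for the derivative, so each closure property below becomes a derivative rule plus an
  induction on \<open>k\<close>.\<close>

lemma Ck_on_SucI:
  assumes "open U" "\<And>x. x \<in> U \<Longrightarrow> (f has_derivative f' x) (at x)"
    and "\<And>v. Ck_on k (\<lambda>x. f' x v) U"
  shows "Ck_on (Suc k) f U"
proof -
  have "frechet_derivative f (at x) = f' x" if "x \<in> U" for x
    using frechet_derivative_at[OF assms(2)[OF that]] by simp
  then have "Ck_on k (\<lambda>x. frechet_derivative f (at x) v) U" for v
    by (intro Ck_on_cong[OF assms(1) _ assms(3)[of v]]) auto
  then show ?thesis using assms(2) by (auto simp: differentiable_def)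
qed

lemma Ck_on_const: "Ck_on k (\<lambda>x. c) U"
  by (induction k arbitrary: c) auto

lemma Ck_on_bounded_linear:
  assumes "bounded_linear h" "open U" "Ck_on k f U"
  shows "Ck_on k (\<lambda>x. h (f x)) U"
  using assms(3)
proof (induction k arbitrary: f)
  case 0
  then show ?case using bounded_linear.continuous_on[OF assms(1)] by simp
next
  case (Suc k)
  have "(f has_derivative frechet_derivative f (at x)) (at x)" if "x \<in> U" for x
    using Suc.prems that frechet_derivative_works by auto
  then have "((\<lambda>x. h (f x)) has_derivative (\<lambda>v. h (frechet_derivative f (at x) v))) (at x)" if "x \<in> U" for x
    using bounded_linear.has_derivative[OF assms(1)] that by blast
  then show ?case
    by (rule Ck_on_SucI[OF assms(2)]) (use Suc in auto)
qed

lemma Ck_on_add: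
  assumes "open U" "Ck_on k f U" "Ck_on k g U"
  shows "Ck_on k (\<lambda>x. f x + g x) U"
  using assms(2,3)
proof (induction k arbitrary: f g)
  case 0
  then show ?case by (simp add: continuous_on_add)
next
  case (Suc k)
  have "((\<lambda>x. f x + g x) has_derivative (\<lambda>v. frechet_derivative f (at x) v + frechet_derivative g (at x) v)) (at x)"
    if "x \<in> U" for x
    using Suc.prems that by (auto intro!: has_derivative_add simp: frechet_derivative_works[symmetric])
  then show ?case
    by (rule Ck_on_SucI[OF assms(1)]) (use Suc in auto)
qed

lemma Ck_on_bilinear:
  assumes "bounded_bilinear B" "open U" "Ck_on k f U" "Ck_on k g U"
  shows "Ck_on k (\<lambda>x. B (f x) (g x)) U"
  using assms(3,4)
proof (induction k arbitrary: f g)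
  case 0
  then show ?case using bounded_bilinear.continuous_on[OF assms(1)] by simp
next
  case (Suc k)
  have "((\<lambda>x. B (f x) (g x)) has_derivative
      (\<lambda>v. B (f x) (frechet_derivative g (at x) v) + B (frechet_derivative f (at x) v) (g x))) (at x)"
    if "x \<in> U" for x
    using Suc.prems that
    by (intro bounded_bilinear.FDERIV[OF assms(1)]) (auto simp: frechet_derivative_works[symmetric])
  then show ?case
    by (rule Ck_on_SucI[OF assms(2)])
      (use Suc Ck_on_Suc_imp[OF Suc.prems(1)] Ck_on_Suc_imp[OF Suc.prems(2)] in
        \<open>auto intro!: Ck_on_add assms(2)\<close>)
qed

lemma Ck_on_sum:
  assumes "open U" "\<And>i. i \<in> I \<Longrightarrow> Ck_on k (f i) U"
  shows "Ck_on k (\<lambda>x. \<Sum>i\<in>I. f i x) U"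
  using assms(2)
  by (induction I rule: infinite_finite_induct) (auto simp: Ck_on_const intro!: Ck_on_add assms(1))

text \<open>The chain rule evaluates the derivative of \<open>g\<close> in a direction that moves
  with \<open>x\<close>, while \<open>Ck_on\<close> controls fixed directions only. Hence the
  expansion in \<open>Basis\<close> and the Euclidean middle space.\<close>

lemma Ck_on_compose:
  fixes f :: "'a::real_normed_vector \<Rightarrow> 'b::euclidean_space"
  assumes "open U" "open V" "f ` U \<subseteq> V" "Ck_on k f U" "Ck_on k g V"
  shows "Ck_on k (\<lambda>x. g (f x)) U"
  using assms(4,5)
proof (induction k arbitrary: g)
  case 0
  then show ?case using continuous_on_compose2[of V g U f] assms by simp
next
  case (Suc k)
  have df: "(f has_derivative frechet_derivative f (at x)) (at x)" if "x \<in> U" for x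
    using Suc.prems(1) that frechet_derivative_works by auto
  have dg: "(g has_derivative frechet_derivative g (at (f x))) (at (f x))" if "x \<in> U" for x
    using Suc.prems(2) assms(3) that frechet_derivative_works by auto
  have D: "((\<lambda>x. g (f x)) has_derivative
      (\<lambda>v. \<Sum>b\<in>Basis. (frechet_derivative f (at x) v \<bullet> b) *\<^sub>R frechet_derivative g (at (f x)) b)) (at x)"
    if "x \<in> U" for x
  proof -
    have "linear (frechet_derivative g (at (f x)))"
      using dg[OF that] has_derivative_linear by blast
    then have "frechet_derivative g (at (f x)) u = (\<Sum>b\<in>Basis. (u \<bullet> b) *\<^sub>R frechet_derivative g (at (f x)) b)" for u
      by (subst euclidean_representation[of u, symmetric], simp only: linear_sum linear_cmul)
    then have "(\<lambda>v. frechet_derivative g (at (f x)) (frechet_derivative f (at x) v)) =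
      (\<lambda>v. \<Sum>b\<in>Basis. (frechet_derivative f (at x) v \<bullet> b) *\<^sub>R frechet_derivative g (at (f x)) b)"
      by (intro ext)
    then show ?thesis using has_derivative_compose[OF df[OF that] dg[OF that]] by (simp only:)
  qed
  have f: "Ck_on k f U" and fd: "Ck_on k (\<lambda>x. frechet_derivative f (at x) v) U" for v
    using Ck_on_Suc_imp Suc.prems(1) by auto
  have gd: "Ck_on k (\<lambda>y. frechet_derivative g (at y) b) V" for b
    using Suc.prems(2) by simp
  have "Ck_on k (\<lambda>x. (frechet_derivative f (at x) v \<bullet> b) *\<^sub>R frechet_derivative g (at (f x)) b) U" for v b
    by (rule Ck_on_bilinear[OF bounded_bilinear_scaleR assms(1)
        Ck_on_bounded_linear[OF bounded_linear_inner_left assms(1) fd] Suc.IH[OF f gd]])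
  then have S: "Ck_on k (\<lambda>x. \<Sum>b\<in>Basis. (frechet_derivative f (at x) v \<bullet> b) *\<^sub>R frechet_derivative g (at (f x)) b) U" for v
    by (rule Ck_on_sum[OF assms(1)])
  show ?case by (rule Ck_on_SucI[OF assms(1) D S])
qed

lemma Ck_on_inverse: "Ck_on k (inverse :: 'a::real_normed_field \<Rightarrow> 'a) (- {0})"
proof (induction k)
  case 0
  then show ?case using continuous_on_inverse[OF continuous_on_id, of "- {0 :: 'a}"] by simp
next
  case (Suc k)
  have "Ck_on k (\<lambda>x::'a. - (inverse x * v * inverse x)) (- {0})" for v
    by (rule Ck_on_bounded_linear[OF bounded_linear_minus[OF bounded_linear_ident]])
      (auto intro!: Ck_on_bilinear[OF bounded_bilinear_mult] Suc Ck_on_const)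
  then show ?case
    by (intro Ck_on_SucI[OF _ has_derivative_inverse']) auto
qed

lemma Ck_on_exp: "Ck_on k (exp :: 'a::{real_normed_field,banach} \<Rightarrow> 'a) UNIV"
proof (induction k)
  case 0
  show ?case unfolding Ck_on.simps
    by (rule continuous_at_imp_continuous_on) (blast intro: isCont_exp)
next
  case (Suc k)
  have 1: "Ck_on k (\<lambda>x::'a. exp x * v) UNIV" for v
    using Ck_on_bilinear[OF bounded_bilinear_mult open_UNIV Suc Ck_on_const[of k v]] .
  have 2: "(exp has_derivative (\<lambda>v. exp x * v)) (at x)" for x :: 'a
    using DERIV_exp[of x] unfolding has_field_derivative_def by simp
  show ?case
    by (rule Ck_on_SucI[where f'="\<lambda>x v. exp x * v", OF open_UNIV 2 1])
qed

lemma Ck_on_ln: "Ck_on k (ln :: real \<Rightarrow> real) {0<..}"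
proof (cases k)
  case 0
  then show ?thesis by (auto intro!: continuous_on_ln continuous_on_id)
next
  case (Suc j)
  have inv: "Ck_on j (inverse :: real \<Rightarrow> real) {0<..}"
    by (rule Ck_on_subset[OF Ck_on_inverse]) auto
  have 1: "Ck_on j (\<lambda>x::real. inverse x * v) {0<..}" for v
    using Ck_on_bilinear[OF bounded_bilinear_mult open_greaterThan inv Ck_on_const[of j v]] .
  have 2: "(ln has_derivative (\<lambda>v. inverse x * v)) (at x)" if "x \<in> {0<..}" for x :: real
    using DERIV_ln[of x] that unfolding has_field_derivative_def by simp
  show ?thesis
    unfolding Suc by (rule Ck_on_SucI[where f'="\<lambda>x v. inverse x * v", OF open_greaterThan 2 1])
qed

lemma smooth_on_cong:
  "open U \<Longrightarrow> (\<And>y. y \<in> U \<Longrightarrow> f y = g y) \<Longrightarrow> smooth_on f U \<Longrightarrow> smooth_on g U"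
  unfolding smooth_on_def by (intro allI Ck_on_cong[of U f g]) auto

lemma smooth_on_subset: "smooth_on f U \<Longrightarrow> V \<subseteq> U \<Longrightarrow> smooth_on f V"
  unfolding smooth_on_def using Ck_on_subset by blast

lemma smooth_on_const: "smooth_on (\<lambda>x. c) U"
  unfolding smooth_on_def by (simp add: Ck_on_const)

lemma smooth_on_ident: "open U \<Longrightarrow> smooth_on (\<lambda>x. x) U"
  unfolding smooth_on_def
proof
  fix k assume "open U"
  show "Ck_on k (\<lambda>x. x) U"
  proof (cases k)
    case (Suc j)
    show ?thesis unfolding Suc
      by (rule Ck_on_SucI[OF \<open>open U\<close> has_derivative_ident Ck_on_const])
  qed auto
qed

lemma smooth_on_bounded_linear:
  "bounded_linear h \<Longrightarrow> open U \<Longrightarrow> smooth_on f U \<Longrightarrow> smooth_on (\<lambda>x. h (f x)) U"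
  unfolding smooth_on_def by (intro allI Ck_on_bounded_linear[where h=h and f=f]) auto

lemma smooth_on_bilinear:
  "bounded_bilinear B \<Longrightarrow> open U \<Longrightarrow> smooth_on f U \<Longrightarrow> smooth_on g U \<Longrightarrow> smooth_on (\<lambda>x. B (f x) (g x)) U"
  unfolding smooth_on_def by (intro allI Ck_on_bilinear[where B=B and f=f and g=g]) auto

lemma smooth_on_add:
  "open U \<Longrightarrow> smooth_on f U \<Longrightarrow> smooth_on g U \<Longrightarrow> smooth_on (\<lambda>x. f x + g x) U"
  unfolding smooth_on_def by (intro allI Ck_on_add[where f=f and g=g]) auto

lemmas smooth_on_minus = smooth_on_bounded_linear[OF bounded_linear_minus[OF bounded_linear_ident]]

lemma smooth_on_diff:
  "open U \<Longrightarrow> smooth_on f U \<Longrightarrow> smooth_on g U \<Longrightarrow> smooth_on (\<lambda>x. f x - g x) U"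
  using smooth_on_add[of U f "\<lambda>x. - g x", OF _ _ smooth_on_minus] by simp

lemma smooth_on_sum:
  "open U \<Longrightarrow> (\<And>i. i \<in> I \<Longrightarrow> smooth_on (f i) U) \<Longrightarrow> smooth_on (\<lambda>x. \<Sum>i\<in>I. f i x) U"
  unfolding smooth_on_def by (intro allI Ck_on_sum[where f=f]) auto

lemmas smooth_on_mult = smooth_on_bilinear[OF bounded_bilinear_mult]

lemma smooth_on_compose:
  fixes f :: "'a::real_normed_vector \<Rightarrow> 'b::euclidean_space"
  shows "open U \<Longrightarrow> open V \<Longrightarrow> f ` U \<subseteq> V \<Longrightarrow> smooth_on f U \<Longrightarrow> smooth_on g V \<Longrightarrow> smooth_on (\<lambda>x. g (f x)) U"
  unfolding smooth_on_def by (intro allI Ck_on_compose[where f=f and g=g and V=V]) auto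

lemma smooth_on_inverse:
  fixes f :: "'a::real_normed_vector \<Rightarrow> 'b::{euclidean_space,real_normed_field}"
  shows "open U \<Longrightarrow> smooth_on f U \<Longrightarrow> (\<And>x. x \<in> U \<Longrightarrow> f x \<noteq> 0) \<Longrightarrow> smooth_on (\<lambda>x. inverse (f x)) U"
  by (rule smooth_on_compose[where V="- {0}" and g=inverse and f=f]) (auto simp: smooth_on_def Ck_on_inverse)

lemma smooth_on_divide:
  fixes f :: "'a::real_normed_vector \<Rightarrow> 'b::{euclidean_space,real_normed_field}"
  shows "open U \<Longrightarrow> smooth_on g U \<Longrightarrow> smooth_on f U \<Longrightarrow> (\<And>x. x \<in> U \<Longrightarrow> f x \<noteq> 0) \<Longrightarrow> smooth_on (\<lambda>x. g x / f x) U"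
  unfolding divide_inverse by (rule smooth_on_mult[OF _ _ smooth_on_inverse])

lemma smooth_on_exp:
  fixes f :: "'a::real_normed_vector \<Rightarrow> 'b::{euclidean_space,real_normed_field,banach}"
  shows "open U \<Longrightarrow> smooth_on f U \<Longrightarrow> smooth_on (\<lambda>x. exp (f x)) U"
  by (rule smooth_on_compose[where V=UNIV]) (auto simp: smooth_on_def Ck_on_exp)

lemma smooth_on_ln:
  fixes f :: "'a::real_normed_vector \<Rightarrow> real"
  shows "open U \<Longrightarrow> smooth_on f U \<Longrightarrow> (\<And>x. x \<in> U \<Longrightarrow> f x > 0) \<Longrightarrow> smooth_on (\<lambda>x. ln (f x)) U"
  by (rule smooth_on_compose[where V="{0<..}" and g=ln and f=f]) (auto simp: smooth_on_def Ck_on_ln)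

lemma smooth_on_has_derivative:
  "smooth_on f U \<Longrightarrow> x \<in> U \<Longrightarrow> (f has_derivative frechet_derivative f (at x)) (at x)"
  unfolding smooth_on_def frechet_derivative_works[symmetric] by (elim allE[of _ "Suc 0"]) simp

lemma smooth_on_frechet_derivative:
  "smooth_on f U \<Longrightarrow> smooth_on (\<lambda>x. frechet_derivative f (at x) v) U"
  unfolding smooth_on_def
proof
  fix k assume "\<forall>k. Ck_on k f U"
  from this[rule_format, of "Suc k"] show "Ck_on k (\<lambda>x. frechet_derivative f (at x) v) U" by simp
qed

lemma smooth_on_imp_continuous_on: "smooth_on f U \<Longrightarrow> continuous_on U f"
  unfolding smooth_on_def using Ck_on_imp_continuous_on by blast

text \<open>Smoothness on \<open>M0\<close> is given by local extensions that change from point to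
  point; this lemma glues the resulting local statements.\<close>

lemma smooth_on_local:
  assumes "open U" "\<And>x. x \<in> U \<Longrightarrow> \<exists>V. open V \<and> x \<in> V \<and> smooth_on f V"
  shows "smooth_on f U"
proof -
  have "Ck_on k f U" if "\<And>x. x \<in> U \<Longrightarrow> \<exists>V. open V \<and> x \<in> V \<and> Ck_on k f V" for k
    using that
  proof (induction k arbitrary: f)
    case 0
    then show ?case
      by (auto simp: continuous_on_eq_continuous_at[OF assms(1)])
        (metis continuous_on_eq_continuous_at)
  next
    case (Suc k)
    then show ?case by simp metis
  qed
  then show ?thesis using assms(2) unfolding smooth_on_def by blast
qed

subsection \<open>Symmetry of second derivatives\<close>

lemma smooth_on_inner_const:
  fixes f :: "'a::real_normed_vector \<Rightarrow> 'b::euclidean_space"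
  assumes "open U" "smooth_on f U" "x \<in> U"
  shows "frechet_derivative (\<lambda>x. f x \<bullet> b) (at x) v = frechet_derivative f (at x) v \<bullet> b"
  using frechet_derivative_at[OF bounded_linear.has_derivative[OF bounded_linear_inner_left
        smooth_on_has_derivative[OF assms(2,3)], of b]] by metis

text \<open>The second difference on the left is symmetric in \<open>u\<close> and \<open>v\<close>.
  The mean value theorem, first along \<open>u\<close> and then along \<open>v\<close>, turns it
  into one mixed derivative at a nearby point; exchanging the roles gives the other one.\<close>

lemma second_difference_mvt:
  fixes f :: "'a::real_normed_vector \<Rightarrow> real"
  assumes "open U" "smooth_on f U" "h > 0"
    and "\<And>s t. 0 \<le> s \<Longrightarrow> s \<le> h \<Longrightarrow> 0 \<le> t \<Longrightarrow> t \<le> h \<Longrightarrow> x + s *\<^sub>R u + t *\<^sub>R v \<in> U"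
  shows "\<exists>s t. 0 < s \<and> s < h \<and> 0 < t \<and> t < h \<and>
    f (x + h *\<^sub>R u + h *\<^sub>R v) - f (x + h *\<^sub>R u) - f (x + h *\<^sub>R v) + f x =
    h * h * frechet_derivative (\<lambda>y. frechet_derivative f (at y) u) (at (x + s *\<^sub>R u + t *\<^sub>R v)) v"
proof -
  let ?D = "\<lambda>w y. frechet_derivative f (at y) w"
  let ?phi = "\<lambda>s. f (x + s *\<^sub>R u + h *\<^sub>R v) - f (x + s *\<^sub>R u)"
  have lin: "linear (frechet_derivative f (at y))" if "y \<in> U" for y
    using smooth_on_has_derivative[OF assms(2) that] has_derivative_linear by blast
  have d1: "((\<lambda>s. f (x + s *\<^sub>R u + t *\<^sub>R v)) has_real_derivative ?D u (x + s *\<^sub>R u + t *\<^sub>R v)) (at s)"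
    if "0 \<le> s" "s \<le> h" "0 \<le> t" "t \<le> h" for s t
  proof -
    have U: "x + s *\<^sub>R u + t *\<^sub>R v \<in> U" using assms(4) that by simp
    have "((\<lambda>s. x + s *\<^sub>R u + t *\<^sub>R v) has_derivative (\<lambda>k. k *\<^sub>R u)) (at s)"
      by (auto intro!: derivative_eq_intros)
    from has_derivative_compose[OF this smooth_on_has_derivative[OF assms(2) U]]
    show ?thesis unfolding has_field_derivative_def
      by (rule has_derivative_eq_rhs) (simp add: linear_cmul[OF lin[OF U]] mult.commute fun_eq_iff)
  qed
  have "(?phi has_real_derivative ?D u (x + s *\<^sub>R u + h *\<^sub>R v) - ?D u (x + s *\<^sub>R u)) (at s)"
    if "0 \<le> s" "s \<le> h" for s
    using d1[OF that, of h] d1[OF that, of 0] assms(3) by (intro derivative_intros) auto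
  then obtain s where s: "0 < s" "s < h" and
    e1: "?phi h - ?phi 0 = h * (?D u (x + s *\<^sub>R u + h *\<^sub>R v) - ?D u (x + s *\<^sub>R u))"
    using MVT2[of 0 h ?phi "\<lambda>s. ?D u (x + s *\<^sub>R u + h *\<^sub>R v) - ?D u (x + s *\<^sub>R u)"] assms(3) by auto
  let ?E = "\<lambda>y. frechet_derivative (?D u) (at y) v"
  have d2: "((\<lambda>t. ?D u (x + s *\<^sub>R u + t *\<^sub>R v)) has_real_derivative ?E (x + s *\<^sub>R u + t *\<^sub>R v)) (at t)"
    if "0 \<le> t" "t \<le> h" for t
  proof -
    have U: "x + s *\<^sub>R u + t *\<^sub>R v \<in> U" using assms(4) that s by simp
    have sm: "smooth_on (?D u) U" using smooth_on_frechet_derivative[OF assms(2)] .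
    have "((\<lambda>t. x + s *\<^sub>R u + t *\<^sub>R v) has_derivative (\<lambda>k. k *\<^sub>R v)) (at t)"
      by (auto intro!: derivative_eq_intros)
    note has_derivative_compose[OF this smooth_on_has_derivative[OF sm U]]
    moreover have "linear (frechet_derivative (?D u) (at (x + s *\<^sub>R u + t *\<^sub>R v)))"
      using smooth_on_has_derivative[OF sm U] has_derivative_linear by blast
    ultimately show ?thesis unfolding has_field_derivative_def
      by (elim has_derivative_eq_rhs) (simp add: linear_cmul mult.commute fun_eq_iff)
  qed
  then obtain t where t: "0 < t" "t < h" and
    e2: "?D u (x + s *\<^sub>R u + h *\<^sub>R v) - ?D u (x + s *\<^sub>R u + 0 *\<^sub>R v) = h * ?E (x + s *\<^sub>R u + t *\<^sub>R v)"
    using MVT2[of 0 h "\<lambda>t. ?D u (x + s *\<^sub>R u + t *\<^sub>R v)" "\<lambda>t. ?E (x + s *\<^sub>R u + t *\<^sub>R v)"] assms(3) by auto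
  show ?thesis
    using s t e1 e2 by (intro exI[of _ s] exI[of _ t]) (simp add: algebra_simps)
qed

lemma second_derivative_symmetric_real:
  fixes f :: "'a::real_normed_vector \<Rightarrow> real"
  assumes "open U" "smooth_on f U" "x \<in> U"
  shows "frechet_derivative (\<lambda>y. frechet_derivative f (at y) u) (at x) v =
    frechet_derivative (\<lambda>y. frechet_derivative f (at y) v) (at x) u"
proof (rule ccontr)
  let ?A = "\<lambda>x. frechet_derivative (\<lambda>y. frechet_derivative f (at y) u) (at x) v"
  let ?B = "\<lambda>x. frechet_derivative (\<lambda>y. frechet_derivative f (at y) v) (at x) u"
  assume ne: "?A x \<noteq> ?B x"
  define e where "e = \<bar>?A x - ?B x\<bar> / 2"
  have e: "e > 0" using ne by (simp add: e_def)
  have "continuous_on U ?A" "continuous_on U ?B"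
    using assms(2) by (auto intro!: smooth_on_imp_continuous_on smooth_on_frechet_derivative)
  then have "isCont ?A x" "isCont ?B x"
    using assms(1,3) continuous_on_eq_continuous_at by blast+
  then obtain d1 d2 where d: "d1 > 0" "d2 > 0"
    "\<And>y. dist y x < d1 \<Longrightarrow> dist (?A y) (?A x) < e" "\<And>y. dist y x < d2 \<Longrightarrow> dist (?B y) (?B x) < e"
    using e unfolding continuous_at_eps_delta by metis
  obtain d3 where d3: "d3 > 0" "ball x d3 \<subseteq> U" using assms(1,3) open_contains_ball by blast
  define m where "m = norm u + norm v + 1"
  \<comment> \<open>With the factor \<open>2 * m\<close> every point
    \<open>x + s *\<^sub>R u + t *\<^sub>R v\<close> with \<open>s\<close>, \<open>t\<close> up to
    \<open>h\<close> stays within half of the smallest of the three radii.\<close>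
  define h where "h = min (min d1 d2) d3 / (2 * m)"
  have m: "m > 0" by (simp add: m_def add_nonneg_pos)
  have h: "h > 0" using d d3 m by (simp add: h_def)
  have near: "dist (x + s *\<^sub>R u + t *\<^sub>R v) x < min (min d1 d2) d3" if "0 \<le> s" "s \<le> h" "0 \<le> t" "t \<le> h" for s t
  proof -
    have "dist (x + s *\<^sub>R u + t *\<^sub>R v) x = norm (s *\<^sub>R u + t *\<^sub>R v)" by (simp add: dist_norm add.assoc)
    also have "\<dots> \<le> s * norm u + t * norm v" using that by (intro norm_triangle_le) simp
    also have "\<dots> \<le> h * norm u + h * norm v" using that by (intro add_mono mult_right_mono) auto
    also have "\<dots> \<le> h * m" using h by (simp add: m_def algebra_simps)
    also have "\<dots> = min (min d1 d2) d3 / 2" using m by (simp add: h_def)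
    also have "\<dots> < min (min d1 d2) d3" using d d3 by linarith
    finally show ?thesis .
  qed
  then have inU: "x + s *\<^sub>R u + t *\<^sub>R v \<in> U" if "0 \<le> s" "s \<le> h" "0 \<le> t" "t \<le> h" for s t
    using that d3 by (metis dist_commute mem_ball min_less_iff_conj subsetD)
  then have inU': "x + t *\<^sub>R v + s *\<^sub>R u \<in> U" if "0 \<le> t" "t \<le> h" "0 \<le> s" "s \<le> h" for s t
    using that by (metis add.assoc add.commute)
  obtain s t where A: "0 < s" "s < h" "0 < t" "t < h"
    "f (x + h *\<^sub>R u + h *\<^sub>R v) - f (x + h *\<^sub>R u) - f (x + h *\<^sub>R v) + f x = h * h * ?A (x + s *\<^sub>R u + t *\<^sub>R v)"
    using second_difference_mvt[OF assms(1,2) h inU] by blast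
  obtain t' s' where B: "0 < t'" "t' < h" "0 < s'" "s' < h"
    "f (x + h *\<^sub>R v + h *\<^sub>R u) - f (x + h *\<^sub>R v) - f (x + h *\<^sub>R u) + f x = h * h * ?B (x + t' *\<^sub>R v + s' *\<^sub>R u)"
    using second_difference_mvt[OF assms(1,2) h inU'] by blast
  have "f (x + h *\<^sub>R v + h *\<^sub>R u) = f (x + h *\<^sub>R u + h *\<^sub>R v)"
    by (rule arg_cong[of _ _ f]) (simp add: algebra_simps)
  then have "h * h * ?A (x + s *\<^sub>R u + t *\<^sub>R v) = h * h * ?B (x + t' *\<^sub>R v + s' *\<^sub>R u)"
    using A(5) B(5) by linarith
  then have eq: "?A (x + s *\<^sub>R u + t *\<^sub>R v) = ?B (x + t' *\<^sub>R v + s' *\<^sub>R u)" using h by simp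
  have "dist (x + t' *\<^sub>R v + s' *\<^sub>R u) x < min (min d1 d2) d3"
    using near[of s' t'] B by (simp add: algebra_simps)
  then have "dist (?B (x + t' *\<^sub>R v + s' *\<^sub>R u)) (?B x) < e" using d(4) by simp
  moreover have "dist (?A (x + s *\<^sub>R u + t *\<^sub>R v)) (?A x) < e" using d(3) near[of s t] A by simp
  ultimately have "\<bar>?A x - ?B x\<bar> < 2 * e" using eq unfolding dist_real_def by linarith
  then show False by (simp add: e_def)
qed

lemma second_derivative_symmetric:
  fixes f :: "'a::real_normed_vector \<Rightarrow> 'b::euclidean_space"
  assumes "open U" "smooth_on f U" "x \<in> U"
  shows "frechet_derivative (\<lambda>y. frechet_derivative f (at y) u) (at x) v =
    frechet_derivative (\<lambda>y. frechet_derivative f (at y) v) (at x) u"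
proof (rule euclidean_eqI)
  fix b :: 'b assume "b \<in> Basis"
  have *: "frechet_derivative (\<lambda>y. frechet_derivative (\<lambda>x. f x \<bullet> b) (at y) u) (at x) v =
      frechet_derivative (\<lambda>y. frechet_derivative f (at y) u) (at x) v \<bullet> b" for u v
  proof -
    have "frechet_derivative (\<lambda>y. frechet_derivative (\<lambda>x. f x \<bullet> b) (at y) u) (at x) =
       frechet_derivative (\<lambda>y. frechet_derivative f (at y) u \<bullet> b) (at x)"
      by (rule frechet_derivative_cong_open[OF assms(1,3)]) (simp add: smooth_on_inner_const[OF assms(1,2)])
    then show ?thesis
      using smooth_on_inner_const[OF assms(1) smooth_on_frechet_derivative[OF assms(2)] assms(3)] by metis
  qed
  have "smooth_on (\<lambda>x. f x \<bullet> b) U"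
    by (rule smooth_on_bounded_linear[OF bounded_linear_inner_left assms(1,2)])
  from second_derivative_symmetric_real[OF assms(1) this assms(3), of u v]
  show "frechet_derivative (\<lambda>y. frechet_derivative f (at y) u) (at x) v \<bullet> b =
    frechet_derivative (\<lambda>y. frechet_derivative f (at y) v) (at x) u \<bullet> b" unfolding * .
qed

section \<open>Complex scalars and the Hermitian product\<close>

lemma scaleC_complex [simp]: "c *\<^sub>C (x :: complex) = c * x"
  by (simp add: scaleC_complex_def)

lemma scaleC_vec_component [simp]: "(c *\<^sub>C x) $ i = c *\<^sub>C (x $ i)"
  by (simp add: scaleC_vec_def)

lemma scaleC_one [simp]: "1 *\<^sub>C x = x"
  using scaleC_of_real[of 1 x] by simp

lemma scaleC_zero_left [simp]: "0 *\<^sub>C x = 0"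
  using scaleC_of_real[of 0 x] by simp

lemma scaleC_zero_right [simp]: "c *\<^sub>C 0 = 0"
  using norm_scaleC[of c 0] by simp

lemma scaleC_minus_left: "(- c) *\<^sub>C x = - (c *\<^sub>C x)"
  using scaleC_add_left[of c "- c" x] by (simp add: eq_neg_iff_add_eq_0 add.commute)

lemma scaleC_minus_right: "c *\<^sub>C (- x) = - (c *\<^sub>C x)"
  using scaleC_add_right[of c x "- x"] by (simp add: eq_neg_iff_add_eq_0 add.commute)

lemma scaleC_diff_right: "c *\<^sub>C (x - y) = c *\<^sub>C x - c *\<^sub>C y"
  using scaleC_add_right[of c x "- y"] by (simp add: scaleC_minus_right)

lemma scaleC_diff_left: "(c - d) *\<^sub>C x = c *\<^sub>C x - d *\<^sub>C x"
  using scaleC_add_left[of c "- d" x] by (simp add: scaleC_minus_left)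

lemma scaleC_scaleR_left: "(r *\<^sub>R c) *\<^sub>C x = r *\<^sub>R (c *\<^sub>C x)"
  by (simp add: scaleR_conv_of_real flip: scaleC_scaleC scaleC_of_real)

lemma scaleC_scaleR_right: "c *\<^sub>C (r *\<^sub>R x) = r *\<^sub>R (c *\<^sub>C x)"
  by (simp add: scaleC_scaleC mult.commute flip: scaleC_of_real)

lemma bounded_bilinear_scaleC: "bounded_bilinear (\<lambda>c (x::'a::complex_normed_space). c *\<^sub>C x)"
  by (rule bounded_bilinear.intro)
    (auto simp: scaleC_add_left scaleC_add_right scaleC_scaleR_left scaleC_scaleR_right norm_scaleC intro!: exI[of _ 1])

lemma bounded_linear_scaleC_right: "bounded_linear (\<lambda>x::'a::complex_normed_space. c *\<^sub>C x)"
  by (rule bounded_bilinear.bounded_linear_right[OF bounded_bilinear_scaleC])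

lemmas scaleC_simps = scaleC_add_left scaleC_add_right scaleC_diff_left scaleC_diff_right
  scaleC_minus_left scaleC_minus_right scaleC_scaleC

definition hip :: "complex ^ 'm \<Rightarrow> complex ^ 'm \<Rightarrow> complex"
  where "hip u v = (\<Sum>i\<in>UNIV. u $ i * cnj (v $ i))"

lemma hip_add_left: "hip (u + v) x = hip u x + hip v x"
  by (simp add: hip_def algebra_simps sum.distrib)

lemma hip_add_right: "hip x (u + v) = hip x u + hip x v"
  by (simp add: hip_def algebra_simps sum.distrib)

lemma hip_scaleC_left: "hip (c *\<^sub>C u) x = c * hip u x"
  by (simp add: hip_def algebra_simps sum_distrib_left)

lemma hip_scaleC_right: "hip x (c *\<^sub>C u) = cnj c * hip x u"
  by (simp add: hip_def algebra_simps sum_distrib_left)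

lemma hip_minus_left: "hip (- u) x = - hip u x"
  by (simp add: hip_def sum_negf)

lemma hip_minus_right: "hip x (- u) = - hip x u"
  by (simp add: hip_def sum_negf)

lemma hip_diff_left: "hip (u - v) x = hip u x - hip v x"
  by (simp add: hip_def algebra_simps sum_subtractf)

lemma hip_diff_right: "hip x (u - v) = hip x u - hip x v"
  by (simp add: hip_def algebra_simps sum_subtractf)

lemma hip_zero_left [simp]: "hip 0 x = 0"
  by (simp add: hip_def)

lemma hip_zero_right [simp]: "hip x 0 = 0"
  by (simp add: hip_def)

lemma cnj_hip: "cnj (hip u v) = hip v u"
  by (simp add: hip_def mult.commute)

lemma Re_hip: "Re (hip u v) = u \<bullet> v"
  by (simp add: hip_def inner_vec_def inner_complex_def)

lemma hip_self: "hip u u = of_real ((norm u)\<^sup>2)"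
proof (rule complex_eqI)
  show "Re (hip u u) = Re (of_real ((norm u)\<^sup>2))"
    by (simp only: Re_hip dot_square_norm Re_complex_of_real)
  have "Im (hip u u) = - Im (hip u u)"
    using arg_cong[OF cnj_hip[of u u], of Im] by simp
  then show "Im (hip u u) = Im (of_real ((norm u)\<^sup>2))" by simp
qed

lemma hip_self_eq_0_iff [simp]: "hip u u = 0 \<longleftrightarrow> u = 0"
  by (simp add: hip_self)

lemma hip_eq_0_commute: "hip u v = 0 \<longleftrightarrow> hip v u = 0"
  by (metis cnj_hip complex_cnj_zero)

lemma hip_scaleR_left: "hip (r *\<^sub>R u) x = r *\<^sub>R hip u x"
  using hip_scaleC_left[of "of_real r" u x] unfolding scaleC_of_real by (simp add: scaleR_conv_of_real[of r "hip u x"])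

lemma hip_scaleR_right: "hip x (r *\<^sub>R u) = r *\<^sub>R hip x u"
  using hip_scaleC_right[of x "of_real r" u] unfolding scaleC_of_real by (simp add: scaleR_conv_of_real[of r "hip x u"])

lemmas hip_simps = hip_add_left hip_add_right hip_scaleC_left hip_scaleC_right hip_minus_left
  hip_minus_right hip_diff_left hip_diff_right

lemma bounded_bilinear_hip: "bounded_bilinear (hip :: complex ^ 'm \<Rightarrow> complex ^ 'm \<Rightarrow> complex)"
proof -
  have "bilinear (hip :: complex ^ 'm \<Rightarrow> _ \<Rightarrow> _)"
    unfolding bilinear_def linear_iff
    by (simp add: hip_add_left hip_add_right hip_scaleR_left hip_scaleR_right)
  then show ?thesis by (simp add: bilinear_conv_bounded_bilinear)
qed

section \<open>First-order complex differential operators\<close>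

text \<open>\<open>dz\<close>, \<open>dzb\<close>, \<open>dT\<close>, \<open>dhol\<close> and
  \<open>dbar\<close> are all combinations of two directional derivatives with complex coefficients,
  so one product rule and one commutation rule serve all of them.\<close>

definition cderiv ::
    "complex \<Rightarrow> complex \<Rightarrow> 'a \<Rightarrow> 'a \<Rightarrow> ('a::real_normed_vector \<Rightarrow> 'b::complex_normed_space) \<Rightarrow> 'a \<Rightarrow> 'b"
  where "cderiv a b r s f p =
    a *\<^sub>C frechet_derivative f (at p) r + b *\<^sub>C frechet_derivative f (at p) s"

lemma cderiv_cong:
  assumes "open W" "p \<in> W" "\<And>x. x \<in> W \<Longrightarrow> f x = g x"
  shows "cderiv a b r s f p = cderiv a b r s g p"
  using frechet_derivative_cong_open[of W p f g, OF assms] by (simp add: cderiv_def)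

lemma smooth_on_cderiv: "open W \<Longrightarrow> smooth_on f W \<Longrightarrow> smooth_on (cderiv a b r s f) W"
  unfolding cderiv_def
  by (rule smooth_on_add smooth_on_bounded_linear[OF bounded_linear_scaleC_right]
      smooth_on_frechet_derivative | assumption)+

lemma frechet_derivative_bilinear:
  assumes "bounded_bilinear B" "smooth_on f W" "smooth_on g W" "p \<in> W"
  shows "frechet_derivative (\<lambda>x. B (f x) (g x)) (at p) r =
    B (f p) (frechet_derivative g (at p) r) + B (frechet_derivative f (at p) r) (g p)"
  using frechet_derivative_at[OF bounded_bilinear.FDERIV[OF assms(1)
    smooth_on_has_derivative[OF assms(2,4)] smooth_on_has_derivative[OF assms(3,4)]]] by metis

lemma frechet_derivative_bounded_linear:
  assumes "bounded_linear h" "smooth_on f W" "p \<in> W"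
  shows "frechet_derivative (\<lambda>x. h (f x)) (at p) r = h (frechet_derivative f (at p) r)"
  using frechet_derivative_at[OF bounded_linear.has_derivative[OF assms(1)
    smooth_on_has_derivative[OF assms(2,3)]]] by metis

lemma frechet_derivative_add:
  assumes "smooth_on f W" "smooth_on g W" "p \<in> W"
  shows "frechet_derivative (\<lambda>x. f x + g x) (at p) r =
    frechet_derivative f (at p) r + frechet_derivative g (at p) r"
  using frechet_derivative_at[OF has_derivative_add[OF
    smooth_on_has_derivative[OF assms(1,3)] smooth_on_has_derivative[OF assms(2,3)]]] by metis

lemma cderiv_add:
  assumes "smooth_on f W" "smooth_on g W" "p \<in> W"
  shows "cderiv a b r s (\<lambda>x. f x + g x) p = cderiv a b r s f p + cderiv a b r s g p"
  unfolding cderiv_def frechet_derivative_add[OF assms] by (simp add: scaleC_simps algebra_simps)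

lemma cderiv_const [simp]: "cderiv a b r s (\<lambda>x. c) p = 0"
  by (simp add: cderiv_def)

lemma cderiv_scaleC:
  fixes g :: "'a::real_normed_vector \<Rightarrow> 'b::complex_normed_space"
  assumes "smooth_on f W" "smooth_on g W" "p \<in> W"
  shows "cderiv a b r s (\<lambda>x. f x *\<^sub>C g x) p = f p *\<^sub>C cderiv a b r s g p + cderiv a b r s f p *\<^sub>C g p"
  unfolding cderiv_def frechet_derivative_bilinear[OF bounded_bilinear_scaleC assms]
  by (simp add: scaleC_simps algebra_simps)

lemma cderiv_const_scaleC:
  fixes g :: "'a::real_normed_vector \<Rightarrow> 'b::complex_normed_space"
  assumes "smooth_on g W" "p \<in> W"
  shows "cderiv a b r s (\<lambda>x. c *\<^sub>C g x) p = c *\<^sub>C cderiv a b r s g p"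
  using cderiv_scaleC[OF smooth_on_const assms, of a b r s c] by simp

lemma cderiv_hip:
  assumes "smooth_on f W" "smooth_on g W" "p \<in> W"
  shows "cderiv a b r s (\<lambda>x. hip (f x) (g x)) p =
    hip (cderiv a b r s f p) (g p) + hip (f p) (cderiv (cnj a) (cnj b) r s g p)"
  unfolding cderiv_def frechet_derivative_bilinear[OF bounded_bilinear_hip assms]
  by (simp add: hip_simps algebra_simps)

lemma cderiv_cnj:
  assumes "smooth_on f W" "p \<in> W"
  shows "cderiv a b r s (\<lambda>x. cnj (f x)) p = cnj (cderiv (cnj a) (cnj b) r s f p)"
  unfolding cderiv_def frechet_derivative_bounded_linear[OF bounded_linear_cnj assms] by simp

text \<open>The directions are constant vectors, so the symmetry of second derivatives is the whole
  content.\<close>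

lemma cderiv_commute:
  fixes f :: "'a::real_normed_vector \<Rightarrow> 'b::{complex_normed_space,euclidean_space}"
  assumes "open W" "smooth_on f W" "p \<in> W"
  shows "cderiv a b r s (cderiv a' b' r' s' f) p = cderiv a' b' r' s' (cderiv a b r s f) p"
proof -
  have D: "frechet_derivative (cderiv c d u v f) (at p) x =
      c *\<^sub>C frechet_derivative (\<lambda>y. frechet_derivative f (at y) u) (at p) x +
      d *\<^sub>C frechet_derivative (\<lambda>y. frechet_derivative f (at y) v) (at p) x" for c d u v x
  proof -
    note sm = smooth_on_frechet_derivative[OF assms(2)]
    have sm': "smooth_on (\<lambda>y. c *\<^sub>C frechet_derivative f (at y) u) W" for c u
      by (rule smooth_on_bounded_linear[OF bounded_linear_scaleC_right assms(1) sm])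
    show ?thesis unfolding cderiv_def
      by (subst frechet_derivative_add[OF sm' sm' assms(3)])
        (simp only: frechet_derivative_bounded_linear[OF bounded_linear_scaleC_right sm assms(3)])
  qed
  show ?thesis
    unfolding cderiv_def[of a b] cderiv_def[of a' b' r' s' "cderiv a b r s f"] D
      second_derivative_symmetric[OF assms, of r r'] second_derivative_symmetric[OF assms, of r s']
      second_derivative_symmetric[OF assms, of s r'] second_derivative_symmetric[OF assms, of s s']
    by (simp add: scaleC_simps algebra_simps)
qed

lemma frechet_derivative_linear: "smooth_on f W \<Longrightarrow> p \<in> W \<Longrightarrow> linear (frechet_derivative f (at p))"
  using smooth_on_has_derivative has_derivative_linear by blast

section \<open>The circle bundle of a potential\<close>

definition dz :: "'e::complex_normed_space \<Rightarrow> ('e \<times> real \<Rightarrow> 'b::complex_normed_space) \<Rightarrow> 'e \<times> real \<Rightarrow> 'b"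
  where "dz X = cderiv (1/2) (- \<i>/2) (X, 0) (\<i> *\<^sub>C X, 0)"

definition dzb :: "'e::complex_normed_space \<Rightarrow> ('e \<times> real \<Rightarrow> 'b::complex_normed_space) \<Rightarrow> 'e \<times> real \<Rightarrow> 'b"
  where "dzb X = cderiv (1/2) (\<i>/2) (X, 0) (\<i> *\<^sub>C X, 0)"

definition dT :: "('e::complex_normed_space \<times> real \<Rightarrow> 'b::complex_normed_space) \<Rightarrow> 'e \<times> real \<Rightarrow> 'b"
  where "dT = cderiv 1 0 (0, 1) 0"

locale circle_bundle =
  fixes \<Psi> :: "'e::{complex_normed_space} \<Rightarrow> real" and W :: "('e \<times> real) set"
  assumes open_W: "open W" and smooth_Psi: "smooth_on (\<lambda>p. complex_of_real (\<Psi> (fst p))) W"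
begin

abbreviation sm :: "('e \<times> real \<Rightarrow> 'b::real_normed_vector) \<Rightarrow> bool"
  where "sm f \<equiv> smooth_on f W"

definition P :: "'e \<Rightarrow> 'e \<times> real \<Rightarrow> complex"
  where "P X = dz X (\<lambda>p. of_real (\<Psi> (fst p)))"

definition Pb :: "'e \<Rightarrow> 'e \<times> real \<Rightarrow> complex"
  where "Pb X = dzb X (\<lambda>p. of_real (\<Psi> (fst p)))"

text \<open>The \<open>dT\<close> term is chosen so that \<open>Lb X\<close> annihilates
  \<open>exp (i t - \<Psi> / 2)\<close>: \<open>dzb X\<close> of the exponent is
  \<open>- Pb X / 2\<close>, and the correction contributes \<open>+ Pb X / 2\<close>. The fields
  \<open>Lb X\<close> are thus the (0,1) fields of the CR structure in the bundle
  parametrization.\<close>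

definition L :: "'e \<Rightarrow> ('e \<times> real \<Rightarrow> 'b::complex_normed_space) \<Rightarrow> 'e \<times> real \<Rightarrow> 'b"
  where "L X f p = dz X f p + (\<i>/2 * P X p) *\<^sub>C dT f p"

definition Lb :: "'e \<Rightarrow> ('e \<times> real \<Rightarrow> 'b::complex_normed_space) \<Rightarrow> 'e \<times> real \<Rightarrow> 'b"
  where "Lb X f p = dzb X f p + (- \<i>/2 * Pb X p) *\<^sub>C dT f p"

text \<open>The complex Hessian of the potential; by \<open>Lb_L\<close> it is also the Levi form of
  the circle bundle.\<close>

definition g :: "'e \<Rightarrow> 'e \<Rightarrow> 'e \<times> real \<Rightarrow> complex"
  where "g X Y = dz X (Pb Y)"

lemma sm_dz: "sm f \<Longrightarrow> sm (dz X f)" and sm_dzb: "sm f \<Longrightarrow> sm (dzb X f)" and sm_T: "sm f \<Longrightarrow> sm (dT f)"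
  unfolding dz_def dzb_def dT_def by (rule smooth_on_cderiv[OF open_W], assumption)+

lemma sm_const: "sm (\<lambda>p. c)" by (rule smooth_on_const)

lemmas sm_add = smooth_on_add[OF open_W] and sm_diff = smooth_on_diff[OF open_W]
  and sm_minus = smooth_on_minus[OF open_W] and sm_mult = smooth_on_mult[OF open_W]
  and sm_scaleC = smooth_on_bilinear[OF bounded_bilinear_scaleC open_W]
  and sm_hip = smooth_on_bilinear[OF bounded_bilinear_hip open_W]
  and sm_cnj = smooth_on_bounded_linear[OF bounded_linear_cnj open_W]
  and sm_divide = smooth_on_divide[OF open_W]
  and sm_sum = smooth_on_sum[OF open_W]

lemma sm_P: "sm (P X)" and sm_Pb: "sm (Pb X)"
  unfolding P_def Pb_def by (rule sm_dz sm_dzb smooth_Psi)+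

lemma sm_g: "sm (g X Y)"
  unfolding g_def by (rule sm_dz sm_Pb)+

lemma sm_L: "sm f \<Longrightarrow> sm (L X f)" and sm_Lb: "sm f \<Longrightarrow> sm (Lb X f)"
  unfolding L_def[abs_def] Lb_def[abs_def]
  by (intro sm_add sm_scaleC sm_mult sm_const sm_P sm_Pb sm_dz sm_dzb sm_T, assumption+)+

lemmas sm_intros = sm_L sm_Lb sm_T sm_g sm_const sm_add sm_diff sm_minus sm_mult sm_scaleC sm_hip sm_cnj

lemma T_cong: "p \<in> W \<Longrightarrow> (\<And>x. x \<in> W \<Longrightarrow> f x = f' x) \<Longrightarrow> dT f p = dT f' p"
  and L_cong: "p \<in> W \<Longrightarrow> (\<And>x. x \<in> W \<Longrightarrow> f x = f' x) \<Longrightarrow> L X f p = L X f' p"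
  and Lb_cong: "p \<in> W \<Longrightarrow> (\<And>x. x \<in> W \<Longrightarrow> f x = f' x) \<Longrightarrow> Lb X f p = Lb X f' p"
  unfolding L_def Lb_def dz_def dzb_def dT_def using cderiv_cong[OF open_W, of p f f'] by simp_all

lemma T_const [simp]: "dT (\<lambda>p. c) p = 0" and L_const [simp]: "L X (\<lambda>p. c) p = 0"
  and Lb_const [simp]: "Lb X (\<lambda>p. c) p = 0"
  unfolding L_def Lb_def dz_def dzb_def dT_def by simp_all

context
  fixes p assumes p: "p \<in> W"
begin

lemma T_add: "sm f \<Longrightarrow> sm h \<Longrightarrow> dT (\<lambda>x. f x + h x) p = dT f p + dT h p"
  and L_add: "sm f \<Longrightarrow> sm h \<Longrightarrow> L X (\<lambda>x. f x + h x) p = L X f p + L X h p"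
  and Lb_add: "sm f \<Longrightarrow> sm h \<Longrightarrow> Lb X (\<lambda>x. f x + h x) p = Lb X f p + Lb X h p"
  unfolding L_def Lb_def dz_def dzb_def dT_def
  by (simp_all add: cderiv_add[where W=W] p scaleC_simps algebra_simps)

lemma T_scaleC: "sm c \<Longrightarrow> sm h \<Longrightarrow> dT (\<lambda>x. c x *\<^sub>C h x) p = c p *\<^sub>C dT h p + dT c p *\<^sub>C h p"
  and L_scaleC: "sm c \<Longrightarrow> sm h \<Longrightarrow> L X (\<lambda>x. c x *\<^sub>C h x) p = c p *\<^sub>C L X h p + L X c p *\<^sub>C h p"
  and Lb_scaleC: "sm c \<Longrightarrow> sm h \<Longrightarrow> Lb X (\<lambda>x. c x *\<^sub>C h x) p = c p *\<^sub>C Lb X h p + Lb X c p *\<^sub>C h p"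
  unfolding L_def Lb_def dz_def dzb_def dT_def
  by (simp_all add: cderiv_scaleC[where W=W] p scaleC_simps algebra_simps)

lemma T_mult: "sm c \<Longrightarrow> sm h \<Longrightarrow> dT (\<lambda>x. c x * h x :: complex) p = c p * dT h p + dT c p * h p"
  and L_mult: "sm c \<Longrightarrow> sm h \<Longrightarrow> L X (\<lambda>x. c x * h x :: complex) p = c p * L X h p + L X c p * h p"
  and Lb_mult: "sm c \<Longrightarrow> sm h \<Longrightarrow> Lb X (\<lambda>x. c x * h x :: complex) p = c p * Lb X h p + Lb X c p * h p"
  using T_scaleC[of c h] L_scaleC[of c h X] Lb_scaleC[of c h X] by simp_all

lemma T_minus: "sm f \<Longrightarrow> dT (\<lambda>x. - f x) p = - dT f p"
  and L_minus: "sm f \<Longrightarrow> L X (\<lambda>x. - f x) p = - L X f p"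
  and Lb_minus: "sm f \<Longrightarrow> Lb X (\<lambda>x. - f x) p = - Lb X f p"
  using T_scaleC[OF sm_const, of f "-1"] L_scaleC[OF sm_const, of f X "-1"] Lb_scaleC[OF sm_const, of f X "-1"]
  by (simp_all add: scaleC_minus_left)

lemma T_diff: "sm f \<Longrightarrow> sm h \<Longrightarrow> dT (\<lambda>x. f x - h x) p = dT f p - dT h p"
  and L_diff: "sm f \<Longrightarrow> sm h \<Longrightarrow> L X (\<lambda>x. f x - h x) p = L X f p - L X h p"
  and Lb_diff: "sm f \<Longrightarrow> sm h \<Longrightarrow> Lb X (\<lambda>x. f x - h x) p = Lb X f p - Lb X h p"
  using T_add[of f "\<lambda>x. - h x"] L_add[of f "\<lambda>x. - h x" X] Lb_add[of f "\<lambda>x. - h x" X] sm_minus[of h]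
    T_minus[of h] L_minus[of h X] Lb_minus[of h X]
  by simp_all

lemma cnj_P: "cnj (P X p) = Pb X p" and cnj_Pb: "cnj (Pb X p) = P X p"
proof -
  show "cnj (Pb X p) = P X p"
    using cderiv_cnj[OF smooth_Psi p, of "1/2" "- \<i>/2"] unfolding P_def Pb_def dz_def dzb_def by simp
  then show "cnj (P X p) = Pb X p" by (metis complex_cnj_cnj)
qed

text \<open>The second slot of \<open>hip\<close> is antilinear and turns a (1,0) derivative into a
  (0,1) one. For a CR map such terms vanish, which drives all the computations with \<open>f\<close>
  below.\<close>

lemma L_hip: "sm f \<Longrightarrow> sm h \<Longrightarrow> L X (\<lambda>x. hip (f x) (h x)) p = hip (L X f p) (h p) + hip (f p) (Lb X h p)"
  and Lb_hip: "sm f \<Longrightarrow> sm h \<Longrightarrow> Lb X (\<lambda>x. hip (f x) (h x)) p = hip (Lb X f p) (h p) + hip (f p) (L X h p)"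
  and T_hip: "sm f \<Longrightarrow> sm h \<Longrightarrow> dT (\<lambda>x. hip (f x) (h x)) p = hip (dT f p) (h p) + hip (f p) (dT h p)"
  unfolding L_def Lb_def dz_def dzb_def dT_def
  by (simp_all add: cderiv_hip[where W=W] p hip_simps algebra_simps cnj_P cnj_Pb)

lemma L_cnj: "sm f \<Longrightarrow> L X (\<lambda>x. cnj (f x)) p = cnj (Lb X f p)"
  and Lb_cnj: "sm f \<Longrightarrow> Lb X (\<lambda>x. cnj (f x)) p = cnj (L X f p)"
  and T_cnj: "sm f \<Longrightarrow> dT (\<lambda>x. cnj (f x)) p = cnj (dT f p)"
  unfolding L_def Lb_def dz_def dzb_def dT_def
  by (simp_all add: cderiv_cnj[where W=W] p cnj_P cnj_Pb)

lemma L_div: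
  assumes "sm c" "sm (h :: _ \<Rightarrow> complex)" "\<And>x. x \<in> W \<Longrightarrow> h x \<noteq> 0"
  shows "L X (\<lambda>x. c x / h x) p = (L X c p - c p / h p * L X h p) / h p"
    and "Lb X (\<lambda>x. c x / h x) p = (Lb X c p - c p / h p * Lb X h p) / h p"
    and "dT (\<lambda>x. c x / h x) p = (dT c p - c p / h p * dT h p) / h p"
proof -
  have s: "sm (\<lambda>x. c x / h x)" by (rule sm_divide[OF assms])
  have eq: "c x = c x / h x * h x" if "x \<in> W" for x using assms(3)[OF that] by simp
  have "L X c p = c p / h p * L X h p + L X (\<lambda>x. c x / h x) p * h p"
    "Lb X c p = c p / h p * Lb X h p + Lb X (\<lambda>x. c x / h x) p * h p"
    "dT c p = c p / h p * dT h p + dT (\<lambda>x. c x / h x) p * h p"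
    using L_cong[OF p eq, where X=X] Lb_cong[OF p eq, where X=X] T_cong[OF p eq]
      L_mult[OF s assms(2), of X] Lb_mult[OF s assms(2), of X] T_mult[OF s assms(2)] by simp_all
  then show "L X (\<lambda>x. c x / h x) p = (L X c p - c p / h p * L X h p) / h p"
    "Lb X (\<lambda>x. c x / h x) p = (Lb X c p - c p / h p * Lb X h p) / h p"
    "dT (\<lambda>x. c x / h x) p = (dT c p - c p / h p * dT h p) / h p"
    using assms(3)[OF p] by (simp_all add: field_simps)
qed

end

section \<open>Commutators of the frame fields\<close>

lemma T_Psi: assumes "p \<in> W" shows "dT (\<lambda>p. complex_of_real (\<Psi> (fst p))) p = 0"
proof -
  let ?f = "\<lambda>p. complex_of_real (\<Psi> (fst p))"
  have "((\<lambda>t. ?f (p + t *\<^sub>R (0, 1))) has_derivative (\<lambda>t. frechet_derivative ?f (at p) (t *\<^sub>R (0, 1)))) (at 0)"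
  proof -
    have "((\<lambda>t. p + t *\<^sub>R (0, 1)) has_derivative (\<lambda>t. t *\<^sub>R (0, 1))) (at 0)"
      by (auto intro!: derivative_eq_intros)
    moreover have "(?f has_derivative frechet_derivative ?f (at p)) (at (p + 0 *\<^sub>R (0, 1)))"
      using smooth_on_has_derivative[OF smooth_Psi assms] by (simp flip: zero_prod_def)
    ultimately show ?thesis by (rule has_derivative_compose)
  qed
  moreover have "((\<lambda>t::real. ?f (p + t *\<^sub>R (0, 1))) has_derivative (\<lambda>t. 0)) (at 0)" by simp
  ultimately have "(\<lambda>t. frechet_derivative ?f (at p) (t *\<^sub>R (0, 1))) = (\<lambda>t. 0)"
    by (rule has_derivative_unique)
  from fun_cong[OF this, of 1] show ?thesis by (simp add: dT_def cderiv_def)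
qed

lemma commutes:
  fixes f :: "'e \<times> real \<Rightarrow> 'b::{complex_normed_space,euclidean_space}"
  assumes "sm f" "p \<in> W"
  shows "dT (dz X f) p = dz X (dT f) p" "dT (dzb X f) p = dzb X (dT f) p"
    "dz X (dz Y f) p = dz Y (dz X f) p" "dz X (dzb Y f) p = dzb Y (dz X f) p"
    "dzb X (dzb Y f) p = dzb Y (dzb X f) p"
  unfolding dz_def dzb_def dT_def by (rule cderiv_commute[OF open_W assms])+

lemma T_P: assumes "p \<in> W" shows "dT (P X) p = 0" "dT (Pb X) p = 0"
proof -
  have "dz X (dT (\<lambda>p. complex_of_real (\<Psi> (fst p)))) p = 0" "dzb X (dT (\<lambda>p. complex_of_real (\<Psi> (fst p)))) p = 0"
    using cderiv_cong[OF open_W assms T_Psi, of _ _ _ _] unfolding dz_def dzb_def by simp_all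
  then show "dT (P X) p = 0" "dT (Pb X) p = 0"
    unfolding P_def Pb_def by (simp_all add: commutes[OF smooth_Psi assms])
qed

lemma g_eqs: assumes "p \<in> W"
  shows "g X Y p = L X (Pb Y) p" "g X Y p = dzb Y (P X) p" "g X Y p = Lb Y (P X) p"
    "dz X (P Y) p = dz Y (P X) p" "dzb X (Pb Y) p = dzb Y (Pb X) p"
  using commutes[OF smooth_Psi assms] T_P[OF assms]
  unfolding g_def P_def Pb_def L_def Lb_def by simp_all

lemma cnj_g: assumes "p \<in> W" shows "cnj (g X Y p) = g Y X p"
proof -
  have "cnj (g X Y p) = cnj (L X (\<lambda>x. cnj (P Y x)) p)"
    unfolding g_eqs(1)[OF assms] using L_cong[OF assms, of "Pb Y" "\<lambda>x. cnj (P Y x)" X] by (simp add: cnj_P)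
  also have "\<dots> = g Y X p" using L_cnj[OF assms sm_P, of X Y] g_eqs(3)[OF assms] by simp
  finally show ?thesis .
qed

context
  fixes f :: "'e \<times> real \<Rightarrow> 'b::{complex_normed_space,euclidean_space}" and p
  assumes f: "sm f" and p: "p \<in> W"
begin

private lemma expand:
  assumes "sm c" shows
  "dT (\<lambda>p. dz X f p + c p *\<^sub>C dT f p) p = dz X (dT f) p + (c p *\<^sub>C dT (dT f) p + dT c p *\<^sub>C dT f p)"
  "dT (\<lambda>p. dzb X f p + c p *\<^sub>C dT f p) p = dzb X (dT f) p + (c p *\<^sub>C dT (dT f) p + dT c p *\<^sub>C dT f p)"
  "dz X (\<lambda>p. dz Y f p + c p *\<^sub>C dT f p) p = dz X (dz Y f) p + (c p *\<^sub>C dz X (dT f) p + dz X c p *\<^sub>C dT f p)"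
  "dz X (\<lambda>p. dzb Y f p + c p *\<^sub>C dT f p) p = dz X (dzb Y f) p + (c p *\<^sub>C dz X (dT f) p + dz X c p *\<^sub>C dT f p)"
  "dzb X (\<lambda>p. dz Y f p + c p *\<^sub>C dT f p) p = dzb X (dz Y f) p + (c p *\<^sub>C dzb X (dT f) p + dzb X c p *\<^sub>C dT f p)"
  "dzb X (\<lambda>p. dzb Y f p + c p *\<^sub>C dT f p) p = dzb X (dzb Y f) p + (c p *\<^sub>C dzb X (dT f) p + dzb X c p *\<^sub>C dT f p)"
proof -
  have s: "sm (dz Y f)" "sm (dzb Y f)" "sm (\<lambda>p. c p *\<^sub>C dT f p)" "sm (dT f)" for Y
    using f assms by (auto intro: sm_dz sm_dzb sm_scaleC sm_T)
  have *: "cderiv a b r t (\<lambda>p. h p + c p *\<^sub>C dT f p) p =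
      cderiv a b r t h p + (c p *\<^sub>C cderiv a b r t (dT f) p + cderiv a b r t c p *\<^sub>C dT f p)" if "sm h" for a b r t h
    unfolding cderiv_add[OF that s(3) p] cderiv_scaleC[OF assms s(4) p] ..
  show "dT (\<lambda>p. dz X f p + c p *\<^sub>C dT f p) p = dz X (dT f) p + (c p *\<^sub>C dT (dT f) p + dT c p *\<^sub>C dT f p)"
    "dT (\<lambda>p. dzb X f p + c p *\<^sub>C dT f p) p = dzb X (dT f) p + (c p *\<^sub>C dT (dT f) p + dT c p *\<^sub>C dT f p)"
    "dz X (\<lambda>p. dz Y f p + c p *\<^sub>C dT f p) p = dz X (dz Y f) p + (c p *\<^sub>C dz X (dT f) p + dz X c p *\<^sub>C dT f p)"
    "dz X (\<lambda>p. dzb Y f p + c p *\<^sub>C dT f p) p = dz X (dzb Y f) p + (c p *\<^sub>C dz X (dT f) p + dz X c p *\<^sub>C dT f p)"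
    "dzb X (\<lambda>p. dz Y f p + c p *\<^sub>C dT f p) p = dzb X (dz Y f) p + (c p *\<^sub>C dzb X (dT f) p + dzb X c p *\<^sub>C dT f p)"
    "dzb X (\<lambda>p. dzb Y f p + c p *\<^sub>C dT f p) p = dzb X (dzb Y f) p + (c p *\<^sub>C dzb X (dT f) p + dzb X c p *\<^sub>C dT f p)"
    using *[OF s(1)] *[OF s(2)] commutes(1,2)[OF f p]
    unfolding dz_def dzb_def dT_def by simp_all
qed

private lemma smc: "sm (\<lambda>p. \<i>/2 * P X p)" "sm (\<lambda>p. - \<i>/2 * Pb X p)"
  by (intro sm_mult sm_const sm_P sm_Pb)+

private lemma dcoef:
  "cderiv a b r s (\<lambda>p. \<i>/2 * P X p) p = \<i>/2 * cderiv a b r s (P X) p"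
  "cderiv a b r s (\<lambda>p. - \<i>/2 * Pb X p) p = - \<i>/2 * cderiv a b r s (Pb X) p"
  using cderiv_const_scaleC[OF sm_P p, where c="\<i>/2"] cderiv_const_scaleC[OF sm_Pb p, where c="- \<i>/2"]
  by (simp_all only: scaleC_complex)

lemma L_T: "L X (dT f) p = dT (L X f) p" and Lb_T: "Lb X (dT f) p = dT (Lb X f) p"
  unfolding L_def[abs_def] Lb_def[abs_def] expand[OF smc(1)] expand[OF smc(2)]
  using T_P[OF p] unfolding dT_def dcoef by simp_all

lemma L_L: "L X (L Y f) p = L Y (L X f) p"
  unfolding L_def[of _ "L _ f"] unfolding L_def[abs_def] expand[OF smc(1)] commutes(3)[OF f p, of X Y]
  using g_eqs(4)[OF p, of X Y] T_P[OF p]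
  unfolding dz_def dT_def dcoef by (simp add: scaleC_simps algebra_simps)

lemma Lb_Lb: "Lb X (Lb Y f) p = Lb Y (Lb X f) p"
  unfolding Lb_def[of _ "Lb _ f"] unfolding Lb_def[abs_def] expand[OF smc(2)] commutes(5)[OF f p, of X Y]
  using g_eqs(5)[OF p, of X Y] T_P[OF p]
  unfolding dzb_def dT_def dcoef by (simp add: scaleC_simps algebra_simps)

text \<open>Second derivatives of \<open>f\<close> cancel. What survives are the derivatives of the
  two correction coefficients; each contributes \<open>g X Y\<close> times i/2.\<close>

lemma Lb_L: "Lb Y (L X f) p = L X (Lb Y f) p + g X Y p *\<^sub>C (\<i> *\<^sub>C dT f p)"
proof -
  have "dzb Y (P X) p = g X Y p" "dz X (Pb Y) p = g X Y p"
    using g_eqs(2)[OF p, of X Y] by (simp_all add: g_def)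
  then show ?thesis
    unfolding L_def[of _ "Lb _ f"] Lb_def[of _ "L _ f"] unfolding L_def[abs_def] Lb_def[abs_def]
      expand[OF smc(1)] expand[OF smc(2)] commutes(4)[OF f p, of X Y]
    using T_P[OF p]
    unfolding dzb_def dz_def dT_def dcoef
    apply (simp add: scaleC_simps algebra_simps)
    apply (simp add: mult.commute flip: scaleC_add_left)
    done
qed

end

context
  fixes p assumes p: "p \<in> W"
begin

text \<open>The real derivative is only real linear in the direction. Combining the directions
  \<open>X\<close> and \<open>\<i> *\<^sub>C X\<close> is what makes \<open>dz\<close> complex
  linear and \<open>dzb\<close> antilinear.\<close>

lemma dz_linear: assumes "sm f"
  shows "dz (X + Y) f p = dz X f p + dz Y f p" "dz (c *\<^sub>C X) f p = c *\<^sub>C dz X f p"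
    "dzb (X + Y) f p = dzb X f p + dzb Y f p" "dzb (c *\<^sub>C X) f p = cnj c *\<^sub>C dzb X f p"
proof -
  note lin = frechet_derivative_linear[OF assms p]
  let ?D = "frechet_derivative f (at p)"
  have add: "?D (X + Y, 0) = ?D (X, 0) + ?D (Y, 0)" for X Y
    using linear_add[OF lin, of "(X,0)" "(Y,0)"] by simp
  have sc: "?D (c *\<^sub>C X, 0) = of_real (Re c) *\<^sub>C ?D (X, 0) + of_real (Im c) *\<^sub>C ?D (\<i> *\<^sub>C X, 0)" for c X
  proof -
    have "c *\<^sub>C X = Re c *\<^sub>R X + Im c *\<^sub>R (\<i> *\<^sub>C X)"
      by (subst complex_eq[of c]) (simp add: scaleC_simps mult.commute flip: scaleC_of_real)
    then have e: "(c *\<^sub>C X, 0 :: real) = Re c *\<^sub>R (X, 0) + Im c *\<^sub>R (\<i> *\<^sub>C X, 0)" by simp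
    show ?thesis by (simp only: e linear_add[OF lin] linear_cmul[OF lin] scaleC_of_real)
  qed
  show "dz (X + Y) f p = dz X f p + dz Y f p" "dzb (X + Y) f p = dzb X f p + dzb Y f p"
    unfolding dz_def dzb_def cderiv_def by (simp_all add: scaleC_simps add algebra_simps)
  have c: "of_real (Re c) + \<i> * of_real (Im c) = c" "cnj c = of_real (Re c) - \<i> * of_real (Im c)"
    by (simp_all add: complex_eq_iff)
  have "of_real (Re (\<i> * c)) = - complex_of_real (Im c)" "of_real (Im (\<i> * c)) = complex_of_real (Re c)"
    by simp_all
  then have e: "?D (\<i> *\<^sub>C c *\<^sub>C X, 0) = (- of_real (Im c)) *\<^sub>C ?D (X, 0) + of_real (Re c) *\<^sub>C ?D (\<i> *\<^sub>C X, 0)"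
    using sc[of "\<i> * c" X] by (simp add: scaleC_scaleC)
  show "dz (c *\<^sub>C X) f p = c *\<^sub>C dz X f p"
    unfolding dz_def cderiv_def e sc[of c]
    by (subst (3 4) c(1)[symmetric]) (simp add: scaleC_simps algebra_simps add_divide_distrib diff_divide_distrib)
  show "dzb (c *\<^sub>C X) f p = cnj c *\<^sub>C dzb X f p"
    unfolding dzb_def cderiv_def e sc[of c] c(2)
    by (simp add: scaleC_simps algebra_simps add_divide_distrib diff_divide_distrib)
qed

lemma P_linear: "P (X + Y) p = P X p + P Y p" "P (c *\<^sub>C X) p = c * P X p"
  "Pb (X + Y) p = Pb X p + Pb Y p" "Pb (c *\<^sub>C X) p = cnj c * Pb X p"
  unfolding P_def Pb_def by (simp_all add: dz_linear[OF smooth_Psi])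

lemma L_linear: assumes "sm f"
  shows "L (X + Y) f p = L X f p + L Y f p" "L (c *\<^sub>C X) f p = c *\<^sub>C L X f p"
    "Lb (X + Y) f p = Lb X f p + Lb Y f p" "Lb (c *\<^sub>C X) f p = cnj c *\<^sub>C Lb X f p"
  unfolding L_def Lb_def by (simp_all add: dz_linear[OF assms] P_linear scaleC_simps algebra_simps)

end

end

section \<open>CR maps into spheres\<close>

locale cr_sphere_map = circle_bundle \<Psi> W
  for \<Psi> :: "'e::{complex_normed_space} \<Rightarrow> real" and W :: "('e \<times> real) set" +
  fixes f :: "'e \<times> real \<Rightarrow> complex ^ 'm"
  assumes sm_f: "smooth_on f W"
    and Lb_f: "\<And>X p. p \<in> W \<Longrightarrow> Lb X f p = 0"
    and f_f: "\<And>p. p \<in> W \<Longrightarrow> hip (f p) (f p) = 1"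
begin

text \<open>The characteristic derivative with the factor i that it carries in the commutator
  \<open>Lb_L\<close>; this factor also makes \<open>hip (G p) (f p)\<close> real.\<close>

definition G :: "'e \<times> real \<Rightarrow> complex ^ 'm" where "G p = \<i> *\<^sub>C dT f p"

text \<open>\<open>lam\<close> measures CR transversality: it is the factor by which \<open>f\<close> stretches the contact form.\<close>

definition lam :: "'e \<times> real \<Rightarrow> complex" where "lam p = - hip (G p) (f p)"

lemma sm_G: "sm G"
  unfolding G_def[abs_def] by (intro sm_intros sm_f)

lemma sm_lam: "sm lam"
  unfolding lam_def[abs_def] by (intro sm_intros sm_f sm_G)

lemmas sm_intros' = sm_intros sm_f sm_G sm_lam

context
  fixes p assumes p: "p \<in> W"
begin

lemma Lb_G: "Lb X G p = 0"
proof -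
  have "Lb X G p = \<i> *\<^sub>C dT (Lb X f) p"
    unfolding G_def[abs_def] by (simp add: Lb_scaleC[OF p sm_const sm_T[OF sm_f]] Lb_T[OF sm_f p])
  also have "dT (Lb X f) p = dT (\<lambda>x. 0) p" by (rule T_cong[OF p Lb_f])
  finally show ?thesis by simp
qed

lemma L_G: "L X G p = \<i> *\<^sub>C dT (L X f) p"
  unfolding G_def[abs_def] by (simp add: L_scaleC[OF p sm_const sm_T[OF sm_f]] L_T[OF sm_f p])

lemma Lb_Lf: "Lb Y (L X f) p = g X Y p *\<^sub>C G p"
proof -
  have "L X (Lb Y f) p = L X (\<lambda>x. 0) p" by (rule L_cong[OF p Lb_f])
  then show ?thesis using Lb_L[OF sm_f p, of Y X] by (simp add: G_def)
qed

lemma Lf_f: "hip (L X f p) (f p) = 0"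
proof -
  have "L X (\<lambda>x. hip (f x) (f x)) p = L X (\<lambda>x. 1) p" by (rule L_cong[OF p f_f])
  then show ?thesis using L_hip[OF p sm_f sm_f, of X] Lb_f[OF p] by simp
qed

lemma lam_real: "cnj (lam p) = lam p"
proof -
  have "dT (\<lambda>x. hip (f x) (f x)) p = dT (\<lambda>x. 1) p" by (rule T_cong[OF p f_f])
  then have "hip (dT f p) (f p) + hip (f p) (dT f p) = 0" using T_hip[OF p sm_f sm_f] by simp
  then have "hip (f p) (dT f p) = - hip (dT f p) (f p)" by (simp add: eq_neg_iff_add_eq_0 add.commute)
  then show ?thesis by (simp add: lam_def G_def cnj_hip hip_simps)
qed

lemma LG_f: "hip (L X G p) (f p) = - L X lam p"
proof -
  have "L X lam p = - (hip (L X G p) (f p) + hip (G p) (Lb X f p))"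
    unfolding lam_def[abs_def] using L_minus[OF p sm_hip[OF sm_G sm_f], of X] L_hip[OF p sm_G sm_f, of X] by simp
  then show ?thesis by (simp add: Lb_f[OF p])
qed

lemma G_Lf: "hip (G p) (L X f p) = - Lb X lam p"
proof -
  have "Lb X lam p = - (hip (Lb X G p) (f p) + hip (G p) (L X f p))"
    unfolding lam_def[abs_def] using Lb_minus[OF p sm_hip[OF sm_G sm_f], of X] Lb_hip[OF p sm_G sm_f, of X] by simp
  then show ?thesis by (simp add: Lb_G)
qed

lemma Lb_lam: "Lb X lam p = cnj (L X lam p)"
  using L_cnj[OF p sm_lam, of X] Lb_cnj[OF p sm_lam, of X] Lb_cong[OF p, of lam "\<lambda>x. cnj (lam x)" X]
  using cr_sphere_map.lam_real[OF cr_sphere_map_axioms] by simp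

end

text \<open>Apply \<open>Lb Y\<close> to \<open>hip (L X f) f = 0\<close>. Up to the factor
  \<open>lam\<close>, a CR map into the sphere is isometric on complex tangent directions.\<close>

lemma gram: assumes p: "p \<in> W" shows "hip (L X f p) (L Y f p) = lam p * g X Y p"
proof -
  have "Lb Y (\<lambda>x. hip (L X f x) (f x)) p = Lb Y (\<lambda>x. 0) p" by (rule Lb_cong[OF p Lf_f])
  then show ?thesis using Lb_hip[OF p sm_L[OF sm_f] sm_f, of Y X] Lb_Lf[OF p, of Y X]
    by (simp add: hip_simps lam_def add_eq_0_iff)
qed

lemma Lb_LG: assumes p: "p \<in> W" shows "Lb Z (L X G) p = g X Z p *\<^sub>C (\<i> *\<^sub>C dT G p)"
proof -
  have "L X (Lb Z G) p = L X (\<lambda>x. 0) p" by (rule L_cong[OF p Lb_G])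
  then show ?thesis using Lb_L[OF sm_G p, of Z X] by simp
qed

lemma LLf_f: assumes p: "p \<in> W" shows "hip (L X (L Y f) p) (f p) = 0"
proof -
  have "L X (\<lambda>x. hip (L Y f x) (f x)) p = L X (\<lambda>x. 0) p" by (rule L_cong[OF p Lf_f])
  then show ?thesis using L_hip[OF p sm_L[OF sm_f] sm_f, of X Y] Lb_f[OF p] by simp
qed

text \<open>\<open>Lb Z\<close> is moved inwards until it meets \<open>f\<close>, which it kills;
  each exchange leaves one commutator term.\<close>

lemma Lb_LLf: assumes p: "p \<in> W"
  shows "Lb Z (L X (L Y f)) p = L X (g Y Z) p *\<^sub>C G p + g Y Z p *\<^sub>C L X G p + g X Z p *\<^sub>C L Y G p"
proof -
  have "L X (Lb Z (L Y f)) p = L X (\<lambda>x. g Y Z x *\<^sub>C G x) p" by (rule L_cong[OF p Lb_Lf])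
  also have "\<dots> = g Y Z p *\<^sub>C L X G p + L X (g Y Z) p *\<^sub>C G p" by (rule L_scaleC[OF p sm_g sm_G])
  finally show ?thesis using Lb_L[OF sm_L[OF sm_f] p, of Z X Y] L_G[OF p, of Y] by simp
qed

text \<open>\<open>Lb Z\<close> applied to \<open>LLf_f\<close>. Apart from the derivatives of
  \<open>lam\<close> these are the Christoffel symbols of \<open>g\<close> with lowered
  index.\<close>

lemma LLf_Lf: assumes p: "p \<in> W"
  shows "hip (L X (L Y f) p) (L Z f p) = lam p * L X (g Y Z) p + g Y Z p * L X lam p + g X Z p * L Y lam p"
proof -
  have "Lb Z (\<lambda>x. hip (L X (L Y f) x) (f x)) p = Lb Z (\<lambda>x. 0) p" by (rule Lb_cong[OF p LLf_f])
  then have "hip (L X (L Y f) p) (L Z f p) = - hip (Lb Z (L X (L Y f)) p) (f p)"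
    using Lb_hip[OF p sm_L[OF sm_L[OF sm_f]] sm_f, of Z X Y] by (simp add: add_eq_0_iff)
  also have "hip (Lb Z (L X (L Y f)) p) (f p) = - (lam p * L X (g Y Z) p + g Y Z p * L X lam p + g X Z p * L Y lam p)"
    unfolding Lb_LLf[OF p] hip_simps LG_f[OF p] by (simp add: lam_def algebra_simps)
  finally show ?thesis by simp
qed

text \<open>\<open>Lb Z\<close> applied to \<open>LLf_Lf\<close> with both fields equal to
  \<open>X\<close>. Orthogonality is assumed at \<open>p\<close> only, so terms with a derivative of
  \<open>g X Z\<close> remain.\<close>

lemma gauss_equation:
  assumes p: "p \<in> W" and "g X Z p = 0"
  shows "hip (L X (L X f) p) (L Z (L Z f) p) =
    lam p * Lb Z (L X (g X Z)) p + 2 * Lb Z lam p * L X (g X Z) p + 2 * Lb Z (g X Z) p * L X lam p"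
proof -
  have "Lb Z (\<lambda>x. hip (L X (L X f) x) (L Z f x)) p =
      Lb Z (\<lambda>x. lam x * L X (g X Z) x + 2 * (g X Z x * L X lam x)) p"
    by (rule Lb_cong[OF p]) (simp add: LLf_Lf)
  also have "\<dots> = Lb Z (\<lambda>x. lam x * L X (g X Z) x) p + Lb Z (\<lambda>x. 2 * (g X Z x * L X lam x)) p"
    by (rule Lb_add[OF p]) (intro sm_intros')+
  also have "\<dots> = lam p * Lb Z (L X (g X Z)) p + Lb Z lam p * L X (g X Z) p
      + 2 * (g X Z p * Lb Z (L X lam) p + Lb Z (g X Z) p * L X lam p)"
    by (simp add: Lb_mult[OF p] sm_intros')
  finally have 1: "Lb Z (\<lambda>x. hip (L X (L X f) x) (L Z f x)) p =
     lam p * Lb Z (L X (g X Z)) p + Lb Z lam p * L X (g X Z) p + 2 * Lb Z (g X Z) p * L X lam p"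
    using assms(2) by simp
  have "Lb Z (\<lambda>x. hip (L X (L X f) x) (L Z f x)) p =
      hip (Lb Z (L X (L X f)) p) (L Z f p) + hip (L X (L X f) p) (L Z (L Z f) p)"
    by (rule Lb_hip[OF p]) (intro sm_intros')+
  also have "hip (Lb Z (L X (L X f)) p) (L Z f p) = - L X (g X Z) p * Lb Z lam p"
    unfolding Lb_LLf[OF p] hip_simps G_Lf[OF p] by (simp add: assms(2))
  finally show ?thesis using 1 by (simp add: algebra_simps)
qed

end

section \<open>Orthogonality-preserving quadratic maps\<close>

lemma inner_eq_0_if_hip_eq_0:
  assumes "hip u v = 0"
  shows "u \<bullet> v = 0" "u \<bullet> (\<i> *\<^sub>C v) = 0" "(\<i> *\<^sub>C u) \<bullet> v = 0" "(\<i> *\<^sub>C u) \<bullet> (\<i> *\<^sub>C v) = 0"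
  unfolding Re_hip[symmetric] by (simp_all add: hip_simps assms)

lemma hip_eq_0_if_inner_eq_0:
  assumes "u \<bullet> v = 0" "u \<bullet> (\<i> *\<^sub>C v) = 0"
  shows "hip u v = 0"
  using assms unfolding Re_hip[symmetric] by (simp add: hip_simps complex_eq_iff)

text \<open>Dimensions are counted over the reals, so every vector is accompanied by its multiple by
  i and the count doubles.\<close>

lemma dim_orthogonal_family:
  fixes e :: "'a \<Rightarrow> complex ^ 'k"
  assumes "finite A" "\<And>x. x \<in> A \<Longrightarrow> e x \<noteq> 0" "\<And>x y. x \<in> A \<Longrightarrow> y \<in> A \<Longrightarrow> x \<noteq> y \<Longrightarrow> hip (e x) (e y) = 0"
  shows "dim (\<Union>x\<in>A. {e x, \<i> *\<^sub>C e x}) = 2 * card A"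
  using assms
proof (induction A)
  case (insert x A)
  have ne: "e x \<noteq> 0" "\<i> *\<^sub>C e x \<noteq> 0" using insert.prems(1)[of x] norm_scaleC[of \<i> "e x"] by auto
  have "e x \<bullet> (\<i> *\<^sub>C e x) = 0"
    unfolding Re_hip[symmetric] by (simp add: hip_simps hip_self)
  then have "dim ({e x} \<union> {\<i> *\<^sub>C e x}) = dim {e x} + dim {\<i> *\<^sub>C e x}"
    by (intro dim_orthogonal_sum) auto
  then have 1: "dim {e x, \<i> *\<^sub>C e x} = 2"
    using ne by (simp add: dim_insert insert_commute)
  have "dim ({e x, \<i> *\<^sub>C e x} \<union> (\<Union>x\<in>A. {e x, \<i> *\<^sub>C e x})) =
      dim {e x, \<i> *\<^sub>C e x} + dim (\<Union>x\<in>A. {e x, \<i> *\<^sub>C e x})"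
  proof (rule dim_orthogonal_sum)
    fix u v assume u: "u \<in> {e x, \<i> *\<^sub>C e x}" and "v \<in> (\<Union>x\<in>A. {e x, \<i> *\<^sub>C e x})"
    then obtain y where y: "y \<in> A" "v \<in> {e y, \<i> *\<^sub>C e y}" by auto
    then have "hip (e x) (e y) = 0" using insert.hyps insert.prems(2)[of x y] by auto
    then show "u \<bullet> v = 0" using u y(2) inner_eq_0_if_hip_eq_0[of "e x" "e y"] by auto
  qed
  then show ?case using insert 1 by simp
qed simp

text \<open>A positive version of Huang's lemma: an orthogonal system on which \<open>\<phi>\<close> does not vanish is too
  small to span, so a maximal one could be enlarged by rotating one of its members.\<close>

lemma orthogonal_quadratic_zero:
  fixes J \<phi> :: "'a::real_vector \<Rightarrow> complex ^ 'k" and F :: "complex ^ 'k"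
  assumes S: "subspace S"
    and linJ: "\<And>X Y s. X \<in> S \<Longrightarrow> Y \<in> S \<Longrightarrow> J (X + s *\<^sub>R Y) = J X + s *\<^sub>R J Y"
    and iJ: "\<And>X. X \<in> S \<Longrightarrow> \<exists>Y\<in>S. J Y = \<i> *\<^sub>C J X"
    and quad: "\<And>X Y. X \<in> S \<Longrightarrow> Y \<in> S \<Longrightarrow> \<exists>B. \<forall>s. \<phi> (X + s *\<^sub>R Y) = \<phi> X + s *\<^sub>R B + s\<^sup>2 *\<^sub>R \<phi> Y"
    and orth: "\<And>X Y. X \<in> S \<Longrightarrow> Y \<in> S \<Longrightarrow> hip (J X) (J Y) = 0 \<Longrightarrow> hip (\<phi> X) (\<phi> Y) = 0"
    and phiJ: "\<And>X Y. X \<in> S \<Longrightarrow> Y \<in> S \<Longrightarrow> hip (\<phi> X) (J Y) = 0"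
    and phiF: "\<And>X. X \<in> S \<Longrightarrow> hip (\<phi> X) F = 0" and JF: "\<And>X. X \<in> S \<Longrightarrow> hip (J X) F = 0"
    and F: "F \<noteq> 0" and dimJ: "2 * n \<le> dim (J ` S)" and dimk: "CARD('k) \<le> 2 * n"
    and X: "X \<in> S"
  shows "\<phi> X = 0"
proof (rule ccontr)
  assume phiX: "\<phi> X \<noteq> 0"
  define good where "good A \<longleftrightarrow> finite A \<and> A \<subseteq> S \<and> (\<forall>x\<in>A. \<phi> x \<noteq> 0) \<and>
      (\<forall>x\<in>A. \<forall>y\<in>A. x \<noteq> y \<longrightarrow> hip (J x) (J y) = 0)" for A
  have dimU: "dim B \<le> 2 * CARD('k)" for B :: "(complex ^ 'k) set"
    using dim_subset_UNIV[of B] by simp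
  have bound: "card A < n" if A: "good A" for A
  proof -
    have dA: "dim (\<Union>x\<in>A. {\<phi> x, \<i> *\<^sub>C \<phi> x}) = 2 * card A"
      using A orth unfolding good_def by (intro dim_orthogonal_family) (auto simp: subset_iff)
    have dF: "dim {F, \<i> *\<^sub>C F} = 2"
      using dim_orthogonal_family[of "{F}" "\<lambda>x. x"] F by simp
    have 1: "dim (J ` S \<union> {F, \<i> *\<^sub>C F}) = dim (J ` S) + dim {F, \<i> *\<^sub>C F}"
      using JF inner_eq_0_if_hip_eq_0 by (intro dim_orthogonal_sum) blast
    have "dim ((\<Union>x\<in>A. {\<phi> x, \<i> *\<^sub>C \<phi> x}) \<union> (J ` S \<union> {F, \<i> *\<^sub>C F})) =
        dim (\<Union>x\<in>A. {\<phi> x, \<i> *\<^sub>C \<phi> x}) + dim (J ` S \<union> {F, \<i> *\<^sub>C F})"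
    proof (rule dim_orthogonal_sum)
      fix u v assume "u \<in> (\<Union>x\<in>A. {\<phi> x, \<i> *\<^sub>C \<phi> x})" and v: "v \<in> J ` S \<union> {F, \<i> *\<^sub>C F}"
      then obtain x where x: "x \<in> S" "u \<in> {\<phi> x, \<i> *\<^sub>C \<phi> x}" using A unfolding good_def by auto
      show "u \<bullet> v = 0"
      proof (cases "v \<in> J ` S")
        case True
        then obtain y where "y \<in> S" "v = J y" by auto
        then show ?thesis using phiJ[OF x(1)] x(2) inner_eq_0_if_hip_eq_0[of "\<phi> x" "J y"] by auto
      next
        case False
        then show ?thesis using v phiF[OF x(1)] x(2) inner_eq_0_if_hip_eq_0[of "\<phi> x" F] by auto
      qed
    qed
    moreover have "dim ((\<Union>x\<in>A. {\<phi> x, \<i> *\<^sub>C \<phi> x}) \<union> (J ` S \<union> {F, \<i> *\<^sub>C F})) \<le> 2 * CARD('k)"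
      by (rule dimU)
    ultimately show ?thesis using dA dF 1 dimJ dimk by linarith
  qed
  have "good {X}" using X phiX unfolding good_def by simp
  then obtain A where A: "good A" and max: "\<And>B. good B \<Longrightarrow> card B \<le> card A"
    using ex_has_greatest_nat[of good "{X}" card n] bound less_imp_le by blast
  have "A \<noteq> {}" using max[OF \<open>good {X}\<close>] by auto
  then obtain v where v: "v \<in> A" by blast
  have finA: "finite A" and AS: "A \<subseteq> S" and phiA: "\<And>x. x \<in> A \<Longrightarrow> \<phi> x \<noteq> 0"
    and orthA: "\<And>x y. x \<in> A \<Longrightarrow> y \<in> A \<Longrightarrow> x \<noteq> y \<Longrightarrow> hip (J x) (J y) = 0"
    using A unfolding good_def by auto
  have vS: "v \<in> S" using v AS by auto
  let ?D = "\<Union>x\<in>A. {J x, \<i> *\<^sub>C J x}"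
  have Jdim: "subspace (J ` S)"
  proof (unfold subspace_def, intro conjI ballI allI)
    have J0: "J 0 = 0" using linJ[of 0 0 1] subspace_0[OF S] by simp
    then show "0 \<in> J ` S" using subspace_0[OF S] by force
    show "x + y \<in> J ` S" if xy: "x \<in> J ` S" "y \<in> J ` S" for x y
    proof -
      obtain a b where ab: "a \<in> S" "b \<in> S" "x = J a" "y = J b" using xy by auto
      then show ?thesis using linJ[of a b 1] subspace_add[OF S, of a b] by (metis image_eqI scaleR_one)
    qed
    show "c *\<^sub>R x \<in> J ` S" if "x \<in> J ` S" for c x
      using that linJ[OF subspace_0[OF S], of _ c] J0 subspace_scale[OF S, of _ c] by force
  qed
  have DJ: "?D \<subseteq> J ` S" using AS iJ by (auto simp: image_iff) (metis subsetD)
  have "dim ?D \<le> card ?D" by (rule dim_le_card[OF span_superset]) (use finA in auto)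
  also have "card ?D \<le> (\<Sum>x\<in>A. card {J x, \<i> *\<^sub>C J x})" by (rule card_UN_le[OF finA])
  also have "\<dots> \<le> (\<Sum>x\<in>A. 2)" by (intro sum_mono) (simp add: card_insert_if)
  also have "\<dots> < 2 * n" using bound[OF A] by simp
  finally have "dim ?D < dim (J ` S)" using dimJ by simp
  then have "span ?D \<noteq> span (J ` S)"
    using arg_cong[of "span ?D" "span (J ` S)" dim] unfolding dim_span by auto
  then have "span ?D \<subset> span (J ` S)" using span_mono[OF DJ] by blast
  then obtain u where u: "u \<noteq> 0" "u \<in> span (J ` S)" "\<And>y. y \<in> span ?D \<Longrightarrow> orthogonal u y"
    by (rule orthogonal_to_subspace_exists_gen) blast
  have "u \<in> J ` S" using u(2) Jdim by (simp add: span_eq_iff[THEN iffD2])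
  then obtain U where U: "U \<in> S" "J U = u" by auto
  have uD: "hip (J U) (J x) = 0" if "x \<in> A" for x
    using u(3)[of "J x"] u(3)[of "\<i> *\<^sub>C J x"] that U(2)
    by (intro hip_eq_0_if_inner_eq_0) (auto simp: orthogonal_def intro!: span_base)
  have notin: "U' \<notin> B \<and> card (insert U' B) = Suc (card B)" if "finite B" "B \<subseteq> S" "\<phi> U' \<noteq> 0" "U' \<in> S"
    "\<And>x. x \<in> B \<Longrightarrow> hip (J U') (J x) = 0" for U' B
  proof -
    have "U' \<notin> B" using orth[OF that(4) that(4)] that(3) that(5) by (metis hip_self_eq_0_iff)
    then show ?thesis using that(1) by simp
  qed
  \<comment> \<open>Otherwise \<open>U\<close> could be added to the maximal system as it
    is.\<close>
  have phiU: "\<phi> U = 0"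
  proof (rule ccontr)
    assume "\<phi> U \<noteq> 0"
    then have "good (insert U A)" using U uD finA AS phiA orthA unfolding good_def
      by (auto simp: hip_eq_0_commute)
    then show False using max[of "insert U A"] notin[OF finA AS \<open>\<phi> U \<noteq> 0\<close> U(1) uD] by simp
  qed
  have Jv: "J v \<noteq> 0" using orth[OF vS vS] phiA[OF v] by auto
  \<comment> \<open>With this ratio \<open>v + s *\<^sub>R U\<close> and
    \<open>U - (s * \<kappa>) *\<^sub>R v\<close> have orthogonal images under \<open>J\<close>. If
    \<open>\<phi>\<close> vanished on neither, these two could replace \<open>v\<close> and give a
    larger system.\<close>
  define \<kappa> where "\<kappa> = (norm (J U))\<^sup>2 / (norm (J v))\<^sup>2"
  have k: "\<kappa> > 0" using Jv u(1) U(2) by (simp add: \<kappa>_def)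
  obtain B where B: "\<And>s. \<phi> (v + s *\<^sub>R U) = \<phi> v + s *\<^sub>R B + s\<^sup>2 *\<^sub>R \<phi> U" using quad[OF vS U(1)] by blast
  obtain B' where B': "\<And>s. \<phi> (U + s *\<^sub>R v) = \<phi> U + s *\<^sub>R B' + s\<^sup>2 *\<^sub>R \<phi> v" using quad[OF U(1) vS] by blast
  have "\<phi> (v + s *\<^sub>R U) = 0 \<or> \<phi> (U + (- (s * \<kappa>)) *\<^sub>R v) = 0" if s: "s > 0" for s
  proof (rule ccontr)
    let ?X = "v + s *\<^sub>R U" and ?Y = "U + (- (s * \<kappa>)) *\<^sub>R v"
    assume "\<not> ?thesis"
    then have ne: "\<phi> ?X \<noteq> 0" "\<phi> ?Y \<noteq> 0" by auto
    have inS: "?X \<in> S" "?Y \<in> S" using vS U(1) S by (auto intro!: subspace_add subspace_scale subspace_diff)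
    have hv: "hip (J v) (J U) = 0" "hip (J U) (J v) = 0" using uD[OF v] hip_eq_0_commute by blast+
    have xy: "hip (J ?Y) (J ?X) = 0"
      unfolding linJ[OF vS U(1)] linJ[OF U(1) vS]
      using Jv by (simp add: hip_simps hip_scaleR_left hip_scaleR_right hv hip_self \<kappa>_def scaleR_conv_of_real[where 'a=complex])
    have oth: "hip (J ?X) (J x) = 0" "hip (J ?Y) (J x) = 0" if "x \<in> A - {v}" for x
      using that uD[of x] orthA[OF v, of x] unfolding linJ[OF vS U(1)] linJ[OF U(1) vS]
      by (auto simp: hip_simps hip_scaleR_left)
    have f: "finite (A - {v})" "A - {v} \<subseteq> S" using finA AS by auto
    have n1: "card (insert ?X (A - {v})) = Suc (card (A - {v}))"
      using notin[OF f ne(1) inS(1) oth(1)] by blast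
    have n2: "card (insert ?Y (insert ?X (A - {v}))) = Suc (card (insert ?X (A - {v})))"
      using notin[of "insert ?X (A - {v})" ?Y] f ne(2) inS xy oth(2) by auto
    have "good (insert ?Y (insert ?X (A - {v})))"
      unfolding good_def
    proof (intro conjI ballI impI)
      show "finite (insert ?Y (insert ?X (A - {v})))" using finA by simp
      show "insert ?Y (insert ?X (A - {v})) \<subseteq> S" using inS f by blast
      show "\<phi> x \<noteq> 0" if "x \<in> insert ?Y (insert ?X (A - {v}))" for x using that ne phiA by blast
      show "hip (J x) (J y) = 0" if xy': "x \<in> insert ?Y (insert ?X (A - {v}))" "y \<in> insert ?Y (insert ?X (A - {v}))" "x \<noteq> y" for x y
        using xy' xy oth oth[THEN hip_eq_0_commute[THEN iffD1]] xy[THEN hip_eq_0_commute[THEN iffD1]] orthA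
        by (elim insertE) blast+
    qed
    then have "card (insert ?Y (insert ?X (A - {v}))) \<le> card A" by (rule max)
    then show False using n1 n2 v finA by (simp add: card_Diff_singleton)
  qed
  then have alt: "\<phi> v + s *\<^sub>R B = 0 \<or> (- (s * \<kappa>)) *\<^sub>R B' + (s * \<kappa>)\<^sup>2 *\<^sub>R \<phi> v = 0" if "s > 0" for s
    using that unfolding B B' phiU by simp
  have no1: "s = t" if "\<phi> v + s *\<^sub>R B = 0" "\<phi> v + t *\<^sub>R B = 0" for s t
  proof (rule ccontr)
    assume "s \<noteq> t"
    have "s *\<^sub>R B = t *\<^sub>R B" using that by (metis add_left_cancel)
    then have "B = 0" using \<open>s \<noteq> t\<close> by simp
    then show False using that(1) phiA[OF v] by simp
  qed
  have no2: "s = t" if "s > 0" "t > 0" "(- (s * \<kappa>)) *\<^sub>R B' + (s * \<kappa>)\<^sup>2 *\<^sub>R \<phi> v = 0" "(- (t * \<kappa>)) *\<^sub>R B' + (t * \<kappa>)\<^sup>2 *\<^sub>R \<phi> v = 0" for s t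
  proof -
    have *: "B' = (s * \<kappa>) *\<^sub>R \<phi> v" if "s > 0" "(- (s * \<kappa>)) *\<^sub>R B' + (s * \<kappa>)\<^sup>2 *\<^sub>R \<phi> v = 0" for s
    proof -
      have "(s * \<kappa>) *\<^sub>R B' = (s * \<kappa>) *\<^sub>R ((s * \<kappa>) *\<^sub>R \<phi> v)"
        using that(2) by (simp add: power2_eq_square add.commute eq_neg_iff_add_eq_0[symmetric])
      moreover have "s * \<kappa> \<noteq> 0" using that(1) k by simp
      ultimately show ?thesis using scaleR_left_imp_eq by blast
    qed
    have "(s * \<kappa>) *\<^sub>R \<phi> v = (t * \<kappa>) *\<^sub>R \<phi> v" using *[OF that(1,3)] *[OF that(2,4)] by metis
    then show ?thesis using phiA[OF v] k by auto
  qed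
  \<comment> \<open>Each alternative of \<open>alt\<close> holds for at most one positive
    \<open>s\<close>, since \<open>\<phi> v\<close> is nonzero; the three values 1, 2, 3 are one too
    many.\<close>
  show False using alt[of 1] alt[of 2] alt[of 3] no1[of 1 2] no1[of 1 3] no1[of 2 3] no2[of 1 2] no2[of 1 3] no2[of 2 3] by linarith
qed

section \<open>Hermitian forms and the potential of a hypersurface of revolution\<close>

definition herm :: "complex ^ 'n ^ 'n \<Rightarrow> complex ^ 'n \<Rightarrow> complex ^ 'n \<Rightarrow> complex"
  where "herm H a b = (\<Sum>\<alpha>\<in>UNIV. \<Sum>\<beta>\<in>UNIV. H $ \<alpha> $ \<beta> * a $ \<alpha> * cnj (b $ \<beta>))"

lemma hermitian_form_eq: "hermitian_form H z = herm H z z"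
  by (simp add: hermitian_form_def herm_def)

lemma herm_add_left: "herm H (a + b) x = herm H a x + herm H b x"
  by (simp add: herm_def algebra_simps sum.distrib)

lemma herm_add_right: "herm H x (a + b) = herm H x a + herm H x b"
  by (simp add: herm_def algebra_simps sum.distrib)

lemma herm_scaleC_left: "herm H (c *\<^sub>C a) x = c * herm H a x"
  by (simp add: herm_def algebra_simps sum_distrib_left)

lemma herm_scaleC_right: "herm H x (c *\<^sub>C a) = cnj c * herm H x a"
  by (simp add: herm_def algebra_simps sum_distrib_left)

lemma herm_scaleR_left: "herm H (r *\<^sub>R a) x = r *\<^sub>R herm H a x"
  using herm_scaleC_left[of H "of_real r" a x] unfolding scaleC_of_real
  by (simp add: scaleR_conv_of_real[where 'a=complex])

lemma herm_scaleR_right: "herm H x (r *\<^sub>R a) = r *\<^sub>R herm H x a"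
  using herm_scaleC_right[of H x "of_real r" a] unfolding scaleC_of_real
  by (simp add: scaleR_conv_of_real[where 'a=complex])

lemma herm_minus_left: "herm H (- a) x = - herm H a x"
  using herm_scaleR_left[of H "-1" a x] by simp

lemma herm_diff_left: "herm H (a - b) x = herm H a x - herm H b x"
  using herm_add_left[of H a "- b" x] by (simp add: herm_minus_left)

lemma herm_zero_left [simp]: "herm H 0 x = 0" and herm_zero_right [simp]: "herm H x 0 = 0"
  by (simp_all add: herm_def)

lemmas herm_simps = herm_add_left herm_add_right herm_scaleC_left herm_scaleC_right herm_minus_left herm_diff_left

lemma bounded_bilinear_herm: "bounded_bilinear (herm H)"
proof -
  have "bilinear (herm H)"
    unfolding bilinear_def linear_iff
    by (simp add: herm_add_left herm_add_right herm_scaleR_left herm_scaleR_right)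
  then show ?thesis by (simp add: bilinear_conv_bounded_bilinear)
qed

lemma cnj_herm: assumes "positive_definite_hermitian H" shows "cnj (herm H a b) = herm H b a"
proof -
  have H: "cnj (H $ \<alpha> $ \<beta>) = H $ \<beta> $ \<alpha>" for \<alpha> \<beta>
    using assms unfolding positive_definite_hermitian_def by metis
  have "cnj (herm H a b) = (\<Sum>\<alpha>\<in>UNIV. \<Sum>\<beta>\<in>UNIV. H $ \<beta> $ \<alpha> * b $ \<beta> * cnj (a $ \<alpha>))"
    by (simp add: herm_def H mult_ac)
  also have "\<dots> = herm H b a" unfolding herm_def by (rule sum.swap)
  finally show ?thesis .
qed

lemma Re_herm_pos: "positive_definite_hermitian H \<Longrightarrow> z \<noteq> 0 \<Longrightarrow> Re (herm H z z) > 0"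
  unfolding positive_definite_hermitian_def hermitian_form_eq by blast

lemma herm_self_real: "positive_definite_hermitian H \<Longrightarrow> herm H z z = of_real (Re (herm H z z))"
  using arg_cong[OF cnj_herm[of H z z], of Im] by (simp add: complex_eq_iff)

lemma herm_self_eq_0: "positive_definite_hermitian H \<Longrightarrow> herm H z z = 0 \<longleftrightarrow> z = 0"
  by (metis Re_herm_pos herm_zero_left less_irrefl zero_complex.sel(1))

lemma herm_eq_0_commute: "positive_definite_hermitian H \<Longrightarrow> herm H a b = 0 \<longleftrightarrow> herm H b a = 0"
  by (metis cnj_herm complex_cnj_zero)

lemma linear_complex_expand:
  fixes D :: "complex \<Rightarrow> 'b::complex_normed_space"
  assumes "linear D"
  shows "D c = of_real (Re c) *\<^sub>C D 1 + of_real (Im c) *\<^sub>C D \<i>"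
proof -
  have "D c = D (Re c *\<^sub>R 1 + Im c *\<^sub>R \<i>)"
    by (rule arg_cong[of _ _ D]) (simp add: complex_eq_iff)
  then show ?thesis by (simp only: linear_add[OF assms] linear_cmul[OF assms] scaleC_of_real)
qed

lemma linear_complex_wirtinger:
  fixes D :: "complex \<Rightarrow> complex"
  assumes "linear D"
  shows "D c - \<i> * D (\<i> * c) = c * (D 1 - \<i> * D \<i>)"
    and "D c + \<i> * D (\<i> * c) = cnj c * (D 1 + \<i> * D \<i>)"
  using linear_complex_expand[OF assms, of c] linear_complex_expand[OF assms, of "\<i> * c"]
  by (simp_all add: complex_eq_iff algebra_simps add_divide_distrib diff_divide_distrib)

lemma smooth_on_dhol: "open U \<Longrightarrow> smooth_on v U \<Longrightarrow> smooth_on (dhol x v) U"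
  and smooth_on_dbar: "open U \<Longrightarrow> smooth_on v U \<Longrightarrow> smooth_on (dbar x v) U"
proof -
  assume U: "open U" "smooth_on v U"
  have "dhol x v = cderiv (1/2) (- \<i>/2) x (\<i> *\<^sub>C x) v" "dbar x v = cderiv (1/2) (\<i>/2) x (\<i> *\<^sub>C x) v"
    by (simp_all add: fun_eq_iff cderiv_def dhol_def dbar_def field_simps)
  then show "smooth_on (dhol x v) U" "smooth_on (dbar x v) U" using smooth_on_cderiv[OF U] by metis+
qed

text \<open>For \<open>\<psi> = - ln (- q)\<close> this is the logarithm of
  \<open>p / (- q)\<close>, so over the region \<open>q < 0\<close> its zero set is the
  hypersurface.\<close>

definition revolution_potential :: "complex ^ 'n ^ 'n \<Rightarrow> (complex \<Rightarrow> real) \<Rightarrow> (complex ^ 'n) \<times> complex \<Rightarrow> real"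
  where "revolution_potential H \<psi> x = ln (Re (herm H (fst x) (fst x))) + \<psi> (snd x)"

context circle_bundle
begin

lemma base_derivative:
  assumes "(u has_derivative u') (at (fst p))"
  shows "L X (\<lambda>p. u (fst p)) p = (1/2) *\<^sub>C (u' X - \<i> *\<^sub>C u' (\<i> *\<^sub>C X))"
    and "Lb X (\<lambda>p. u (fst p)) p = (1/2) *\<^sub>C (u' X + \<i> *\<^sub>C u' (\<i> *\<^sub>C X))"
    and "dT (\<lambda>p. u (fst p)) p = 0"
    and "dz X (\<lambda>p. u (fst p)) p = (1/2) *\<^sub>C (u' X - \<i> *\<^sub>C u' (\<i> *\<^sub>C X))"
    and "dzb X (\<lambda>p. u (fst p)) p = (1/2) *\<^sub>C (u' X + \<i> *\<^sub>C u' (\<i> *\<^sub>C X))"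
proof -
  have "((\<lambda>p. u (fst p)) has_derivative (\<lambda>r. u' (fst r))) (at p)"
    using has_derivative_compose[OF has_derivative_fst[OF has_derivative_ident] assms] .
  then have D: "frechet_derivative (\<lambda>p. u (fst p)) (at p) = (\<lambda>r. u' (fst r))"
    using frechet_derivative_at by metis
  have u0: "u' 0 = 0" using has_derivative_linear[OF assms] linear_0 by blast
  show t: "dT (\<lambda>p. u (fst p)) p = 0" by (simp add: dT_def cderiv_def D u0)
  show z: "dz X (\<lambda>p. u (fst p)) p = (1/2) *\<^sub>C (u' X - \<i> *\<^sub>C u' (\<i> *\<^sub>C X))"
    and zb: "dzb X (\<lambda>p. u (fst p)) p = (1/2) *\<^sub>C (u' X + \<i> *\<^sub>C u' (\<i> *\<^sub>C X))"
    by (simp_all add: dz_def dzb_def cderiv_def D scaleC_simps)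
  show "L X (\<lambda>p. u (fst p)) p = (1/2) *\<^sub>C (u' X - \<i> *\<^sub>C u' (\<i> *\<^sub>C X))"
    "Lb X (\<lambda>p. u (fst p)) p = (1/2) *\<^sub>C (u' X + \<i> *\<^sub>C u' (\<i> *\<^sub>C X))"
    by (simp_all add: L_def Lb_def t z zb)
qed

end

section \<open>The Fubini-Study metric plus \<open>h\<close> in homogeneous coordinates\<close>

locale revolution_chart = circle_bundle "revolution_potential H \<psi>" W
  for H :: "complex ^ 'n ^ 'n" and \<psi> :: "complex \<Rightarrow> real" and W +
  fixes U :: "complex set"
  assumes posH: "positive_definite_hermitian H" and open_U: "open U" and smooth_psi: "smooth_on \<psi> U"
    and W_dom: "\<And>p. p \<in> W \<Longrightarrow> fst (fst p) \<noteq> 0 \<and> snd (fst p) \<in> U"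
    and h_pos: "\<And>w. w \<in> U \<Longrightarrow> Re (dhol 1 (dbar 1 (\<lambda>u. of_real (\<psi> u))) w) > 0"
begin

definition psib where "psib = dbar 1 (\<lambda>u. complex_of_real (\<psi> u))"
definition h where "h = dhol 1 psib"
definition hw where "hw = dhol 1 h"
definition hb where "hb = dbar 1 h"
definition hwb where "hwb = dbar 1 hw"

abbreviation yc :: "((complex ^ 'n) \<times> complex) \<times> real \<Rightarrow> complex ^ 'n" where "yc p \<equiv> fst (fst p)"
abbreviation wc :: "((complex ^ 'n) \<times> complex) \<times> real \<Rightarrow> complex" where "wc p \<equiv> snd (fst p)"

definition iN where "iN p = 1 / herm H (yc p) (yc p)"

lemma smooth_psi_C: "smooth_on (\<lambda>u. complex_of_real (\<psi> u)) U"
  by (rule smooth_on_bounded_linear[OF bounded_linear_of_real open_U smooth_psi])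

lemma smooth_h: "smooth_on psib U" "smooth_on h U" "smooth_on hw U" "smooth_on hb U" "smooth_on hwb U"
proof -
  show 1: "smooth_on psib U" unfolding psib_def by (rule smooth_on_dbar[OF open_U smooth_psi_C])
  show 2: "smooth_on h U" unfolding h_def by (rule smooth_on_dhol[OF open_U 1])
  show 3: "smooth_on hw U" unfolding hw_def by (rule smooth_on_dhol[OF open_U 2])
  show "smooth_on hb U" unfolding hb_def by (rule smooth_on_dbar[OF open_U 2])
  show "smooth_on hwb U" unfolding hwb_def by (rule smooth_on_dbar[OF open_U 3])
qed

lemma sm_wc: assumes "smooth_on v U" shows "sm (\<lambda>p. v (wc p))"
proof -
  have s: "sm (\<lambda>p. wc p)"
    by (rule smooth_on_bounded_linear[OF bounded_linear_compose[OF bounded_linear_snd bounded_linear_fst]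
          open_W smooth_on_ident[OF open_W], unfolded o_def])
  show ?thesis by (rule smooth_on_compose[OF open_W open_U _ s assms]) (use W_dom in auto)
qed

lemma sm_herm: "sm (\<lambda>p. herm H (yc p) b)" "sm (\<lambda>p. herm H b (yc p))" "sm (\<lambda>p. herm H (yc p) (yc p))"
proof -
  have y: "sm (\<lambda>p. yc p)"
    by (rule smooth_on_bounded_linear[OF bounded_linear_compose[OF bounded_linear_fst bounded_linear_fst]
          open_W smooth_on_ident[OF open_W], unfolded o_def])
  show "sm (\<lambda>p. herm H (yc p) b)" "sm (\<lambda>p. herm H b (yc p))" "sm (\<lambda>p. herm H (yc p) (yc p))"
    by (rule smooth_on_bilinear[OF bounded_bilinear_herm open_W]; rule y sm_const)+
qed

lemma N_neq_0: "p \<in> W \<Longrightarrow> herm H (yc p) (yc p) \<noteq> 0"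
  using W_dom herm_self_eq_0[OF posH] by blast

lemma sm_iN: "sm iN"
  unfolding iN_def[abs_def] by (rule sm_divide[OF sm_const sm_herm(3) N_neq_0])

lemmas sm_chart = sm_intros sm_herm sm_iN smooth_h[THEN sm_wc]

context
  fixes p assumes p: "p \<in> W"
begin

lemma wc_derivs:
  assumes "smooth_on v U"
  shows "L (a, c) (\<lambda>p. v (wc p)) p = c * dhol 1 v (wc p)"
    and "Lb (a, c) (\<lambda>p. v (wc p)) p = cnj c * dbar 1 v (wc p)"
    and "dT (\<lambda>p. v (wc p)) p = 0"
proof -
  have w: "wc p \<in> U" using W_dom[OF p] by blast
  note d = smooth_on_has_derivative[OF assms w]
  have d': "((\<lambda>x. v (snd x)) has_derivative (\<lambda>x. frechet_derivative v (at (wc p)) (snd x))) (at (fst p))"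
    using has_derivative_compose[OF has_derivative_snd[OF has_derivative_ident] d] .
  note lin = has_derivative_linear[OF d]
  have s: "snd (\<i> *\<^sub>C (a, c)) = \<i> * c" by (simp add: scaleC_prod_def)
  show "L (a, c) (\<lambda>p. v (wc p)) p = c * dhol 1 v (wc p)"
    "Lb (a, c) (\<lambda>p. v (wc p)) p = cnj c * dbar 1 v (wc p)"
    "dT (\<lambda>p. v (wc p)) p = 0"
    using linear_complex_wirtinger[OF lin, of c] base_derivative(1,2)[OF d', where X="(a, c)"] base_derivative(3)[OF d']
    unfolding s by (simp_all add: dhol_def dbar_def)
qed

lemma herm_derivs:
  "L (a, c) (\<lambda>p. herm H (yc p) b) p = herm H a b" "Lb (a, c) (\<lambda>p. herm H (yc p) b) p = 0"
  "L (a, c) (\<lambda>p. herm H b (yc p)) p = 0" "Lb (a, c) (\<lambda>p. herm H b (yc p)) p = herm H b a"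
  "L (a, c) (\<lambda>p. herm H (yc p) (yc p)) p = herm H a (yc p)"
  "Lb (a, c) (\<lambda>p. herm H (yc p) (yc p)) p = herm H (yc p) a"
  "dT (\<lambda>p. herm H (yc p) b) p = 0" "dT (\<lambda>p. herm H b (yc p)) p = 0" "dT (\<lambda>p. herm H (yc p) (yc p)) p = 0"
proof -
  have d1: "((\<lambda>x. herm H (fst x) b) has_derivative (\<lambda>x. herm H (fst x) b)) (at (fst p))"
    by (rule bounded_linear.has_derivative[OF bounded_bilinear.bounded_linear_left[OF bounded_bilinear_herm]
        has_derivative_fst[OF has_derivative_ident]])
  have d2: "((\<lambda>x. herm H b (fst x)) has_derivative (\<lambda>x. herm H b (fst x))) (at (fst p))"
    by (rule bounded_linear.has_derivative[OF bounded_bilinear.bounded_linear_right[OF bounded_bilinear_herm]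
        has_derivative_fst[OF has_derivative_ident]])
  have d3: "((\<lambda>x. herm H (fst x) (fst x)) has_derivative
      (\<lambda>x. herm H (yc p) (fst x) + herm H (fst x) (yc p))) (at (fst p))"
    by (rule bounded_bilinear.FDERIV[OF bounded_bilinear_herm
        has_derivative_fst[OF has_derivative_ident] has_derivative_fst[OF has_derivative_ident]])
  have f: "fst (\<i> *\<^sub>C (a, c)) = \<i> *\<^sub>C a" by (simp add: scaleC_prod_def)
  show "L (a, c) (\<lambda>p. herm H (yc p) b) p = herm H a b" "Lb (a, c) (\<lambda>p. herm H (yc p) b) p = 0"
    "dT (\<lambda>p. herm H (yc p) b) p = 0"
    using base_derivative(1,2)[OF d1, where X="(a, c)"] base_derivative(3)[OF d1] unfolding f by (simp_all add: herm_simps)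
  show "L (a, c) (\<lambda>p. herm H b (yc p)) p = 0" "Lb (a, c) (\<lambda>p. herm H b (yc p)) p = herm H b a"
    "dT (\<lambda>p. herm H b (yc p)) p = 0"
    using base_derivative(1,2)[OF d2, where X="(a, c)"] base_derivative(3)[OF d2] unfolding f by (simp_all add: herm_simps)
  show "L (a, c) (\<lambda>p. herm H (yc p) (yc p)) p = herm H a (yc p)"
    "Lb (a, c) (\<lambda>p. herm H (yc p) (yc p)) p = herm H (yc p) a" "dT (\<lambda>p. herm H (yc p) (yc p)) p = 0"
    using base_derivative(1,2)[OF d3, where X="(a, c)"] base_derivative(3)[OF d3] unfolding f by (simp_all add: herm_simps algebra_simps)
qed

lemma iN_derivs:
  "L (a, c) iN p = - (herm H a (yc p) * iN p ^ 2)"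
  "Lb (a, c) iN p = - (herm H (yc p) a * iN p ^ 2)"
  "dT iN p = 0"
  unfolding iN_def[abs_def] using L_div[OF p sm_const sm_herm(3) N_neq_0] herm_derivs N_neq_0[OF p]
  by (simp_all add: power2_eq_square field_simps)

lemma Pb_eq: "Pb (b, d) p = herm H (yc p) b * iN p + cnj d * psib (wc p)"
proof -
  have y: "yc p \<noteq> 0" and w: "wc p \<in> U" using W_dom[OF p] by auto
  have pos: "Re (herm H (yc p) (yc p)) > 0" by (rule Re_herm_pos[OF posH y])
  have N: "herm H (yc p) (yc p) = of_real (Re (herm H (yc p) (yc p)))" by (rule herm_self_real[OF posH])
  have d3: "((\<lambda>x. herm H (fst x) (fst x)) has_derivative
      (\<lambda>x. herm H (yc p) (fst x) + herm H (fst x) (yc p))) (at (fst p))"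
    by (rule bounded_bilinear.FDERIV[OF bounded_bilinear_herm
        has_derivative_fst[OF has_derivative_ident] has_derivative_fst[OF has_derivative_ident]])
  note d4 = bounded_linear.has_derivative[OF bounded_linear_Re d3]
  have "((\<lambda>x. ln (Re (herm H (fst x) (fst x)))) has_derivative
      (\<lambda>x. Re (herm H (yc p) (fst x) + herm H (fst x) (yc p)) / Re (herm H (yc p) (yc p)))) (at (fst p))"
    using has_derivative_compose[OF d4 DERIV_ln[OF pos, unfolded has_field_derivative_def]]
    by (simp add: divide_inverse mult.commute)
  note d5 = this
  note dpsi = smooth_on_has_derivative[OF smooth_psi w]
  have d6: "((\<lambda>x. \<psi> (snd x)) has_derivative (\<lambda>x. frechet_derivative \<psi> (at (wc p)) (snd x))) (at (fst p))"
    using has_derivative_compose[OF has_derivative_snd[OF has_derivative_ident] dpsi] .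
  have d7: "((\<lambda>x. complex_of_real (revolution_potential H \<psi> x)) has_derivative
     (\<lambda>x. of_real (Re (herm H (yc p) (fst x) + herm H (fst x) (yc p)) / Re (herm H (yc p) (yc p)) +
       frechet_derivative \<psi> (at (wc p)) (snd x)))) (at (fst p))"
    unfolding revolution_potential_def
    by (rule bounded_linear.has_derivative[OF bounded_linear_of_real has_derivative_add[OF d5 d6]])
  have dC: "frechet_derivative (\<lambda>u. complex_of_real (\<psi> u)) (at (wc p)) =
      (\<lambda>x. of_real (frechet_derivative \<psi> (at (wc p)) x))"
    using frechet_derivative_at[OF bounded_linear.has_derivative[OF bounded_linear_of_real dpsi]] by metis
  have lin: "linear (\<lambda>x. complex_of_real (frechet_derivative \<psi> (at (wc p)) x))"
    by (rule has_derivative_linear[OF bounded_linear.has_derivative[OF bounded_linear_of_real dpsi]])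
  have e: "complex_of_real (Re (herm H (yc p) x + herm H x (yc p)) / Re (herm H (yc p) (yc p))) =
      (herm H (yc p) x + herm H x (yc p)) * iN p" for x
  proof -
    have "herm H x (yc p) = cnj (herm H (yc p) x)" by (simp add: cnj_herm[OF posH])
    then have 1: "herm H (yc p) x + herm H x (yc p) = of_real (Re (herm H (yc p) x + herm H x (yc p)))"
      by (simp add: complex_eq_iff)
    have 2: "iN p = of_real (1 / Re (herm H (yc p) (yc p)))" unfolding iN_def by (subst N) simp
    have "A = of_real a \<Longrightarrow> m = of_real (1 / b) \<Longrightarrow> of_real (a / b) = A * m" for A m :: complex and a b
      by simp
    from this[OF 1 2] show ?thesis .
  qed
  have r: "complex_of_real (Re (herm H (yc p) x + herm H x (yc p)) / Re (herm H (yc p) (yc p)) + t) =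
      (herm H (yc p) x + herm H x (yc p)) * iN p + of_real t" for x t
    by (simp only: of_real_add e)
  have "Pb (b, d) p = ((herm H (yc p) b + herm H b (yc p)) * iN p
      + \<i> * ((herm H (yc p) (\<i> *\<^sub>C b) + herm H (\<i> *\<^sub>C b) (yc p)) * iN p)) / 2
      + (of_real (frechet_derivative \<psi> (at (wc p)) d) + \<i> * of_real (frechet_derivative \<psi> (at (wc p)) (\<i> * d))) / 2"
    unfolding Pb_def base_derivative(5)[OF d7] r
    by (simp add: scaleC_prod_def add_divide_distrib distrib_left)
  also have "\<dots> = herm H (yc p) b * iN p + cnj d * psib (wc p)"
    unfolding linear_complex_wirtinger(2)[OF lin, of d]
    by (simp add: herm_simps psib_def dbar_def dC field_simps)
  finally show ?thesis .
qed

end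

text \<open>The part without \<open>h\<close> is the Fubini-Study form in homogeneous coordinates;
  it degenerates along the radial vector \<open>(yc p, 0)\<close>.\<close>

lemma g_eq: assumes p: "p \<in> W"
  shows "g (a, c) (b, d) p = herm H a b * iN p - herm H (yc p) b * herm H a (yc p) * iN p ^ 2 + c * cnj d * h (wc p)"
proof -
  have "g (a, c) (b, d) p = L (a, c) (\<lambda>p. herm H (yc p) b * iN p + cnj d * psib (wc p)) p"
    unfolding g_eqs(1)[OF p] by (rule L_cong[OF p Pb_eq])
  also have "\<dots> = herm H a b * iN p - herm H (yc p) b * herm H a (yc p) * iN p ^ 2 + c * cnj d * h (wc p)"
    by (simp add: L_add[OF p] L_diff[OF p] L_mult[OF p] sm_chart wc_derivs(1)[OF p smooth_h(1)] herm_derivs[OF p]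
        iN_derivs[OF p] h_def power2_eq_square)
  finally show ?thesis .
qed

lemma L_g_eq: assumes p: "p \<in> W"
  shows "L (a, c) (g (a, c) (b, d)) p = - 2 * herm H a b * herm H a (yc p) * iN p ^ 2
    + 2 * herm H (yc p) b * herm H a (yc p) ^ 2 * iN p ^ 3 + c ^ 2 * cnj d * hw (wc p)"
proof -
  have "L (a, c) (g (a, c) (b, d)) p = L (a, c) (\<lambda>p. herm H a b * iN p
      - herm H (yc p) b * (herm H a (yc p) * (iN p * iN p)) + c * cnj d * h (wc p)) p"
    by (rule L_cong[OF p]) (simp add: g_eq power2_eq_square)
  also have "\<dots> = - 2 * herm H a b * herm H a (yc p) * iN p ^ 2
    + 2 * herm H (yc p) b * herm H a (yc p) ^ 2 * iN p ^ 3 + c ^ 2 * cnj d * hw (wc p)"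
    by (simp add: L_add[OF p] L_diff[OF p] L_mult[OF p] sm_chart wc_derivs(1)[OF p smooth_h(2)] herm_derivs[OF p]
        iN_derivs[OF p] hw_def)
       (simp add: algebra_simps power2_eq_square power3_eq_cube)
  finally show ?thesis .
qed

lemma Lb_g_eq: assumes p: "p \<in> W"
  shows "Lb (b, d) (g (a, c) (b, d)) p = - 2 * herm H a b * herm H (yc p) b * iN p ^ 2
    + 2 * herm H a (yc p) * herm H (yc p) b ^ 2 * iN p ^ 3 + c * cnj d ^ 2 * hb (wc p)"
proof -
  have "Lb (b, d) (g (a, c) (b, d)) p = Lb (b, d) (\<lambda>p. herm H a b * iN p
      - herm H (yc p) b * (herm H a (yc p) * (iN p * iN p)) + c * cnj d * h (wc p)) p"
    by (rule Lb_cong[OF p]) (simp add: g_eq power2_eq_square)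
  also have "\<dots> = - 2 * herm H a b * herm H (yc p) b * iN p ^ 2
    + 2 * herm H a (yc p) * herm H (yc p) b ^ 2 * iN p ^ 3 + c * cnj d ^ 2 * hb (wc p)"
    by (simp add: Lb_add[OF p] Lb_diff[OF p] Lb_mult[OF p] sm_chart wc_derivs(2)[OF p smooth_h(2)] herm_derivs[OF p]
        iN_derivs[OF p] hb_def)
       (simp add: algebra_simps power2_eq_square power3_eq_cube)
  finally show ?thesis .
qed

text \<open>For vectors orthogonal to \<open>yc p\<close> the first-order terms of the Fubini-Study
  part vanish at \<open>p\<close>; the term \<open>- 2 * (herm H a b * iN p) ^ 2\<close> is the
  trace of its constant curvature.\<close>

lemma Lb_L_g_eq: assumes p: "p \<in> W" and "herm H a (yc p) = 0" "herm H (yc p) b = 0"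
  shows "Lb (b, d) (L (a, c) (g (a, c) (b, d))) p = - 2 * (herm H a b * iN p) ^ 2 + c ^ 2 * cnj d ^ 2 * hwb (wc p)"
proof -
  have "Lb (b, d) (L (a, c) (g (a, c) (b, d))) p = Lb (b, d) (\<lambda>p. - 2 * herm H a b * (herm H a (yc p) * (iN p * iN p))
    + 2 * (herm H (yc p) b * ((herm H a (yc p) * herm H a (yc p)) * (iN p * (iN p * iN p)))) + c ^ 2 * cnj d * hw (wc p)) p"
    by (rule Lb_cong[OF p]) (simp add: L_g_eq power2_eq_square power3_eq_cube)
  also have "\<dots> = - 2 * (herm H a b * iN p) ^ 2 + c ^ 2 * cnj d ^ 2 * hwb (wc p)"
    by (simp add: Lb_add[OF p] Lb_diff[OF p] Lb_mult[OF p] sm_chart wc_derivs(2)[OF p smooth_h(3)] herm_derivs[OF p] assms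
        iN_derivs[OF p] hwb_def)
       (simp add: algebra_simps power2_eq_square power3_eq_cube)
  finally show ?thesis .
qed

text \<open>Reality comes from the Hermitian symmetry of \<open>g\<close> in the direction
  \<open>(0, 1)\<close>, where \<open>g\<close> reduces to \<open>h\<close>.\<close>

lemma h_real: assumes "p \<in> W" shows "h (wc p) = of_real (Re (h (wc p)))" "Re (h (wc p)) > 0"
proof -
  have "g (0, 1) (0, 1) p = h (wc p)" using g_eq[OF assms, of 0 1 0 1] by simp
  then have "cnj (h (wc p)) = h (wc p)" using cnj_g[OF assms] by metis
  then show "h (wc p) = of_real (Re (h (wc p)))" by (simp add: complex_eq_iff)
  show "Re (h (wc p)) > 0" unfolding h_def psib_def using h_pos W_dom[OF assms] by blast
qed

lemma hb_eq: assumes p: "p \<in> W" shows "hb (wc p) = cnj (hw (wc p))"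
proof -
  have "Lb (0, 1) (\<lambda>p. h (wc p)) p = Lb (0, 1) (\<lambda>p. cnj (h (wc p))) p"
    by (rule Lb_cong[OF p]) (metis h_real(1) complex_cnj_complex_of_real)
  also have "\<dots> = cnj (L (0, 1) (\<lambda>p. h (wc p)) p)"
    by (rule Lb_cnj[OF p sm_wc[OF smooth_h(2)]])
  finally show ?thesis using wc_derivs(1,2)[OF p smooth_h(2), of 0 1] by (simp add: hw_def hb_def)
qed

end

section \<open>The second fundamental form vanishes\<close>

text \<open>The coordinate \<open>None\<close> is the added dimension that will carry
  \<open>s x^2\<close>. The same embedding later identifies \<open>C^n x C\<close> with the vectors
  indexed by \<open>'n option\<close>.\<close>

definition emb :: "complex ^ 'm \<Rightarrow> complex \<Rightarrow> complex ^ ('m option)"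
  where "emb u c = (\<chi> i. case i of None \<Rightarrow> c | Some j \<Rightarrow> u $ j)"

lemma hip_emb: "hip (emb u c) (emb v d) = hip u v + c * cnj d"
proof -
  have "hip (emb u c) (emb v d) = (\<Sum>i\<in>insert None (range Some). (emb u c) $ i * cnj ((emb v d) $ i))"
    by (simp add: hip_def UNIV_option_conv)
  also have "\<dots> = c * cnj d + (\<Sum>i\<in>range Some. (emb u c) $ i * cnj ((emb v d) $ i))"
    by (subst sum.insert) (auto simp: emb_def)
  also have "(\<Sum>i\<in>range Some. (emb u c) $ i * cnj ((emb v d) $ i)) = hip u v"
    by (subst sum.reindex) (auto simp: emb_def hip_def)
  finally show ?thesis by simp
qed

lemma emb_add: "emb u c + emb v d = emb (u + v) (c + d)"
  by (simp add: emb_def vec_eq_iff split: option.split)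

lemma emb_scaleC: "a *\<^sub>C emb u c = emb (a *\<^sub>C u) (a * c)"
  by (simp add: emb_def vec_eq_iff split: option.split)

lemma emb_scaleR: "a *\<^sub>R emb u c = emb (a *\<^sub>R u) (a *\<^sub>R c)"
  by (simp add: emb_def vec_eq_iff split: option.split)

lemma emb_eq_0_iff: "emb u c = 0 \<longleftrightarrow> u = 0 \<and> c = 0"
  by (auto simp: emb_def vec_eq_iff split: option.split)

context circle_bundle
begin

lemma L_scaleR: "p \<in> W \<Longrightarrow> sm f \<Longrightarrow> L (s *\<^sub>R X) f p = s *\<^sub>R L X f p"
  using L_linear(2)[of p f "of_real s" X] by (simp add: scaleC_of_real)

context
  fixes f :: "'e \<times> real \<Rightarrow> 'b::{complex_normed_space,euclidean_space}" and p
  assumes f: "sm f" and p: "p \<in> W"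
begin

lemma LL_linear_right:
  "L X (L (Y + Z) f) p = L X (L Y f) p + L X (L Z f) p"
  "L X (L (c *\<^sub>C Y) f) p = c *\<^sub>C L X (L Y f) p"
proof -
  have "L X (L (Y + Z) f) p = L X (\<lambda>x. L Y f x + L Z f x) p"
    by (rule L_cong[OF p L_linear(1)[OF _ f]])
  then show "L X (L (Y + Z) f) p = L X (L Y f) p + L X (L Z f) p"
    by (simp add: L_add[OF p] sm_L f)
  have "L X (L (c *\<^sub>C Y) f) p = L X (\<lambda>x. c *\<^sub>C L Y f x) p"
    by (rule L_cong[OF p L_linear(2)[OF _ f]])
  then show "L X (L (c *\<^sub>C Y) f) p = c *\<^sub>C L X (L Y f) p"
    by (simp add: L_scaleC[OF p] sm_L f sm_const)
qed

lemma LL_linear_left: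
  "L (Y + Z) (L X f) p = L Y (L X f) p + L Z (L X f) p"
  "L (c *\<^sub>C Y) (L X f) p = c *\<^sub>C L Y (L X f) p"
  by (rule L_linear[OF p sm_L[OF f]])+

lemma LL_scaleR:
  "L (s *\<^sub>R Y) (L X f) p = s *\<^sub>R L Y (L X f) p" "L X (L (s *\<^sub>R Y) f) p = s *\<^sub>R L X (L Y f) p"
  using LL_linear_left(2)[of "of_real s" Y X] LL_linear_right(2)[of X "of_real s" Y]
  by (simp_all add: scaleC_of_real)

end

end

text \<open>\<open>hom\<close> says that \<open>f\<close> is killed by the radial (1,0) field, the
  direction that homogeneous coordinates have in excess. \<open>curvature_le\<close> is K >= -2
  multiplied by the cube of \<open>h\<close>, and the first part of \<open>dims\<close> is N + 2 <=
  2n.\<close>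

locale revolution_map = revolution_chart H \<psi> W U + cr_sphere_map "revolution_potential H \<psi>" W f
  for H :: "complex ^ 'n ^ 'n" and \<psi> :: "complex \<Rightarrow> real" and W U
    and f :: "((complex ^ 'n) \<times> complex) \<times> real \<Rightarrow> complex ^ 'm" +
  assumes hom: "\<And>p. p \<in> W \<Longrightarrow> L (fst (fst p), 0) f p = 0"
    and dims: "CARD('m) + 1 \<le> 2 * CARD('n)" and dim2: "2 \<le> CARD('n)"
    and curvature_le: "\<And>p. p \<in> W \<Longrightarrow> Re (h (snd (fst p)) * hwb (snd (fst p)) - hw (snd (fst p)) * hb (snd (fst p)))
      \<le> 2 * Re (h (snd (fst p))) ^ 3"
begin

abbreviation dw :: "(complex ^ 'n) \<times> complex" where "dw \<equiv> (0, 1)"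
abbreviation dy :: "complex ^ 'n \<Rightarrow> (complex ^ 'n) \<times> complex" where "dy a \<equiv> (a, 0)"

lemma hwb_real: assumes p: "p \<in> W" shows "cnj (hwb (wc p)) = hwb (wc p)"
proof -
  have sh: "sm (\<lambda>p. h (wc p))" by (rule sm_wc[OF smooth_h(2)])
  have 1: "L dw (\<lambda>p. h (wc p)) x = hw (wc x)" "Lb dw (\<lambda>p. h (wc p)) x = hb (wc x)" if "x \<in> W" for x
    using wc_derivs(1,2)[OF that smooth_h(2), of 0 1] by (simp_all add: hw_def hb_def)
  have 2: "hwb (wc p) = Lb dw (L dw (\<lambda>p. h (wc p))) p"
    using Lb_cong[OF p 1(1), where X=dw] wc_derivs(2)[OF p smooth_h(3), of 0 1] by (simp add: hwb_def)
  also have "\<dots> = L dw (Lb dw (\<lambda>p. h (wc p))) p"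
    using Lb_L[OF sh p, of dw dw] wc_derivs(3)[OF p smooth_h(2)] by simp
  also have "\<dots> = L dw (\<lambda>p. cnj (hw (wc p))) p"
    by (rule L_cong[OF p]) (simp add: 1 hb_eq)
  also have "\<dots> = cnj (Lb dw (\<lambda>p. hw (wc p)) p)"
    by (rule L_cnj[OF p sm_wc[OF smooth_h(3)]])
  also have "\<dots> = cnj (hwb (wc p))"
    using wc_derivs(2)[OF p smooth_h(3), of 0 1] by (simp add: hwb_def)
  finally show ?thesis by simp
qed

text \<open>The Gram identity in the direction \<open>dw\<close> writes \<open>lam * h\<close> as a
  squared norm; the sign of \<open>lam\<close> follows from \<open>h > 0\<close>.\<close>

lemma lam_eq: assumes p: "p \<in> W"
  shows "lam p = of_real (Re (lam p))" "Re (lam p) * Re (h (wc p)) = (norm (L dw f p))\<^sup>2" "Re (lam p) \<ge> 0"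
proof -
  show 1: "lam p = of_real (Re (lam p))" using lam_real[OF p] by (simp add: complex_eq_iff)
  have "of_real ((norm (L dw f p))\<^sup>2) = lam p * h (wc p)"
    using gram[OF p, of dw dw] g_eq[OF p, of 0 1 0 1] by (simp add: hip_self)
  then show 2: "Re (lam p) * Re (h (wc p)) = (norm (L dw f p))\<^sup>2"
    by (metis 1 h_real(1)[OF p] of_real_mult Re_complex_of_real)
  show "Re (lam p) \<ge> 0" using 2 h_real(2)[OF p] by (metis zero_le_mult_iff zero_le_power2 less_le_not_le)
qed

lemma dy_expand: "dy a = (\<Sum>j\<in>UNIV. a $ j *\<^sub>C dy (axis j 1))"
proof -
  have "(\<Sum>j\<in>UNIV. a $ j *\<^sub>C dy (axis j 1)) = dy (\<Sum>j\<in>UNIV. a $ j *\<^sub>C axis j 1)"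
    by (simp add: prod_eq_iff scaleC_prod_def fst_sum snd_sum)
  also have "(\<Sum>j\<in>UNIV. a $ j *\<^sub>C axis j 1) = a"
    by (simp add: vec_eq_iff sum_component axis_def if_distrib cong: if_cong)
  finally show ?thesis by simp
qed

lemma L_dy_expand:
  assumes p: "p \<in> W" and "sm k"
  shows "L (dy a) k p = (\<Sum>j\<in>UNIV. a $ j *\<^sub>C L (dy (axis j 1)) k p)"
proof -
  have L0: "L 0 k p = 0" using L_linear(2)[OF p assms(2), of 0 0] by simp
  have "L (\<Sum>j\<in>J. a $ j *\<^sub>C dy (axis j 1)) k p = (\<Sum>j\<in>J. a $ j *\<^sub>C L (dy (axis j 1)) k p)" if "finite J" for J
    using that by (induction J) (simp_all add: L0 L_linear[OF p assms(2)])
  from this[of UNIV] show ?thesis by (subst dy_expand) simp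
qed

lemma sm_yc: "sm (\<lambda>p. yc p $ j)"
  by (rule smooth_on_bounded_linear[OF bounded_linear_compose[OF bounded_linear_vec_nth
      bounded_linear_compose[OF bounded_linear_fst bounded_linear_fst]] open_W smooth_on_ident[OF open_W], unfolded o_def])

lemma yc_derivs: "L (a, c) (\<lambda>p. yc p $ j) p = a $ j" "dT (\<lambda>p. yc p $ j) p = 0"
proof -
  have d: "((\<lambda>x. fst x $ j) has_derivative (\<lambda>x. fst x $ j)) (at (fst p))"
    by (rule bounded_linear.has_derivative[OF bounded_linear_vec_nth has_derivative_fst[OF has_derivative_ident]])
  show "L (a, c) (\<lambda>p. yc p $ j) p = a $ j" "dT (\<lambda>p. yc p $ j) p = 0"
    using base_derivative(1)[OF d, where X="(a, c)"] base_derivative(3)[OF d] by (simp_all add: scaleC_prod_def)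
qed

lemma L_sum: "p \<in> W \<Longrightarrow> (\<And>j. j \<in> J \<Longrightarrow> sm (k j)) \<Longrightarrow> L X (\<lambda>x. \<Sum>j\<in>J. k j x) p = (\<Sum>j\<in>J. L X (k j) p)"
  and T_sum: "p \<in> W \<Longrightarrow> (\<And>j. j \<in> J \<Longrightarrow> sm (k j)) \<Longrightarrow> dT (\<lambda>x. \<Sum>j\<in>J. k j x) p = (\<Sum>j\<in>J. dT (k j) p)"
  by (induction J rule: infinite_finite_induct) (simp_all add: L_add T_add sm_sum)

text \<open>In \<open>hom\<close> the vector \<open>yc p\<close> moves with the point, whereas
  \<open>L\<close> takes constant vectors. Expanding in the axis vectors and differentiating
  \<open>hom\<close> produces an extra term from the moving coefficients, and this term is
  \<open>L (dy a) f\<close>.\<close>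

lemma L_radial: assumes p: "p \<in> W"
  shows "L (a, c) (L (dy (yc p)) f) p = - L (dy a) f p" "dT (L (dy (yc p)) f) p = 0"
proof -
  let ?k = "\<lambda>j x. yc x $ j *\<^sub>C L (dy (axis j 1)) f x"
  have s: "sm (L (dy (axis j 1)) f)" for j by (rule sm_L[OF sm_f])
  have sk: "sm (?k j)" for j by (intro sm_scaleC sm_yc s)
  have z: "(\<Sum>j\<in>UNIV. ?k j x) = 0" if "x \<in> W" for x
    using hom[OF that] L_dy_expand[OF that sm_f, of "yc x"] by simp
  have "L (a, c) (\<lambda>x. \<Sum>j\<in>UNIV. ?k j x) p = 0" "dT (\<lambda>x. \<Sum>j\<in>UNIV. ?k j x) p = 0"
    using L_cong[OF p z] T_cong[OF p z] by auto
  then have 1: "(\<Sum>j\<in>UNIV. yc p $ j *\<^sub>C L (a, c) (L (dy (axis j 1)) f) p + a $ j *\<^sub>C L (dy (axis j 1)) f p) = 0"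
    and 2: "(\<Sum>j\<in>UNIV. yc p $ j *\<^sub>C dT (L (dy (axis j 1)) f) p) = 0"
    by (simp_all add: L_sum[OF p sk] T_sum[OF p sk] L_scaleC[OF p sm_yc s] T_scaleC[OF p sm_yc s] yc_derivs)
  have "L (a, c) (L (dy (yc p)) f) p = L (a, c) (\<lambda>x. \<Sum>j\<in>UNIV. yc p $ j *\<^sub>C L (dy (axis j 1)) f x) p"
    by (rule L_cong[OF p L_dy_expand[OF _ sm_f]])
  also have "\<dots> = (\<Sum>j\<in>UNIV. yc p $ j *\<^sub>C L (a, c) (L (dy (axis j 1)) f) p)"
    by (subst L_sum[OF p sm_scaleC[OF sm_const s]]) (simp add: L_scaleC[OF p sm_const s])
  also have "\<dots> = - (\<Sum>j\<in>UNIV. a $ j *\<^sub>C L (dy (axis j 1)) f p)"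
    using 1 by (simp add: sum.distrib add_eq_0_iff)
  finally show "L (a, c) (L (dy (yc p)) f) p = - L (dy a) f p"
    unfolding L_dy_expand[OF p sm_f, of a] .
  have "dT (L (dy (yc p)) f) p = dT (\<lambda>x. \<Sum>j\<in>UNIV. yc p $ j *\<^sub>C L (dy (axis j 1)) f x) p"
    by (rule T_cong[OF p L_dy_expand[OF _ sm_f]])
  also have "\<dots> = (\<Sum>j\<in>UNIV. yc p $ j *\<^sub>C dT (L (dy (axis j 1)) f) p)"
    by (subst T_sum[OF p sm_scaleC[OF sm_const s]]) (simp add: T_scaleC[OF p sm_const s])
  finally show "dT (L (dy (yc p)) f) p = 0" using 2 by simp
qed

lemma lam_radial: "p \<in> W \<Longrightarrow> L (dy (yc p)) lam p = 0"
  using LG_f[of p "dy (yc p)"] L_G[of p "dy (yc p)"] L_radial(2)[of p] by simp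

definition al :: "complex ^ 'n \<Rightarrow> ((complex ^ 'n) \<times> complex) \<times> real \<Rightarrow> complex"
  where "al a p = herm H a (yc p) * iN p"

lemma split_radial: assumes p: "p \<in> W"
  shows "a = al a p *\<^sub>C yc p + (a - al a p *\<^sub>C yc p)" "herm H (a - al a p *\<^sub>C yc p) (yc p) = 0"
  using N_neq_0[OF p] by (simp_all add: al_def iN_def herm_simps)

lemma L_tangential: assumes p: "p \<in> W"
  shows "L (a - al a p *\<^sub>C yc p, c) f p = L (a, c) f p" "L (a - al a p *\<^sub>C yc p, c) lam p = L (a, c) lam p"
proof -
  have e: "(a, c) = (a - al a p *\<^sub>C yc p, c) + al a p *\<^sub>C dy (yc p)" by (simp add: scaleC_prod_def)
  have "L (a, c) f p = L ((a - al a p *\<^sub>C yc p, c) + al a p *\<^sub>C dy (yc p)) f p"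
    by (rule arg_cong[OF e, of "\<lambda>X. L X f p"])
  then show "L (a - al a p *\<^sub>C yc p, c) f p = L (a, c) f p"
    unfolding L_linear[OF p sm_f] hom[OF p] by simp
  have "L (a, c) lam p = L ((a - al a p *\<^sub>C yc p, c) + al a p *\<^sub>C dy (yc p)) lam p"
    by (rule arg_cong[OF e, of "\<lambda>X. L X lam p"])
  then show "L (a - al a p *\<^sub>C yc p, c) lam p = L (a, c) lam p"
    unfolding L_linear[OF p sm_lam] lam_radial[OF p] by simp
qed

text \<open>The radial part of \<open>a\<close> is invisible to \<open>L\<close> and is stored in
  the coefficient of \<open>G\<close> instead. Pairing with \<open>f\<close> recovers that
  coefficient, and the Gram identity recovers the rest.\<close>

lemma tangent_injective:
  assumes p: "p \<in> W" and lam0: "lam p \<noteq> 0" and z: "L (a, c) f p + herm H a (yc p) *\<^sub>C G p = 0"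
  shows "a = 0 \<and> c = 0"
proof -
  have "hip (L (a, c) f p + herm H a (yc p) *\<^sub>C G p) (f p) = - herm H a (yc p) * lam p"
    by (simp add: hip_simps Lf_f[OF p] lam_def)
  then have a: "herm H a (yc p) = 0" using z lam0 by simp
  then have "g (a, c) (a, c) p = 0" using z gram[OF p, of "(a, c)" "(a, c)"] lam0 by simp
  then have "Re (herm H a a * iN p + c * cnj c * h (wc p)) = 0"
    using g_eq[OF p, of a c a c] a by simp
  moreover have "iN p = of_real (1 / Re (herm H (yc p) (yc p)))"
    unfolding iN_def by (subst herm_self_real[OF posH]) simp
  moreover obtain hr where hr: "h (wc p) = of_real hr" "hr > 0" using h_real[OF p] by blast
  ultimately have "Re (herm H a a) / Re (herm H (yc p) (yc p)) + (cmod c)\<^sup>2 * hr = 0"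
    by (simp add: complex_mult_cnj cmod_power2 flip: of_real_mult of_real_add)
  moreover have "Re (herm H a a) \<ge> 0" "Re (herm H (yc p) (yc p)) > 0"
    using Re_herm_pos[OF posH, of a] Re_herm_pos[OF posH, of "yc p"] W_dom[OF p]
    by (cases "a = 0"; auto)+
  ultimately have "Re (herm H a a) / Re (herm H (yc p) (yc p)) = 0" "(cmod c)\<^sup>2 * hr = 0"
    using hr(2) by (smt (verit) divide_nonneg_pos mult_nonneg_nonneg zero_le_power2)+
  then show ?thesis using hr(2) Re_herm_pos[OF posH, of a] Re_herm_pos[OF posH, of "yc p"] W_dom[OF p]
    by (cases "a = 0") auto
qed

context
  fixes p assumes p: "p \<in> W" and lam0: "lam p \<noteq> 0"
begin

lemma h0: "h (wc p) \<noteq> 0" using h_real(2)[OF p] by auto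

text \<open>The quadratic form of the second fundamental form. The subtracted terms are Christoffel
  terms of the metric \<open>lam * g\<close>; those of the Fubini-Study part vanish for vectors
  orthogonal to \<open>yc p\<close>, whence the restriction in \<open>II_Lf\<close>.\<close>

definition II :: "(complex ^ 'n) \<times> complex \<Rightarrow> complex ^ 'm"
  where "II X = L X (L X f) p - (2 * L X lam p / lam p) *\<^sub>C L X f p
    - (hw (wc p) / h (wc p) * (snd X)\<^sup>2) *\<^sub>C L dw f p"

lemma II_f: "hip (II X) (f p) = 0"
  by (simp add: II_def hip_simps LLf_f[OF p] Lf_f[OF p])

lemma II_Lf: assumes "herm H (fst X) (yc p) = 0" shows "hip (II X) (L Y f p) = 0"
proof -
  obtain a c b d where XY: "X = (a, c)" "Y = (b, d)" by fastforce
  have "hip (II X) (L Y f p) = lam p * L X (g X Y) p + 2 * (g X Y p * L X lam p)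
      - 2 * L X lam p / lam p * (lam p * g X Y p) - hw (wc p) / h (wc p) * c\<^sup>2 * (lam p * g dw Y p)"
    by (simp add: II_def hip_simps LLf_Lf[OF p] gram[OF p] XY)
  also have "\<dots> = 0"
    using lam0 h0 L_g_eq[OF p, of a c b d] assms by (simp add: XY g_eq[OF p])
  finally show ?thesis .
qed

text \<open>Orthogonality of \<open>X\<close> and \<open>Y\<close> expresses the Fubini-Study
  product by the \<open>w\<close> components, so the Fubini-Study curvature enters as
  \<open>- 2 * (h (wc p))\<^sup>2\<close>. This is the origin of the threshold -2: the bracket
  equals \<open>- (K + 2)\<close> times the square of \<open>h\<close>.\<close>

lemma II_II:
  assumes "herm H (fst X) (yc p) = 0" "herm H (fst Y) (yc p) = 0" "g X Y p = 0"
  shows "hip (II X) (II Y) = lam p * (hwb (wc p) - hw (wc p) * hb (wc p) / h (wc p) - 2 * (h (wc p))\<^sup>2) * (snd X)\<^sup>2 * (cnj (snd Y))\<^sup>2"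
proof -
  obtain a c b d where XY: "X = (a, c)" "Y = (b, d)" by fastforce
  have y: "herm H a (yc p) = 0" "herm H b (yc p) = 0" "herm H (yc p) b = 0"
    using assms herm_eq_0_commute[OF posH] by (auto simp: XY)
  have hc: "cnj (h (wc p)) = h (wc p)" by (subst (1 2) h_real(1)[OF p]) simp
  have ab: "herm H a b * iN p = - (c * cnj d * h (wc p))"
    using assms(3) g_eq[OF p, of a c b d] y by (simp add: XY add_eq_0_iff)
  have e: "hip (II X) (II Y) = hip (II X) (L Y (L Y f) p)"
    by (subst (2) II_def) (simp add: hip_simps II_Lf[OF assms(1)])
  also have "\<dots> = hip (L X (L X f) p) (L Y (L Y f) p)
      - (2 * L X lam p / lam p) * hip (L X f p) (L Y (L Y f) p)
      - (hw (wc p) / h (wc p) * c\<^sup>2) * hip (L dw f p) (L Y (L Y f) p)"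
    by (simp add: II_def hip_simps XY)
  also have "hip (L X f p) (L Y (L Y f) p) = cnj (lam p * L Y (g Y X) p + 2 * (g Y X p * L Y lam p))"
    by (subst cnj_hip[symmetric]) (simp add: LLf_Lf[OF p])
  also have "hip (L dw f p) (L Y (L Y f) p) = cnj (lam p * L Y (g Y dw) p + 2 * (g Y dw p * L Y lam p))"
    by (subst cnj_hip[symmetric]) (simp add: LLf_Lf[OF p])
  also have "g Y X p = 0" using cnj_g[OF p, of X Y] assms(3) by simp
  also have "L Y (g Y X) p = d\<^sup>2 * cnj c * hw (wc p)"
    using L_g_eq[OF p, of b d a c] y by (simp add: XY)
  also have "L Y (g Y dw) p = d\<^sup>2 * hw (wc p)"
    using L_g_eq[OF p, of b d 0 1] y by (simp add: XY)
  also have "g Y dw p = d * h (wc p)"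
    using g_eq[OF p, of b d 0 1] y by (simp add: XY)
  also have "hip (L X (L X f) p) (L Y (L Y f) p) =
    lam p * (- 2 * (c * cnj d * h (wc p))\<^sup>2 + c\<^sup>2 * (cnj d)\<^sup>2 * hwb (wc p))
    + 2 * Lb Y lam p * (c\<^sup>2 * cnj d * hw (wc p)) + 2 * (c * (cnj d)\<^sup>2 * hb (wc p)) * L X lam p"
    unfolding gauss_equation[OF p assms(3)]
    using Lb_L_g_eq[OF p y(1,3), of d c] L_g_eq[OF p, of a c b d] Lb_g_eq[OF p, of b d a c] y ab
    by (simp add: XY)
  finally have "hip (II X) (II Y) =
    lam p * (- 2 * (c * cnj d * h (wc p))\<^sup>2 + c\<^sup>2 * (cnj d)\<^sup>2 * hwb (wc p))
    + 2 * Lb Y lam p * (c\<^sup>2 * cnj d * hw (wc p)) + 2 * (c * (cnj d)\<^sup>2 * hb (wc p)) * L X lam p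
    - 2 * L X lam p / lam p * (lam p * ((cnj d)\<^sup>2 * c * hb (wc p)))
    - hw (wc p) / h (wc p) * c\<^sup>2 * (lam p * ((cnj d)\<^sup>2 * hb (wc p)) + 2 * (cnj d * h (wc p) * Lb Y lam p))"
    by (simp add: lam_real[OF p] hb_eq[OF p] Lb_lam[OF p, of Y] hc)
  \<comment> \<open>All terms with a derivative of \<open>lam\<close> cancel; \<open>lam\<close>
    remains only as a factor.\<close>
  also have "\<dots> = lam p * (- 2 * (c * cnj d * h (wc p))\<^sup>2 + c\<^sup>2 * (cnj d)\<^sup>2 * hwb (wc p))
    - hw (wc p) / h (wc p) * c\<^sup>2 * (lam p * ((cnj d)\<^sup>2 * hb (wc p)))"
  proof -
    have "hw (wc p) / h (wc p) * c\<^sup>2 * (A + 2 * (cnj d * h (wc p) * B)) =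
        hw (wc p) / h (wc p) * c\<^sup>2 * A + 2 * B * (c\<^sup>2 * cnj d * hw (wc p))" for A B
      using h0 by (simp add: distrib_left)
    then show ?thesis using lam0 by simp
  qed
  also have "\<dots> = lam p * (hwb (wc p) - hw (wc p) * hb (wc p) / h (wc p) - 2 * (h (wc p))\<^sup>2) * c\<^sup>2 * (cnj d)\<^sup>2"
    by (simp add: algebra_simps power2_eq_square)
  finally show ?thesis by (simp add: XY)
qed

lemma second_fundamental_form_zero:
  shows "herm H (fst X) (yc p) = 0 \<Longrightarrow> II X = 0"
    and "h (wc p) * hwb (wc p) - hw (wc p) * hb (wc p) = 2 * h (wc p) ^ 3"
proof -
  define hr where "hr = Re (h (wc p))"
  have hr: "h (wc p) = of_real hr" "hr > 0" using h_real[OF p] by (auto simp: hr_def)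
  define lr where "lr = Re (lam p)"
  have lr: "lam p = of_real lr" "lr > 0" using lam_eq[OF p] lam0 by (auto simp: lr_def complex_eq_iff less_le)
  define kr where "kr = Re (h (wc p) * hwb (wc p) - hw (wc p) * hb (wc p))"
  have kr: "h (wc p) * hwb (wc p) - hw (wc p) * hb (wc p) = of_real kr"
  proof -
    have "cnj (h (wc p) * hwb (wc p) - hw (wc p) * hb (wc p)) = h (wc p) * hwb (wc p) - hw (wc p) * hb (wc p)"
      using hwb_real[OF p] hb_eq[OF p] hr by simp
    moreover have "cnj z = z \<Longrightarrow> z = of_real (Re z)" for z by (simp add: complex_eq_iff)
    ultimately show ?thesis unfolding kr_def by blast
  qed
  have krle: "kr \<le> 2 * hr ^ 3" using curvature_le[OF p] by (simp add: kr_def hr_def)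
  \<comment> \<open>\<open>s\<^sup>2\<close> is \<open>lam\<close> times the square of
    \<open>h\<close> times \<open>K + 2\<close>, the negative of the coefficient in
    \<open>II_II\<close>. The bound K >= -2 makes the radicand nonnegative.\<close>
  define s where "s = sqrt (lr * (2 * hr ^ 3 - kr) / hr)"
  have s2: "complex_of_real (s * s) = - lam p * (hwb (wc p) - hw (wc p) * hb (wc p) / h (wc p) - 2 * (h (wc p))\<^sup>2)"
  proof -
    have "lr * (2 * hr ^ 3 - kr) / hr \<ge> 0" using lr hr krle by simp
    then have "s * s = lr * (2 * hr ^ 3 - kr) / hr" by (simp only: s_def real_sqrt_mult_self abs_of_nonneg)
    then have "complex_of_real (s * s) = lam p * (2 * h (wc p) ^ 3 - (h (wc p) * hwb (wc p) - hw (wc p) * hb (wc p))) / h (wc p)"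
      unfolding kr by (simp add: hr lr)
    then show ?thesis using h0 by (simp add: field_simps power2_eq_square power3_eq_cube)
  qed
  define S where "S = {X :: (complex ^ 'n) \<times> complex. herm H (fst X) (yc p) = 0}"
  let ?J = "\<lambda>X. emb (L X f p) 0" and ?phi = "\<lambda>X. emb (II X) (of_real s * (snd X)\<^sup>2)" and ?F = "emb (f p) 0"
  have subS: "subspace S"
    unfolding subspace_def S_def by (simp add: herm_add_left herm_scaleR_left)
  have gJ: "g X Y p = 0" if "hip (?J X) (?J Y) = 0" for X Y
    using that gram[OF p, of X Y] lam0 by (simp add: hip_emb)
  \<comment> \<open>With the \<open>G\<close> term the map is injective on \<open>C^n x C\<close>,
    of real dimension \<open>2 * CARD('n) + 2\<close>; the complex line of \<open>G\<close> accounts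
    for two of these dimensions.\<close>
  have dimJ: "2 * CARD('n) \<le> dim (?J ` S)"
  proof -
    let ?K = "\<lambda>X. ?J X + herm H (fst X) (yc p) *\<^sub>C emb (G p) 0"
    have lin: "linear ?K"
      by (rule linearI) (simp_all add: L_linear[OF p sm_f] L_scaleR[OF p sm_f] herm_add_left herm_scaleR_left
        emb_add emb_scaleC emb_scaleR scaleC_simps scaleC_scaleR_left scaleR_add_right algebra_simps)
    have inj: "inj ?K"
      unfolding linear_injective_0[OF lin]
    proof (intro allI impI)
      fix X assume z: "?K X = 0"
      obtain a c where X: "X = (a, c)" by fastforce
      have z': "L X f p + herm H a (yc p) *\<^sub>C G p = 0"
        using z by (simp add: emb_scaleC emb_add emb_eq_0_iff X)
      show "X = 0" using tangent_injective[OF p lam0 z'[unfolded X]] by (simp add: X zero_prod_def)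
    qed
    have "dim (range ?K) = DIM((complex ^ 'n) \<times> complex)"
      using dim_image_eq[OF lin, of UNIV] inj by simp
    moreover have "range ?K \<subseteq> span (insert (emb (G p) 0) (insert (\<i> *\<^sub>C emb (G p) 0) (?J ` S)))" (is "_ \<subseteq> span ?B")
    proof clarify
      fix a c
      have "?J (a, c) = ?J (a - al a p *\<^sub>C yc p, c)" by (simp add: L_tangential[OF p])
      also have "\<dots> \<in> ?J ` S" using split_radial(2)[OF p, of a] by (auto simp: S_def)
      finally have 1: "?J (a, c) \<in> span ?B" by (intro span_base) auto
      have "herm H a (yc p) *\<^sub>C emb (G p) 0 = Re (herm H a (yc p)) *\<^sub>R emb (G p) 0
          + Im (herm H a (yc p)) *\<^sub>R (\<i> *\<^sub>C emb (G p) 0)"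
        using linear_complex_expand[OF bounded_linear.linear[OF bounded_bilinear.bounded_linear_left[OF
              bounded_bilinear_scaleC, of "emb (G p) 0"]], of "herm H a (yc p)"]
        by (simp add: scaleC_of_real)
      also have "\<dots> \<in> span ?B" by (intro span_add span_scale span_base) auto
      finally show "?K (a, c) \<in> span ?B" using 1 by (auto intro: span_add)
    qed
    then have "dim (range ?K) \<le> dim ?B" using dim_mono by blast
    moreover have "dim ?B \<le> dim (?J ` S) + 2"
      by (simp add: dim_insert)
    ultimately show ?thesis by simp
  qed
  have "?phi X = 0" if X: "X \<in> S" for X
  proof (rule orthogonal_quadratic_zero[where S=S and J="?J" and F="?F" and n="CARD('n)" and X=X])
    show "subspace S" by (rule subS)
    show "?J (X + s *\<^sub>R Y) = ?J X + s *\<^sub>R ?J Y" for X Y s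
      by (simp add: L_linear[OF p sm_f] L_scaleR[OF p sm_f] emb_add emb_scaleR)
    show "\<exists>Y\<in>S. ?J Y = \<i> *\<^sub>C ?J X" if "X \<in> S" for X
    proof (rule bexI)
      show "?J (\<i> *\<^sub>C X) = \<i> *\<^sub>C ?J X" by (simp add: L_linear[OF p sm_f] emb_scaleC)
      show "\<i> *\<^sub>C X \<in> S" using that by (simp add: S_def scaleC_prod_def herm_simps)
    qed
    show "\<exists>B. \<forall>t. ?phi (X + t *\<^sub>R Y) = ?phi X + t *\<^sub>R B + t\<^sup>2 *\<^sub>R ?phi Y" for X Y
    proof (intro exI allI)
      fix t :: real
      have c2: "(snd (X + t *\<^sub>R Y))\<^sup>2 = (snd X)\<^sup>2 + t *\<^sub>R (2 * snd X * snd Y) + t\<^sup>2 *\<^sub>R (snd Y)\<^sup>2"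
        by (simp add: power2_eq_square algebra_simps scaleR_conv_of_real)
      have l2: "(2 * L (X + t *\<^sub>R Y) lam p / lam p) *\<^sub>C L (X + t *\<^sub>R Y) f p =
          (2 * L X lam p / lam p) *\<^sub>C L X f p
        + t *\<^sub>R ((2 * L X lam p / lam p) *\<^sub>C L Y f p + (2 * L Y lam p / lam p) *\<^sub>C L X f p)
        + t\<^sup>2 *\<^sub>R ((2 * L Y lam p / lam p) *\<^sub>C L Y f p)"
        unfolding L_linear(1)[OF p sm_f] L_linear(1)[OF p sm_lam] L_scaleR[OF p sm_f] L_scaleR[OF p sm_lam]
        unfolding scaleC_of_real[symmetric]
        by (simp add: scaleC_simps power2_eq_square add_divide_distrib algebra_simps)
      have q2: "L (X + t *\<^sub>R Y) (L (X + t *\<^sub>R Y) f) p = L X (L X f) p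
        + t *\<^sub>R (L X (L Y f) p + L Y (L X f) p) + t\<^sup>2 *\<^sub>R L Y (L Y f) p"
        by (simp add: LL_linear_left[OF sm_f p] LL_linear_right[OF sm_f p] LL_scaleR[OF sm_f p]
            power2_eq_square algebra_simps)
      show "?phi (X + t *\<^sub>R Y) = ?phi X + t *\<^sub>R emb (L X (L Y f) p + L Y (L X f) p
          - ((2 * L X lam p / lam p) *\<^sub>C L Y f p + (2 * L Y lam p / lam p) *\<^sub>C L X f p)
          - (hw (wc p) / h (wc p) * (2 * snd X * snd Y)) *\<^sub>C L dw f p) (of_real s * (2 * snd X * snd Y))
          + t\<^sup>2 *\<^sub>R ?phi Y"
        unfolding II_def q2 l2 c2 emb_scaleR emb_add
        by (rule arg_cong2[of _ _ _ _ emb])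
          (simp_all add: algebra_simps scaleC_simps scaleR_diff_right scaleR_add_right
            scaleC_scaleR_left scaleR_conv_of_real[where 'a=complex] flip: scaleC_of_real)
    qed
    show "hip (?phi X) (?phi Y) = 0" if "X \<in> S" "Y \<in> S" "hip (?J X) (?J Y) = 0" for X Y
    proof -
      have "hip (?phi X) (?phi Y) = hip (II X) (II Y) + of_real (s * s) * (snd X)\<^sup>2 * (cnj (snd Y))\<^sup>2"
        by (simp add: hip_emb)
      then show ?thesis using that II_II[OF _ _ gJ[OF that(3)]] unfolding s2 by (simp add: S_def)
    qed
    show "hip (?phi X) (?J Y) = 0" if "X \<in> S" for X Y
      using that II_Lf[of X Y] by (simp add: hip_emb S_def)
    show "hip (?phi X) ?F = 0" for X by (simp add: hip_emb II_f)
    show "hip (?J X) ?F = 0" for X by (simp add: hip_emb Lf_f[OF p])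
    show "?F \<noteq> 0" using f_f[OF p] by (auto simp: emb_eq_0_iff)
    show "2 * CARD('n) \<le> dim (?J ` S)" by (rule dimJ)
    show "CARD('m option) \<le> 2 * CARD('n)" using dims by simp
    show "X \<in> S" by (rule X)
  qed
  then have all: "II X = 0 \<and> of_real s * (snd X)\<^sup>2 = 0" if "herm H (fst X) (yc p) = 0" for X
    using that by (simp add: S_def emb_eq_0_iff)
  show "herm H (fst X) (yc p) = 0 \<Longrightarrow> II X = 0" using all by blast
  \<comment> \<open>The added coordinate of the form at \<open>dw\<close> is \<open>s\<close>
    itself, so its vanishing is the equality K = -2 at \<open>p\<close>.\<close>
  have "s = 0" using all[of dw] by simp
  then have "hwb (wc p) - hw (wc p) * hb (wc p) / h (wc p) - 2 * (h (wc p))\<^sup>2 = 0"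
    using s2 lam0 by simp
  then show "h (wc p) * hwb (wc p) - hw (wc p) * hb (wc p) = 2 * h (wc p) ^ 3"
    using h0 by (simp add: field_simps power2_eq_square power3_eq_cube)
qed

end

end

section \<open>The structure equations of a transversal map\<close>

locale transversal_map = revolution_map H \<psi> W U f
  for H :: "complex ^ 'n ^ 'n" and \<psi> :: "complex \<Rightarrow> real" and W U
    and f :: "((complex ^ 'n) \<times> complex) \<times> real \<Rightarrow> complex ^ 'm" +
  assumes lam_nz: "\<And>p. p \<in> W \<Longrightarrow> lam p \<noteq> 0"
begin

abbreviation hp where "hp \<equiv> \<lambda>p. h (wc p)"

text \<open>\<open>rho\<close> is minus the logarithmic derivative of \<open>lam\<close>, and
  \<open>tau\<close> is the one further quantity needed to close the system: all first derivatives
  of \<open>L X f\<close>, \<open>G\<close>, \<open>rho\<close> and \<open>tau\<close> are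
  expressions in these four and the geometry of the hypersurface.\<close>

definition rho where "rho X p = - L X lam p / lam p"

definition tau where "tau p = Lb dw (rho dw) p / hp p"

lemma hp_nz: "p \<in> W \<Longrightarrow> hp p \<noteq> 0"
  by (rule h0[OF _ lam_nz])

lemma hp_cnj: "p \<in> W \<Longrightarrow> cnj (hp p) = hp p"
  by (subst (1 2) h_real(1)) simp_all

lemma sm_hp: "sm hp" "sm (\<lambda>p. hw (wc p))" by (rule sm_wc smooth_h)+

lemma sm_rho: "sm (rho X)"
  unfolding rho_def[abs_def] by (rule sm_divide[OF sm_minus[OF sm_L[OF sm_lam]] sm_lam lam_nz])

lemma sm_tau: "sm tau"
  unfolding tau_def[abs_def] by (rule sm_divide[OF sm_Lb[OF sm_rho] sm_hp(1) hp_nz])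

lemmas sm_str = sm_intros' sm_rho sm_tau sm_hp

lemma L_lam: "p \<in> W \<Longrightarrow> L X lam p = - lam p * rho X p"
  using lam_nz by (simp add: rho_def)

lemma Lb_lam_rho: "p \<in> W \<Longrightarrow> Lb X lam p = - lam p * cnj (rho X p)"
  by (simp add: Lb_lam L_lam lam_real)

lemma hp_derivs: assumes p: "p \<in> W"
  shows "L dw hp p = hw (wc p)" "L (dy a) hp p = 0" "Lb (dy a) hp p = 0" "Lb dw hp p = hb (wc p)" "dT hp p = 0"
  using wc_derivs[OF p smooth_h(2)] by (simp_all add: hw_def hb_def)

text \<open>Liouville's equation for curvature -2. This is how K = -2 enters the structure
  equations.\<close>

lemma curvature_deriv: assumes p: "p \<in> W"
  shows "Lb dw (\<lambda>p. hw (wc p) / hp p) p = 2 * hp p"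
proof -
  have "Lb dw (\<lambda>p. hw (wc p)) p = hwb (wc p)"
    using wc_derivs(2)[OF p smooth_h(3), of 0 1] by (simp add: hwb_def)
  then have "Lb dw (\<lambda>p. hw (wc p) / hp p) p = (hwb (wc p) - hw (wc p) / hp p * hb (wc p)) / hp p"
    using L_div(2)[OF p sm_hp(2,1) hp_nz] by (simp add: hp_derivs[OF p])
  also have "\<dots> = (hp p * hwb (wc p) - hw (wc p) * hb (wc p)) / (hp p * hp p)"
    using hp_nz[OF p] by (simp add: field_simps)
  also have "\<dots> = 2 * hp p"
    unfolding second_fundamental_form_zero(2)[OF p lam_nz[OF p]] using hp_nz[OF p]
    by (simp add: power3_eq_cube)
  finally show ?thesis .
qed

lemma g_vals: assumes p: "p \<in> W"
  shows "g dw dw p = hp p" "g (dy a) dw p = 0" "g dw (dy b) p = 0"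
  using g_eq[OF p, of 0 1 0 1] g_eq[OF p, of a 0 0 1] g_eq[OF p, of 0 1 b 0] by simp_all

lemma L_g_dw: assumes p: "p \<in> W" shows "L X (g dw dw) p = L X hp p"
  by (rule L_cong[OF p g_vals(1)])

text \<open>Polarization of \<open>II X = 0\<close>, possible because \<open>L_L\<close> makes the
  underlying bilinear form symmetric.\<close>

lemma LLf_polar: assumes p: "p \<in> W" and "herm H a (yc p) = 0" "herm H b (yc p) = 0"
  shows "L (a, c) (L (b, d) f) p = - (rho (a, c) p) *\<^sub>C L (b, d) f p - rho (b, d) p *\<^sub>C L (a, c) f p
    + (hw (wc p) / hp p * (c * d)) *\<^sub>C L dw f p"
proof -
  have q: "L X (L X f) p = (- 2 * rho X p) *\<^sub>C L X f p + (hw (wc p) / hp p * (snd X)\<^sup>2) *\<^sub>C L dw f p"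
    if "herm H (fst X) (yc p) = 0" for X
    using second_fundamental_form_zero(1)[OF p lam_nz[OF p] that]
    unfolding II_def[OF p lam_nz[OF p]] by (simp add: rho_def algebra_simps scaleC_simps)
  let ?X = "(a, c)" and ?Y = "(b, d)"
  have r: "rho (?X + ?Y) p = rho ?X p + rho ?Y p"
    unfolding rho_def L_linear[OF p sm_lam] by (simp add: add_divide_distrib diff_divide_distrib)
  have s: "(snd (?X + ?Y))\<^sup>2 = c\<^sup>2 + d\<^sup>2 + 2 * (c * d)" by (simp add: power2_eq_square algebra_simps)
  have "herm H (fst (?X + ?Y)) (yc p) = 0" using assms by (simp add: herm_simps)
  note q[OF this, unfolded r s L_linear[OF p sm_f] LL_linear_left[OF sm_f p] LL_linear_right[OF sm_f p]]
  moreover have "L ?Y (L ?X f) p = L ?X (L ?Y f) p" by (rule L_L[OF sm_f p])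
  ultimately have "2 *\<^sub>C L ?X (L ?Y f) p = 2 *\<^sub>C (- (rho ?X p) *\<^sub>C L ?Y f p - rho ?Y p *\<^sub>C L ?X f p
    + (hw (wc p) / hp p * (c * d)) *\<^sub>C L dw f p)"
    using q[of ?X] q[of ?Y] assms
    by (simp add: scaleC_simps algebra_simps)
       (simp add: scaleC_simps algebra_simps scaleC_add_left[of 1 1, simplified])
  then have "(1/2) *\<^sub>C (2 *\<^sub>C L ?X (L ?Y f) p) = (1/2) *\<^sub>C (2 *\<^sub>C (- (rho ?X p) *\<^sub>C L ?Y f p - rho ?Y p *\<^sub>C L ?X f p
    + (hw (wc p) / hp p * (c * d)) *\<^sub>C L dw f p))" by (rule arg_cong)
  then show ?thesis by (simp only: scaleC_scaleC) simp
qed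

lemma rho_tangential: assumes p: "p \<in> W"
  shows "rho (a - al a p *\<^sub>C yc p, c) p = rho (a, c) p"
  by (simp add: rho_def L_tangential[OF p])

lemma dy_split: "dy a = (a - al a p *\<^sub>C yc p, 0) + al a p *\<^sub>C dy (yc p)"
  by (simp add: scaleC_prod_def)

lemma Fww: assumes p: "p \<in> W"
  shows "L dw (L dw f) p = (- 2 * rho dw p + hw (wc p) / hp p) *\<^sub>C L dw f p"
proof -
  have *: "(- 2 * r + k) *\<^sub>C F = - r *\<^sub>C F - r *\<^sub>C F + k *\<^sub>C F" for r k and F :: "complex ^ 'm"
  proof -
    have "- 2 * r + k = - r - r + k" by simp
    then show ?thesis by (simp only: scaleC_simps)
  qed
  show ?thesis unfolding * using LLf_polar[OF p, of 0 0 1 1] by simp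
qed

text \<open>The radial part of \<open>a\<close> is split off; by \<open>L_radial\<close> it
  contributes nothing, because \<open>dw\<close> has no \<open>y\<close> component.\<close>

lemma Faw: assumes p: "p \<in> W"
  shows "L (dy a) (L dw f) p = - (rho (dy a) p) *\<^sub>C L dw f p - rho dw p *\<^sub>C L (dy a) f p"
proof -
  have "L (dy (yc p)) (L dw f) p = 0"
    using L_L[OF sm_f p, of "dy (yc p)" dw] L_radial(1)[OF p, of 0 1] L_linear(2)[OF p sm_f, of 0 0]
    by (simp flip: zero_prod_def)
  then have "L (dy a) (L dw f) p = L (a - al a p *\<^sub>C yc p, 0) (L dw f) p"
    by (subst dy_split[of a p]) (simp only: LL_linear_left[OF sm_f p], simp)
  also have "\<dots> = - (rho (dy a) p) *\<^sub>C L dw f p - rho dw p *\<^sub>C L (dy a) f p"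
    by (subst LLf_polar[OF p split_radial(2)[OF p]]) (simp_all add: rho_tangential[OF p] L_tangential[OF p])
  finally show ?thesis .
qed

text \<open>The terms with \<open>al\<close> come from the radial parts of \<open>a\<close> and
  \<open>b\<close> by \<open>L_radial\<close>.\<close>

lemma Fab: assumes p: "p \<in> W"
  shows "L (dy a) (L (dy b) f) p = - (rho (dy a) p) *\<^sub>C L (dy b) f p - rho (dy b) p *\<^sub>C L (dy a) f p
    - al a p *\<^sub>C L (dy b) f p - al b p *\<^sub>C L (dy a) f p"
proof -
  let ?a = "a - al a p *\<^sub>C yc p" and ?b = "b - al b p *\<^sub>C yc p"
  have yr: "L X (L (dy (yc p)) f) p = - L (dy (fst X)) f p" for X
    using L_radial(1)[OF p, of "fst X" "snd X"] by simp
  have yl: "L (dy (yc p)) (L X f) p = - L (dy (fst X)) f p" for X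
    using L_L[OF sm_f p, of "dy (yc p)" X] yr[of X] by simp
  have "L (dy a) (L (dy b) f) p = L ((?a, 0) + al a p *\<^sub>C dy (yc p)) (L ((?b, 0) + al b p *\<^sub>C dy (yc p)) f) p"
    by (simp only: dy_split[symmetric])
  also have "\<dots> = L (?a, 0) (L (?b, 0) f) p - al b p *\<^sub>C L (dy a) f p - al a p *\<^sub>C L (dy b) f p"
    unfolding LL_linear_left[OF sm_f p] LL_linear_right[OF sm_f p] yr yl
    using hom[OF p] by (simp add: scaleC_simps L_tangential[OF p] scaleC_prod_def)
  also have "L (?a, 0) (L (?b, 0) f) p = - (rho (dy a) p) *\<^sub>C L (dy b) f p - rho (dy b) p *\<^sub>C L (dy a) f p"
    by (subst LLf_polar[OF p split_radial(2)[OF p] split_radial(2)[OF p]])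
      (simp add: rho_tangential[OF p] L_tangential[OF p])
  finally show ?thesis by simp
qed

section \<open>Derivatives of \<open>G\<close>, \<open>rho\<close> and \<open>tau\<close>\<close>

lemma tau_eq: "p \<in> W \<Longrightarrow> Lb dw (rho dw) p = hp p * tau p"
  using hp_nz by (simp add: tau_def)

text \<open>\<open>Lb dw\<close> is applied to \<open>Fww\<close>. By \<open>Lb_LLf\<close> the left
  side contains \<open>L dw G\<close> twice, and \<open>curvature_deriv\<close> supplies the summand
  1 in \<open>1 - tau p\<close>.\<close>

lemma Gw: assumes p: "p \<in> W"
  shows "L dw G p = - (rho dw p) *\<^sub>C G p + (1 - tau p) *\<^sub>C L dw f p"
proof -
  have sk: "sm (\<lambda>p. hw (wc p) / hp p)" by (rule sm_divide[OF sm_hp(2,1) hp_nz])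
  have "Lb dw (L dw (L dw f)) p = Lb dw (\<lambda>p. (- 2 * rho dw p + hw (wc p) / hp p) *\<^sub>C L dw f p) p"
    by (rule Lb_cong[OF p Fww])
  also have "\<dots> = (- 2 * rho dw p + hw (wc p) / hp p) *\<^sub>C (hp p *\<^sub>C G p)
      + (- 2 * (hp p * tau p) + 2 * hp p) *\<^sub>C L dw f p"
    by (simp add: Lb_scaleC[OF p] Lb_add[OF p] Lb_diff[OF p] Lb_mult[OF p] sm_str sk Lb_Lf[OF p] g_vals[OF p] tau_eq[OF p]
        curvature_deriv[OF p])
  also have "Lb dw (L dw (L dw f)) p = hw (wc p) *\<^sub>C G p + (2 * hp p) *\<^sub>C L dw G p"
    unfolding Lb_LLf[OF p] L_g_dw[OF p] hp_derivs[OF p] g_vals[OF p]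
    by (simp only: mult_2 scaleC_add_left add.assoc)
  finally have "(2 * hp p) *\<^sub>C L dw G p = (2 * hp p) *\<^sub>C (- (rho dw p) *\<^sub>C G p + (1 - tau p) *\<^sub>C L dw f p)"
    using hp_nz[OF p] by (simp add: scaleC_simps algebra_simps)
  then have "(1 / (2 * hp p)) *\<^sub>C ((2 * hp p) *\<^sub>C L dw G p) = (1 / (2 * hp p)) *\<^sub>C ((2 * hp p) *\<^sub>C (- (rho dw p) *\<^sub>C G p + (1 - tau p) *\<^sub>C L dw f p))"
    by (rule arg_cong)
  then show ?thesis using hp_nz[OF p] by (simp only: scaleC_scaleC) simp
qed

text \<open>A second evaluation of \<open>L X G\<close> against tangent vectors, independent of
  \<open>Gw\<close> and \<open>Ga_pre\<close>; comparing the two determines the (0,1) derivatives of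
  \<open>rho\<close>.\<close>

lemma LG_Lf: assumes p: "p \<in> W"
  shows "hip (L X G p) (L Z f p) = - lam p * cnj (rho Z p) * rho X p + lam p * Lb Z (rho X) p
    - g X Z p * hip (\<i> *\<^sub>C dT G p) (f p)"
proof -
  have "Lb Z (\<lambda>x. hip (L X G x) (f x)) p = Lb Z (\<lambda>x. lam x * rho X x) p"
    by (rule Lb_cong[OF p]) (simp add: LG_f L_lam)
  then show ?thesis
    by (simp add: Lb_hip[OF p] Lb_mult[OF p] sm_str Lb_lam_rho[OF p] Lb_LG[OF p] hip_simps algebra_simps)
qed

text \<open>\<open>Lb dw\<close> applied to \<open>Faw\<close>. The last coefficient is still open
  here; \<open>Lb_rho\<close> shows that it vanishes.\<close>

lemma Ga_pre: assumes p: "p \<in> W"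
  shows "L (dy a) G p = - (rho (dy a) p) *\<^sub>C G p - tau p *\<^sub>C L (dy a) f p - (Lb dw (rho (dy a)) p / hp p) *\<^sub>C L dw f p"
proof -
  have "Lb dw (L (dy a) (L dw f)) p = Lb dw (\<lambda>p. - (rho (dy a) p) *\<^sub>C L dw f p - rho dw p *\<^sub>C L (dy a) f p) p"
    by (rule Lb_cong[OF p Faw])
  also have "\<dots> = - (rho (dy a) p) *\<^sub>C (hp p *\<^sub>C G p) - Lb dw (rho (dy a)) p *\<^sub>C L dw f p
      - (hp p * tau p) *\<^sub>C L (dy a) f p"
    by (simp add: Lb_scaleC[OF p] Lb_diff[OF p] Lb_minus[OF p] sm_str Lb_Lf[OF p] g_vals[OF p] tau_eq[OF p] scaleC_simps)
  also have "Lb dw (L (dy a) (L dw f)) p = hp p *\<^sub>C L (dy a) G p"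
    unfolding Lb_LLf[OF p] L_g_dw[OF p] hp_derivs[OF p] g_vals[OF p] by simp
  finally have "(1 / hp p) *\<^sub>C (hp p *\<^sub>C L (dy a) G p) = (1 / hp p) *\<^sub>C (- (rho (dy a) p) *\<^sub>C (hp p *\<^sub>C G p) - Lb dw (rho (dy a)) p *\<^sub>C L dw f p
      - (hp p * tau p) *\<^sub>C L (dy a) f p)" by (rule arg_cong)
  then show ?thesis using hp_nz[OF p] by (simp add: scaleC_simps algebra_simps)
qed

lemma gram_vals: assumes p: "p \<in> W"
  shows "hip (L dw f p) (L dw f p) = lam p * hp p" "hip (L (dy a) f p) (L dw f p) = 0" "hip (L dw f p) (L (dy b) f p) = 0"
  by (simp_all add: gram[OF p] g_vals[OF p])

text \<open>The two evaluations of \<open>hip (L (dy a) G p) (L dw f p)\<close> contain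
  \<open>Lb dw (rho (dy a)) p\<close> with opposite signs, so it is zero. The remaining values come
  from the other choices of directions.\<close>

lemma Lb_rho: assumes p: "p \<in> W"
  shows "Lb dw (rho (dy a)) p = 0" "Lb (dy b) (rho dw) p = 0"
    and "hip (\<i> *\<^sub>C dT G p) (f p) = lam p * (2 * tau p - 1)"
    and "Lb (dy b) (rho (dy a)) p = g (dy a) (dy b) p * (tau p - 1)"
proof -
  have "hip (L (dy a) G p) (L dw f p) = - lam p * cnj (rho dw p) * rho (dy a) p - lam p * Lb dw (rho (dy a)) p" for a
    unfolding Ga_pre[OF p] using hp_nz[OF p]
    by (simp add: hip_simps gram_vals[OF p] G_Lf[OF p] Lb_lam_rho[OF p])
  then show 1: "Lb dw (rho (dy a)) p = 0" for a
    using LG_Lf[OF p, of "dy a" dw] lam_nz[OF p] by (simp add: g_vals[OF p] eq_neg_iff_add_eq_0)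
  have "hip (L dw G p) (L (dy b) f p) = - lam p * cnj (rho (dy b) p) * rho dw p"
    unfolding Gw[OF p]
    by (simp add: hip_simps gram_vals[OF p] G_Lf[OF p] Lb_lam_rho[OF p])
  then show "Lb (dy b) (rho dw) p = 0"
    using LG_Lf[OF p, of dw "dy b"] lam_nz[OF p] by (simp add: g_vals[OF p])
  have "hip (L dw G p) (L dw f p) = - lam p * cnj (rho dw p) * rho dw p + (1 - tau p) * lam p * hp p"
    unfolding Gw[OF p]
    by (simp add: hip_simps gram_vals[OF p] G_Lf[OF p] Lb_lam_rho[OF p])
  then have "hp p * hip (\<i> *\<^sub>C dT G p) (f p) = hp p * (lam p * (2 * tau p - 1))"
    using LG_Lf[OF p, of dw dw] by (simp add: g_vals[OF p] tau_eq[OF p] algebra_simps)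
  then show 2: "hip (\<i> *\<^sub>C dT G p) (f p) = lam p * (2 * tau p - 1)" using hp_nz[OF p] by simp
  have "hip (L (dy a) G p) (L (dy b) f p) = - lam p * cnj (rho (dy b) p) * rho (dy a) p - tau p * (lam p * g (dy a) (dy b) p)"
    unfolding Ga_pre[OF p] 1
    by (simp add: hip_simps gram[OF p] G_Lf[OF p] Lb_lam_rho[OF p])
  then have "lam p * Lb (dy b) (rho (dy a)) p = lam p * (g (dy a) (dy b) p * (tau p - 1))"
    using LG_Lf[OF p, of "dy a" "dy b"] unfolding 2 by (simp add: algebra_simps)
  then show "Lb (dy b) (rho (dy a)) p = g (dy a) (dy b) p * (tau p - 1)" using lam_nz[OF p] by simp
qed

lemma Ga: assumes p: "p \<in> W"
  shows "L (dy a) G p = - (rho (dy a) p) *\<^sub>C G p - tau p *\<^sub>C L (dy a) f p"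
  using Ga_pre[OF p, of a] Lb_rho(1)[OF p] by simp

text \<open>With \<open>n\<close> at least 2, cross-multiplying two axis vectors by their products
  with \<open>yc p\<close> gives a vector orthogonal to \<open>yc p\<close>. If it is zero, one of
  the axis vectors is itself orthogonal.\<close>

lemma tangential_exists: assumes "p \<in> W" obtains a where "a \<noteq> 0" "herm H a (yc p) = 0"
proof -
  obtain i j :: 'n where ij: "i \<noteq> j"
    using dim2 card_le_Suc0_iff_eq[of "UNIV :: 'n set"] by force
  define a :: "complex ^ 'n" where "a = herm H (axis j 1) (yc p) *\<^sub>C axis i 1 - herm H (axis i 1) (yc p) *\<^sub>C axis j 1"
  have ai: "axis i (1::complex) \<noteq> (0 :: complex ^ 'n)" by (auto simp: vec_eq_iff axis_def)
  show thesis
  proof (cases "a = 0")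
    case True
    have "a $ j = - herm H (axis i 1) (yc p)" using ij by (simp add: a_def axis_def)
    then have "herm H (axis i 1) (yc p) = 0" using True by simp
    then show thesis using ai that by blast
  next
    case False
    moreover have "herm H a (yc p) = 0" by (simp add: a_def herm_simps)
    ultimately show thesis using that by blast
  qed
qed

lemma Lb_dw_g: assumes p: "p \<in> W" shows "Lb dw (g (dy a) (dy b)) p = 0"
proof -
  have "Lb dw (g (dy a) (dy b)) p = Lb dw (\<lambda>p. herm H a b * iN p - herm H (yc p) b * (herm H a (yc p) * (iN p * iN p))) p"
    by (rule Lb_cong[OF p]) (simp add: g_eq power2_eq_square)
  also have "\<dots> = 0"
    by (simp add: Lb_diff[OF p] Lb_mult[OF p] sm_chart herm_derivs[OF p] iN_derivs[OF p])
  finally show ?thesis .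
qed

text \<open>Two commuting (0,1) fields are applied to \<open>rho\<close>. In the direction
  \<open>dw\<close> the equation contains \<open>tau\<close> multiplied by
  \<open>g (dy a) (dy a) p\<close>, so a nonzero \<open>a\<close> orthogonal to \<open>yc p\<close>
  is needed to isolate it.\<close>

lemma Lb_tau: assumes p: "p \<in> W" shows "Lb X tau p = 0"
proof -
  obtain a where a: "a \<noteq> 0" "herm H a (yc p) = 0" by (rule tangential_exists[OF p])
  have ga: "g (dy a) (dy a) p \<noteq> 0"
    using g_eq[OF p, of a 0 a 0] a herm_self_eq_0[OF posH] N_neq_0[OF p] by (simp add: iN_def)
  have "Lb dw (Lb (dy a) (rho (dy a))) p = Lb dw (\<lambda>p. g (dy a) (dy a) p * (tau p - 1)) p"
    by (rule Lb_cong[OF p Lb_rho(4)])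
  also have "\<dots> = g (dy a) (dy a) p * Lb dw tau p"
    by (simp add: Lb_mult[OF p] Lb_diff[OF p] sm_str Lb_dw_g[OF p])
  also have "Lb dw (Lb (dy a) (rho (dy a))) p = Lb (dy a) (\<lambda>p. 0) p"
    unfolding Lb_Lb[OF sm_rho p, of dw] by (rule Lb_cong[OF p Lb_rho(1)])
  finally have w: "Lb dw tau p = 0" using ga by simp
  have "Lb (dy b) (Lb dw (rho dw)) p = Lb (dy b) (\<lambda>p. hp p * tau p) p" for b
    by (rule Lb_cong[OF p tau_eq])
  moreover have "Lb (dy b) (Lb dw (rho dw)) p = Lb dw (\<lambda>p. 0) p" for b
    unfolding Lb_Lb[OF sm_rho p, of "dy b"] by (rule Lb_cong[OF p Lb_rho(2)])
  ultimately have "hp p * Lb (dy b) tau p = 0" for b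
    by (simp add: Lb_mult[OF p] sm_str hp_derivs[OF p])
  then have y: "Lb (dy b) tau p = 0" for b using hp_nz[OF p] by simp
  have "Lb X tau p = Lb (dy (fst X) + snd X *\<^sub>C dw) tau p"
    by (rule arg_cong[of _ _ "\<lambda>X. Lb X tau p"]) (simp add: prod_eq_iff scaleC_prod_def)
  then show ?thesis using w y by (simp add: L_linear[OF p sm_tau])
qed

text \<open>\<open>Lb dw\<close> kills \<open>G\<close>, so applying it to \<open>Gw\<close> leaves
  only a commutator on the left.\<close>

lemma TG: assumes p: "p \<in> W" shows "\<i> *\<^sub>C dT G p = (1 - 2 * tau p) *\<^sub>C G p"
proof -
  have "Lb dw (L dw G) p = Lb dw (\<lambda>p. - (rho dw p) *\<^sub>C G p + (1 - tau p) *\<^sub>C L dw f p) p"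
    by (rule Lb_cong[OF p Gw])
  also have "\<dots> = - (hp p * tau p) *\<^sub>C G p + (1 - tau p) *\<^sub>C (hp p *\<^sub>C G p)"
    by (simp add: Lb_scaleC[OF p] Lb_add[OF p] Lb_diff[OF p] Lb_minus[OF p] sm_str Lb_Lf[OF p] Lb_G[OF p]
       g_vals[OF p] tau_eq[OF p] Lb_tau[OF p])
  also have "\<dots> = (hp p * (1 - 2 * tau p)) *\<^sub>C G p"
    unfolding scaleC_scaleC scaleC_add_left[symmetric] by (simp add: algebra_simps)
  also have "Lb dw (L dw G) p = hp p *\<^sub>C (\<i> *\<^sub>C dT G p)" by (simp add: Lb_LG[OF p] g_vals[OF p])
  finally have "(1 / hp p) *\<^sub>C (hp p *\<^sub>C (\<i> *\<^sub>C dT G p)) = (1 / hp p) *\<^sub>C ((hp p * (1 - 2 * tau p)) *\<^sub>C G p)"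
    by (rule arg_cong)
  then show ?thesis using hp_nz[OF p] by (simp only: scaleC_scaleC) simp
qed

lemma LLG: assumes p: "p \<in> W" shows "L Y (L X G) p = \<i> *\<^sub>C dT (L Y (L X f)) p"
proof -
  have "L Y (L X G) p = L Y (\<lambda>p. \<i> *\<^sub>C dT (L X f) p) p" by (rule L_cong[OF p L_G])
  then show ?thesis by (simp add: L_scaleC[OF p] sm_str L_T[OF sm_L[OF sm_f] p])
qed

text \<open>The pairing contains a derivative of \<open>rho\<close>. The equations for
  \<open>L Y (L X f)\<close> therefore become first-order equations for \<open>rho\<close> in
  \<open>L_rho\<close>.\<close>

lemma LLlam: assumes p: "p \<in> W" shows "hip (\<i> *\<^sub>C dT (L Y (L X f)) p) (f p) = lam p * (L Y (rho X) p - rho X p * rho Y p)"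
proof -
  have "L Y (\<lambda>x. hip (L X G x) (f x)) p = L Y (\<lambda>x. lam x * rho X x) p"
    by (rule L_cong[OF p]) (simp add: LG_f L_lam)
  then show ?thesis
    by (simp add: L_hip[OF p] L_mult[OF p] sm_str L_lam[OF p] Lb_f[OF p] LLG[OF p] algebra_simps)
qed

lemma T_scaled_Lf: assumes p: "p \<in> W" and "sm c"
  shows "hip (dT (\<lambda>x. c x *\<^sub>C L X f x) p) (f p) = c p * hip (dT (L X f) p) (f p)"
  by (simp add: T_scaleC[OF p assms(2)] sm_str hip_simps Lf_f[OF p])

lemma T_Lf_f: assumes p: "p \<in> W" shows "\<i> * hip (dT (L X f) p) (f p) = lam p * rho X p"
  using LG_f[OF p, of X] L_lam[OF p, of X] L_G[OF p, of X] by (simp add: hip_simps)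

text \<open>\<open>dT\<close> of the structure equations is paired with \<open>f\<close>. Where
  \<open>dT\<close> falls on a coefficient the term vanishes, because \<open>L X f\<close> is
  orthogonal to \<open>f\<close>.\<close>

lemma L_rho: assumes p: "p \<in> W"
  shows "L dw (rho dw) p = - (rho dw p)\<^sup>2 + hw (wc p) / hp p * rho dw p"
    and "L (dy a) (rho dw) p = - rho (dy a) p * rho dw p"
    and "L dw (rho (dy a)) p = - rho (dy a) p * rho dw p"
    and "L (dy a) (rho (dy b)) p = - rho (dy a) p * rho (dy b) p - al a p * rho (dy b) p - al b p * rho (dy a) p"
proof -
  have sk: "sm (\<lambda>p. hw (wc p) / hp p)" by (rule sm_divide[OF sm_hp(2,1) hp_nz])
  have sal: "sm (al a)" for a unfolding al_def[abs_def] by (intro sm_mult sm_chart)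
  have t: "\<i> * hip (dT (L X f) p) (f p) = lam p * rho X p" for X by (rule T_Lf_f[OF p])
  have cancel: "x = y" if "lam p * x = lam p * y" for x y using that lam_nz[OF p] by simp
  have "dT (L dw (L dw f)) p = dT (\<lambda>p. (- 2 * rho dw p + hw (wc p) / hp p) *\<^sub>C L dw f p) p"
    by (rule T_cong[OF p Fww])
  then have "\<i> * hip (dT (L dw (L dw f)) p) (f p) = (- 2 * rho dw p + hw (wc p) / hp p) * (lam p * rho dw p)"
    using T_scaled_Lf[OF p, of "\<lambda>p. - 2 * rho dw p + hw (wc p) / hp p" dw] t[of dw] sk by (simp add: sm_str)
  then have "lam p * (L dw (rho dw) p - rho dw p * rho dw p) = (- 2 * rho dw p + hw (wc p) / hp p) * (lam p * rho dw p)"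
    using LLlam[OF p, of dw dw] by (auto simp: hip_simps)
  then show "L dw (rho dw) p = - (rho dw p)\<^sup>2 + hw (wc p) / hp p * rho dw p"
    by - (rule cancel, simp add: algebra_simps power2_eq_square)
  have "dT (L (dy a) (L dw f)) p = dT (\<lambda>p. - (rho (dy a) p) *\<^sub>C L dw f p - rho dw p *\<^sub>C L (dy a) f p) p" for a
    by (rule T_cong[OF p Faw])
  then have "\<i> * hip (dT (L (dy a) (L dw f)) p) (f p) = - 2 * lam p * rho (dy a) p * rho dw p" for a
    using T_scaled_Lf[OF p, of "\<lambda>p. - rho (dy a) p" dw] T_scaled_Lf[OF p, of "rho dw" "dy a"] t[of dw] t[of "dy a"]
    by (simp add: sm_str T_diff[OF p] hip_simps right_diff_distrib mult.left_commute[of \<i>])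
  then have *: "lam p * (L (dy a) (rho dw) p - rho dw p * rho (dy a) p) = - 2 * lam p * rho (dy a) p * rho dw p" for a
    using LLlam[OF p, of "dy a" dw] by (simp add: hip_simps)
  then show aw: "L (dy a) (rho dw) p = - rho (dy a) p * rho dw p" for a
    by - (rule cancel, simp add: algebra_simps)
  have "L dw (L (dy a) f) x = L (dy a) (L dw f) x" if "x \<in> W" for x by (rule L_L[OF sm_f that])
  then have "dT (L dw (L (dy a) f)) p = dT (L (dy a) (L dw f)) p" by (rule T_cong[OF p])
  then have "lam p * (L dw (rho (dy a)) p - rho (dy a) p * rho dw p) = - 2 * lam p * rho (dy a) p * rho dw p"
    using LLlam[OF p, of dw "dy a"] LLlam[OF p, of "dy a" dw] *[of a] by simp
  then show "L dw (rho (dy a)) p = - rho (dy a) p * rho dw p"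
    by - (rule cancel, simp add: algebra_simps)
  have "dT (L (dy a) (L (dy b) f)) p = dT (\<lambda>p. - (rho (dy a) p) *\<^sub>C L (dy b) f p - rho (dy b) p *\<^sub>C L (dy a) f p
    - al a p *\<^sub>C L (dy b) f p - al b p *\<^sub>C L (dy a) f p) p"
    by (rule T_cong[OF p Fab])
  then have "\<i> * hip (dT (L (dy a) (L (dy b) f)) p) (f p) =
      - 2 * lam p * rho (dy a) p * rho (dy b) p - al a p * (lam p * rho (dy b) p) - al b p * (lam p * rho (dy a) p)"
    using T_scaled_Lf[OF p, of "\<lambda>p. - rho (dy a) p" "dy b"] T_scaled_Lf[OF p, of "rho (dy b)" "dy a"]
      T_scaled_Lf[OF p sal, of a "dy b"] T_scaled_Lf[OF p sal, of b "dy a"] t[of "dy a"] t[of "dy b"]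
    by (simp add: sm_str sal T_diff[OF p] hip_simps right_diff_distrib mult.left_commute[of \<i>])
  then have "lam p * (L (dy a) (rho (dy b)) p - rho (dy b) p * rho (dy a) p) =
      - 2 * lam p * rho (dy a) p * rho (dy b) p - al a p * (lam p * rho (dy b) p) - al b p * (lam p * rho (dy a) p)"
    using LLlam[OF p, of "dy a" "dy b"] by (simp add: hip_simps)
  then show "L (dy a) (rho (dy b)) p = - rho (dy a) p * rho (dy b) p - al a p * rho (dy b) p - al b p * rho (dy a) p"
    by - (rule cancel, simp add: algebra_simps)
qed

text \<open>Both mixed second derivatives of \<open>lam\<close> along \<open>dw\<close> are known
  through \<open>rho\<close> and \<open>tau\<close>; their difference is the commutator
  term.\<close>

lemma T_lam: assumes p: "p \<in> W" shows "\<i> * dT lam p = lam p * (cnj (tau p) - tau p)"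
proof -
  have "Lb dw (L dw lam) p = Lb dw (\<lambda>p. - (lam p * rho dw p)) p"
    by (rule Lb_cong[OF p]) (simp add: L_lam)
  moreover have "L dw (Lb dw lam) p = L dw (\<lambda>p. - (lam p * cnj (rho dw p))) p"
    by (rule L_cong[OF p]) (simp add: Lb_lam_rho)
  ultimately have "hp p * (\<i> * dT lam p) = hp p * (lam p * (cnj (tau p) - tau p))"
    using Lb_L[OF sm_lam p, of dw dw] hp_cnj[OF p]
    by (simp add: Lb_minus[OF p] L_minus[OF p] Lb_mult[OF p] L_mult[OF p] sm_str L_cnj[OF p] L_lam[OF p] Lb_lam_rho[OF p]
        g_vals[OF p] tau_eq[OF p] algebra_simps)
  then show ?thesis using hp_nz[OF p] by simp
qed

end

section \<open>A differential inequality along segments\<close>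

text \<open>The inequality is known on \<open>V\<close> only, but the factor \<open>k\<close> is
  continuous on a set containing the whole compact segment. So \<open>C\<close> does not depend on
  how close the path comes to the boundary of \<open>V\<close>, which is what excludes a blow-up
  there.\<close>

lemma segment_gronwall:
  fixes S :: "'a::euclidean_space \<Rightarrow> real"
  assumes seg: "closed_segment x z \<subseteq> W" and cont: "\<And>b. b \<in> Basis \<Longrightarrow> continuous_on W (k b)"
    and diff: "\<And>p. p \<in> V \<Longrightarrow> S differentiable (at p)"
    and bound: "\<And>p b. p \<in> V \<Longrightarrow> b \<in> Basis \<Longrightarrow> \<bar>frechet_derivative S (at p) b\<bar> \<le> k b p * S p"
    and nonneg: "\<And>p. p \<in> V \<Longrightarrow> S p \<ge> 0"
  obtains C where "C > 0" "\<And>t. 0 \<le> t \<Longrightarrow> t \<le> 1 \<Longrightarrow> (\<And>s. 0 \<le> s \<Longrightarrow> s \<le> t \<Longrightarrow> x + s *\<^sub>R (z - x) \<in> V) \<Longrightarrow>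
    S (x + t *\<^sub>R (z - x)) \<le> C * S x"
proof -
  let ?c = "\<lambda>s. x + s *\<^sub>R (z - x)"
  have cW: "?c s \<in> closed_segment x z" if "0 \<le> s" "s \<le> 1" for s
    using that by (auto simp: in_segment algebra_simps intro!: exI[of _ s])
  have "\<exists>m. \<forall>p\<in>closed_segment x z. k b p \<le> m" if "b \<in> Basis" for b
  proof -
    have "compact (k b ` closed_segment x z)"
      by (rule compact_continuous_image[OF continuous_on_subset[OF cont[OF that] seg] compact_segment])
    then show ?thesis using compact_imp_bounded bounded_real by (metis abs_le_D1 image_eqI)
  qed
  then obtain m where m: "\<And>b p. b \<in> Basis \<Longrightarrow> p \<in> closed_segment x z \<Longrightarrow> k b p \<le> m b" by metis
  define C where "C = (\<Sum>b\<in>Basis. \<bar>(z - x) \<bullet> b\<bar> * \<bar>m b\<bar>)"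
  have C0: "C \<ge> 0" unfolding C_def by (intro sum_nonneg) simp
  have d: "\<exists>y. ((\<lambda>s. S (?c s)) has_real_derivative y) (at s) \<and> y \<le> C * S (?c s)"
    if s: "0 \<le> s" "s \<le> 1" "?c s \<in> V" for s
  proof -
    let ?D = "frechet_derivative S (at (?c s))"
    have D: "(S has_derivative ?D) (at (?c s))" using diff[OF s(3)] frechet_derivative_works by blast
    note lin = has_derivative_linear[OF D]
    have "(?c has_derivative (\<lambda>k. k *\<^sub>R (z - x))) (at s)" by (auto intro!: derivative_eq_intros)
    from has_derivative_compose[OF this D]
    have 1: "((\<lambda>s. S (?c s)) has_real_derivative ?D (z - x)) (at s)"
      unfolding has_field_derivative_def
      by (rule has_derivative_eq_rhs) (simp add: linear_cmul[OF lin] mult.commute fun_eq_iff)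
    have "?D (z - x) = (\<Sum>b\<in>Basis. ((z - x) \<bullet> b) *\<^sub>R ?D b)"
      by (subst euclidean_representation[of "z - x", symmetric], simp only: linear_sum[OF lin] linear_cmul[OF lin])
    also have "\<dots> \<le> (\<Sum>b\<in>Basis. \<bar>(z - x) \<bullet> b\<bar> * \<bar>m b\<bar> * S (?c s))"
    proof (rule sum_mono)
      fix b :: 'a assume b: "b \<in> Basis"
      have "\<bar>?D b\<bar> \<le> k b (?c s) * S (?c s)" by (rule bound[OF s(3) b])
      also have "\<dots> \<le> \<bar>m b\<bar> * S (?c s)"
        using m[OF b cW[OF s(1,2)]] nonneg[OF s(3)] by (intro mult_right_mono) auto
      finally have "\<bar>(z - x) \<bullet> b\<bar> * \<bar>?D b\<bar> \<le> \<bar>(z - x) \<bullet> b\<bar> * (\<bar>m b\<bar> * S (?c s))"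
        by (intro mult_left_mono) auto
      moreover have "((z - x) \<bullet> b) *\<^sub>R ?D b \<le> \<bar>(z - x) \<bullet> b\<bar> * \<bar>?D b\<bar>"
        using abs_ge_self[of "((z - x) \<bullet> b) * ?D b"] unfolding abs_mult real_scaleR_def .
      ultimately show "((z - x) \<bullet> b) *\<^sub>R ?D b \<le> \<bar>(z - x) \<bullet> b\<bar> * \<bar>m b\<bar> * S (?c s)"
        unfolding mult.assoc by (rule order_trans[rotated])
    qed
    also have "\<dots> = C * S (?c s)" by (simp add: C_def sum_distrib_right)
    finally show ?thesis using 1 by blast
  qed
  show thesis
  proof (rule that[of "exp C"])
    fix t :: real assume t: "0 \<le> t" "t \<le> 1" and V: "\<And>s. 0 \<le> s \<Longrightarrow> s \<le> t \<Longrightarrow> ?c s \<in> V"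
    have "S (?c t) * exp (- C * t) \<le> S (?c 0) * exp (- C * 0)"
    proof (rule DERIV_nonpos_imp_nonincreasing[OF t(1)])
      fix s assume s: "0 \<le> s" "s \<le> t"
      then obtain y where y: "((\<lambda>s. S (?c s)) has_real_derivative y) (at s)" "y \<le> C * S (?c s)"
        using d[of s] V[of s] t by auto
      have "((\<lambda>s. S (?c s) * exp (- C * s)) has_real_derivative (y * exp (- C * s) + (exp (- C * s) * (- C)) * S (?c s))) (at s)"
        by (rule DERIV_mult[OF y(1)]) (auto intro!: derivative_eq_intros)
      moreover have "y * exp (- C * s) + (exp (- C * s) * (- C)) * S (?c s) = (y - C * S (?c s)) * exp (- C * s)"
        by (simp add: algebra_simps)
      moreover have "(y - C * S (?c s)) * exp (- C * s) \<le> 0" using y(2) by (simp add: mult_le_0_iff)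
      ultimately show "\<exists>y. ((\<lambda>s. S (?c s) * exp (- C * s)) has_real_derivative y) (at s) \<and> y \<le> 0" by metis
    qed
    then have "S (?c t) \<le> S x * exp (C * t)" by (simp add: exp_minus field_simps)
    also have "\<dots> \<le> S x * exp C"
      using C0 t nonneg[OF V[of 0]] by (intro mult_left_mono) (auto simp: mult_left_le)
    finally show "S (?c t) \<le> exp C * S x" by (simp add: mult.commute)
  qed simp
qed

text \<open>As in \<open>segment_gronwall\<close>, the factor is continuous on the large set while
  the estimate is required on the small one. Sums and continuous multiples preserve the relation, so
  an estimate can be read off the shape of a formula.\<close>

definition dominated :: "'a::topological_space set \<Rightarrow> 'a set \<Rightarrow> ('a \<Rightarrow> real) \<Rightarrow> ('a \<Rightarrow> complex) \<Rightarrow> bool"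
  where "dominated W V N u \<longleftrightarrow> (\<exists>k. continuous_on W k \<and> (\<forall>p\<in>V. cmod (u p) \<le> k p * N p))"

lemma dominated_add:
  assumes "dominated W V N u" "dominated W V N v"
  shows "dominated W V N (\<lambda>p. u p + v p)"
proof -
  obtain k l where "continuous_on W k" "\<And>p. p \<in> V \<Longrightarrow> cmod (u p) \<le> k p * N p"
    "continuous_on W l" "\<And>p. p \<in> V \<Longrightarrow> cmod (v p) \<le> l p * N p"
    using assms unfolding dominated_def by blast
  then show ?thesis unfolding dominated_def
    by (intro exI[of _ "\<lambda>p. k p + l p"]) (auto intro!: continuous_on_add norm_triangle_le simp: distrib_right add_mono)
qed

lemma dominated_mult:
  assumes "dominated W V N u" "continuous_on W c" "V \<subseteq> W"
  shows "dominated W V N (\<lambda>p. c p * u p)"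
proof -
  obtain k where k: "continuous_on W k" "\<And>p. p \<in> V \<Longrightarrow> cmod (u p) \<le> k p * N p"
    using assms unfolding dominated_def by blast
  have "continuous_on W (\<lambda>p. cmod (c p) * k p)"
    using k(1) assms(2) by (intro continuous_on_mult continuous_on_norm)
  moreover have "cmod (c p * u p) \<le> (cmod (c p) * k p) * N p" if "p \<in> V" for p
    using mult_left_mono[OF k(2)[OF that], of "cmod (c p)"] by (simp add: norm_mult mult.assoc)
  ultimately show ?thesis unfolding dominated_def by blast
qed

lemma dominated_zero: "dominated W V N (\<lambda>p. 0)"
  unfolding dominated_def by (intro exI[of _ "\<lambda>p. 0"]) auto

lemma dominated_sum:
  "(\<And>i. i \<in> I \<Longrightarrow> dominated W V N (u i)) \<Longrightarrow> dominated W V N (\<lambda>p. \<Sum>i\<in>I. u i p)"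
  by (induction I rule: infinite_finite_induct) (simp_all add: dominated_zero dominated_add)

lemma dominated_minus: "dominated W V N u \<Longrightarrow> dominated W V N (\<lambda>p. - u p)"
  unfolding dominated_def by simp

lemma dominated_diff:
  "dominated W V N u \<Longrightarrow> dominated W V N v \<Longrightarrow> dominated W V N (\<lambda>p. u p - v p)"
  using dominated_add[of W V N u "\<lambda>p. - v p"] dominated_minus[of W V N v] by simp

lemma dominated_cnj: "dominated W V N u \<Longrightarrow> dominated W V N (\<lambda>p. cnj (u p))"
  unfolding dominated_def by simp

lemma dominated_cong: "(\<And>p. p \<in> V \<Longrightarrow> u p = v p) \<Longrightarrow> dominated W V N u \<Longrightarrow> dominated W V N v"
  unfolding dominated_def by simp

lemma dominated_self: "(\<And>p. p \<in> V \<Longrightarrow> cmod (u p) \<le> N p) \<Longrightarrow> dominated W V N u"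
  unfolding dominated_def by (intro exI[of _ "\<lambda>p. 1"]) auto

section \<open>Transversality propagates\<close>

context transversal_map
begin

text \<open>\<open>dT\<close> and \<open>L X\<close> commute on \<open>lam\<close>. The conjugate of
  \<open>tau\<close> contributes no derivative, since \<open>tau\<close> is annihilated by
  \<open>Lb\<close>.\<close>

lemma T_rho: assumes p: "p \<in> W" shows "\<i> * dT (rho X) p = L X tau p"
proof -
  have "dT (L X lam) p = dT (\<lambda>p. - (lam p * rho X p)) p"
    by (rule T_cong[OF p]) (simp add: L_lam)
  then have 1: "L X (dT lam) p = - (lam p * dT (rho X) p + dT lam p * rho X p)"
    by (simp add: T_minus[OF p] T_mult[OF p] sm_str L_T[OF sm_lam p])
  have "L X (\<lambda>p. \<i> * dT lam p) p = L X (\<lambda>p. lam p * (cnj (tau p) - tau p)) p"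
    by (rule L_cong[OF p T_lam])
  then have "\<i> * L X (dT lam) p = - lam p * rho X p * (cnj (tau p) - tau p) - lam p * L X tau p"
    by (simp add: L_mult[OF p] L_diff[OF p] L_cnj[OF p] sm_str L_lam[OF p] Lb_tau[OF p] algebra_simps)
  then have "lam p * (\<i> * dT (rho X) p) + (\<i> * dT lam p) * rho X p
      = lam p * rho X p * (cnj (tau p) - tau p) + lam p * L X tau p"
    unfolding 1 by (simp add: algebra_simps)
  then have "lam p * (\<i> * dT (rho X) p) = lam p * L X tau p"
    unfolding T_lam[OF p] by (simp add: algebra_simps)
  then show ?thesis using lam_nz[OF p] by simp
qed

text \<open>\<open>hp * tau\<close> is a (0,1) derivative of \<open>rho dw\<close>, so the
  commutator formula reduces the (1,0) derivatives of \<open>tau\<close> to those of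
  \<open>rho\<close>. In the direction \<open>dw\<close> the commutator term is again
  \<open>L dw tau\<close>, by \<open>T_rho\<close>, which accounts for the factor 2.\<close>

lemma L_tau: assumes p: "p \<in> W"
  shows "L (dy a) tau p = - rho (dy a) p * tau p" "L dw tau p = rho dw p * (1 - tau p)"
proof -
  define kk where "kk = (\<lambda>p. hw (wc p) / hp p)"
  have sk: "sm kk" unfolding kk_def by (rule sm_divide[OF sm_hp(2,1) hp_nz])
  have dk: "Lb dw kk p = 2 * hp p" unfolding kk_def by (rule curvature_deriv[OF p])
  have hk: "hp p * kk p = hw (wc p)" using hp_nz[OF p] by (simp add: kk_def)
  have 0: "L X (Lb dw (rho dw)) p = L X (\<lambda>p. hp p * tau p) p" for X
    by (rule L_cong[OF p tau_eq])
  have "Lb dw (L (dy a) (rho dw)) p = Lb dw (\<lambda>p. - (rho (dy a) p * rho dw p)) p"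
    by (rule Lb_cong[OF p]) (simp add: L_rho)
  then have "hp p * L (dy a) tau p = hp p * (- rho (dy a) p * tau p)"
    using Lb_L[OF sm_rho p, of dw "dy a" dw] 0[of "dy a"]
    by (simp add: Lb_minus[OF p] Lb_mult[OF p] L_mult[OF p] sm_str g_vals[OF p] hp_derivs[OF p] tau_eq[OF p] Lb_rho[OF p])
  then show "L (dy a) tau p = - rho (dy a) p * tau p" using hp_nz[OF p] by (metis mult_left_cancel)
  have "Lb dw (L dw (rho dw)) p = Lb dw (\<lambda>p. kk p * rho dw p - rho dw p * rho dw p) p"
    by (rule Lb_cong[OF p]) (simp add: L_rho power2_eq_square kk_def)
  then have "Lb dw (L dw (rho dw)) p = 2 * hp p * rho dw p + hw (wc p) * tau p - 2 * (hp p * tau p * rho dw p)"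
    unfolding hk[symmetric]
    by (simp add: Lb_diff[OF p] Lb_mult[OF p] sm_str sk dk tau_eq[OF p] algebra_simps)
  moreover have "L dw (Lb dw (rho dw)) p = hw (wc p) * tau p + hp p * L dw tau p"
    unfolding 0 by (simp add: L_mult[OF p] sm_str hp_derivs[OF p])
  ultimately have "2 * (hp p * L dw tau p) = 2 * (hp p * (rho dw p * (1 - tau p)))"
    using Lb_L[OF sm_rho p, of dw dw dw] T_rho[OF p, of dw]
    by (simp add: g_vals[OF p] algebra_simps)
  then show "L dw tau p = rho dw p * (1 - tau p)" using hp_nz[OF p] by simp
qed

lemma T_tau: assumes p: "p \<in> W" shows "\<i> * dT tau p = tau p * (1 - tau p)"
proof -
  have "Lb dw (L dw tau) p = Lb dw (\<lambda>p. rho dw p * (1 - tau p)) p"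
    by (rule Lb_cong[OF p L_tau(2)])
  moreover have "L dw (Lb dw tau) p = L dw (\<lambda>p. 0) p" by (rule L_cong[OF p Lb_tau])
  ultimately have "hp p * (\<i> * dT tau p) = hp p * (tau p * (1 - tau p))"
    using Lb_L[OF sm_tau p, of dw dw]
    by (simp add: Lb_mult[OF p] Lb_diff[OF p] sm_str g_vals[OF p] tau_eq[OF p] Lb_tau[OF p])
  then show ?thesis using hp_nz[OF p] by simp
qed

section \<open>The energy and its derivatives\<close>

definition vi where "vi p = 1 / lam p"

lemma sm_vi: "sm vi" unfolding vi_def[abs_def] by (rule sm_divide[OF sm_const sm_lam lam_nz])

lemma vi_derivs: assumes p: "p \<in> W"
  shows "L X vi p = vi p * rho X p" "\<i> * dT vi p = vi p * (tau p - cnj (tau p))"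
proof -
  show "L X vi p = vi p * rho X p"
    unfolding vi_def[abs_def] using L_div(1)[OF p sm_const sm_lam lam_nz] lam_nz[OF p]
    by (simp add: L_lam[OF p] field_simps)
  have "dT vi p = - (1 / lam p * dT lam p) / lam p"
    unfolding vi_def[abs_def] using L_div(3)[OF p sm_const sm_lam lam_nz] by simp
  then have "\<i> * dT vi p = - (1 / lam p * (\<i> * dT lam p)) / lam p" by simp
  also have "\<dots> = vi p * (tau p - cnj (tau p))"
    unfolding T_lam[OF p] using lam_nz[OF p] by (simp add: vi_def diff_divide_distrib)
  finally show "\<i> * dT vi p = vi p * (tau p - cnj (tau p))" .
qed

text \<open>The weight contributes \<open>rho X p\<close> times the square, respectively
  \<open>tau - cnj tau\<close> times it. For \<open>u\<close> among \<open>tau\<close> and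
  \<open>rho\<close> these are the terms that cancel the quadratic right-hand sides of the equations
  for \<open>u\<close>.\<close>

lemma L_weighted: assumes p: "p \<in> W" and u: "sm u"
  shows "L X (\<lambda>p. vi p * (u p * cnj (u p))) p =
      vi p * (rho X p * u p * cnj (u p) + L X u p * cnj (u p) + u p * cnj (Lb X u p))"
    and "\<i> * dT (\<lambda>p. vi p * (u p * cnj (u p))) p =
      vi p * ((tau p - cnj (tau p)) * u p * cnj (u p) + (\<i> * dT u p) * cnj (u p) - u p * cnj (\<i> * dT u p))"
proof -
  show "L X (\<lambda>p. vi p * (u p * cnj (u p))) p =
      vi p * (rho X p * u p * cnj (u p) + L X u p * cnj (u p) + u p * cnj (Lb X u p))"
    by (simp add: L_mult[OF p] sm_vi sm_str u L_cnj[OF p] vi_derivs[OF p] algebra_simps)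
  have "\<i> * dT (\<lambda>p. vi p * (u p * cnj (u p))) p = (\<i> * dT vi p) * (u p * cnj (u p))
      + vi p * ((\<i> * dT u p) * cnj (u p) - u p * cnj (\<i> * dT u p))"
    by (simp add: T_mult[OF p] sm_vi sm_str u T_cnj[OF p] algebra_simps)
  then show "\<i> * dT (\<lambda>p. vi p * (u p * cnj (u p))) p =
      vi p * ((tau p - cnj (tau p)) * u p * cnj (u p) + (\<i> * dT u p) * cnj (u p) - u p * cnj (\<i> * dT u p))"
    unfolding vi_derivs[OF p] by (simp add: algebra_simps)
qed

abbreviation rj where "rj j \<equiv> rho (dy (axis j 1))"

text \<open>The squared length of (1, \<open>tau\<close>, \<open>rho\<close>) divided by
  \<open>lam\<close>. The constant 1 makes the energy an upper bound for
  1/\<open>lam\<close>.\<close>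

definition energy where "energy p = vi p * (1 * cnj 1) + vi p * (tau p * cnj (tau p)) + vi p * (rho dw p * cnj (rho dw p))
  + (\<Sum>j\<in>UNIV. vi p * (rj j p * cnj (rj j p)))"

lemma sm_w: "sm u \<Longrightarrow> sm (\<lambda>p. vi p * (u p * cnj (u p)))"
  by (intro sm_mult sm_vi sm_cnj)

lemma sm_energy: "sm energy"
  unfolding energy_def[abs_def] by (intro sm_add sm_sum sm_w sm_const sm_tau sm_rho)

text \<open>The point is the shape of the right-hand sides: each summand is \<open>vi\<close> times
  a product of two of the functions 1, \<open>tau\<close>, \<open>rho\<close>, with coefficients
  from the hypersurface. All cubic terms have cancelled.\<close>

lemma energy_derivs: assumes p: "p \<in> W"
  shows "L dw energy p = vi p * rho dw p * cnj 1 + vi p * rho dw p * cnj (tau p) + hw (wc p) / hp p * (vi p * rho dw p * cnj (rho dw p))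
      + hp p * (vi p * rho dw p * cnj (tau p))"
    and "L (dy a) energy p = vi p * rho (dy a) p * cnj 1
      + (\<Sum>j\<in>UNIV. - al a p * (vi p * rj j p * cnj (rj j p)) - al (axis j 1) p * (vi p * rho (dy a) p * cnj (rj j p))
          + cnj (g (dy (axis j 1)) (dy a) p) * (vi p * rj j p * cnj (tau p) - vi p * rj j p * cnj 1))"
    and "\<i> * dT energy p = vi p * tau p * cnj 1 - vi p * 1 * cnj (tau p)"
proof -
  note s = sm_w[OF sm_const, of 1] sm_w[OF sm_tau] sm_w[OF sm_rho] sm_sum[where I=UNIV, OF sm_w[OF sm_rho]]
  have Lsum: "L X energy p = L X (\<lambda>p. vi p * (1 * cnj 1)) p + L X (\<lambda>p. vi p * (tau p * cnj (tau p))) p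
     + L X (\<lambda>p. vi p * (rho dw p * cnj (rho dw p))) p + (\<Sum>j\<in>UNIV. L X (\<lambda>p. vi p * (rj j p * cnj (rj j p))) p)" for X
    unfolding energy_def[abs_def] L_sum[OF p sm_w[OF sm_rho], symmetric]
    by (simp only: L_add[OF p] s sm_add)
  have Tsum: "dT energy p = dT (\<lambda>p. vi p * (1 * cnj 1)) p + dT (\<lambda>p. vi p * (tau p * cnj (tau p))) p
     + dT (\<lambda>p. vi p * (rho dw p * cnj (rho dw p))) p + (\<Sum>j\<in>UNIV. dT (\<lambda>p. vi p * (rj j p * cnj (rj j p))) p)"
    unfolding energy_def[abs_def] T_sum[OF p sm_w[OF sm_rho], symmetric]
    by (simp only: T_add[OF p] s sm_add)
  show "L dw energy p = vi p * rho dw p * cnj 1 + vi p * rho dw p * cnj (tau p) + hw (wc p) / hp p * (vi p * rho dw p * cnj (rho dw p))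
      + hp p * (vi p * rho dw p * cnj (tau p))"
    unfolding Lsum L_weighted(1)[OF p sm_const] L_weighted(1)[OF p sm_tau] L_weighted(1)[OF p sm_rho]
      L_rho[OF p] Lb_rho[OF p] L_tau[OF p] Lb_tau[OF p] tau_eq[OF p]
    by (simp add: hp_cnj[OF p] power2_eq_square algebra_simps)
  show "L (dy a) energy p = vi p * rho (dy a) p * cnj 1
      + (\<Sum>j\<in>UNIV. - al a p * (vi p * rj j p * cnj (rj j p)) - al (axis j 1) p * (vi p * rho (dy a) p * cnj (rj j p))
          + cnj (g (dy (axis j 1)) (dy a) p) * (vi p * rj j p * cnj (tau p) - vi p * rj j p * cnj 1))"
    unfolding Lsum L_weighted(1)[OF p sm_const] L_weighted(1)[OF p sm_tau] L_weighted(1)[OF p sm_rho]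
      L_rho[OF p] Lb_rho[OF p] L_tau[OF p] Lb_tau[OF p]
    by (simp add: power2_eq_square algebra_simps)
  have "\<i> * dT energy p = \<i> * dT (\<lambda>p. vi p * (1 * cnj 1)) p + \<i> * dT (\<lambda>p. vi p * (tau p * cnj (tau p))) p
     + \<i> * dT (\<lambda>p. vi p * (rho dw p * cnj (rho dw p))) p + (\<Sum>j\<in>UNIV. \<i> * dT (\<lambda>p. vi p * (rj j p * cnj (rj j p))) p)"
    unfolding Tsum by (simp add: distrib_left sum_distrib_left)
  also have "\<dots> = vi p * tau p * cnj 1 - vi p * 1 * cnj (tau p)"
    unfolding L_weighted(2)[OF p sm_const] L_weighted(2)[OF p sm_tau] L_weighted(2)[OF p sm_rho]
      T_rho[OF p] T_tau[OF p] L_tau[OF p]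
    by (simp add: algebra_simps)
  finally show "\<i> * dT energy p = vi p * tau p * cnj 1 - vi p * 1 * cnj (tau p)" .
qed

end

lemma segment_point: "0 \<le> s \<Longrightarrow> s \<le> 1 \<Longrightarrow> x + s *\<^sub>R (z - x) \<in> closed_segment x z"
  by (auto simp: in_segment algebra_simps intro!: exI[of _ s])

lemma hip_sum_left: "hip (\<Sum>j\<in>J. u j) e = (\<Sum>j\<in>J. hip (u j) e)"
  by (induction J rule: infinite_finite_induct) (simp_all add: hip_add_left)

lemma Re_mult_cnj: "Re (u * cnj u) = (cmod u)\<^sup>2"
  by (metis Re_complex_of_real complex_norm_square)

text \<open>Estimates in the frame become estimates of real derivatives; the coefficient of
  \<open>dT\<close> takes back the corrections built into \<open>L\<close> and
  \<open>Lb\<close>.\<close>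

lemma (in circle_bundle) total_derivative:
  fixes u :: "'e \<times> real \<Rightarrow> 'b::complex_normed_space"
  assumes "p \<in> W" "sm u"
  shows "frechet_derivative u (at p) (X, t) =
    L X u p + Lb X u p + (of_real t - \<i>/2 * P X p + \<i>/2 * Pb X p) *\<^sub>C dT u p"
proof -
  note lin = frechet_derivative_linear[OF assms(2,1)]
  have "frechet_derivative u (at p) ((X, 0) + t *\<^sub>R (0, 1)) =
      frechet_derivative u (at p) (X, 0) + t *\<^sub>R frechet_derivative u (at p) (0, 1)"
    by (simp only: linear_add[OF lin] linear_cmul[OF lin])
  moreover have "(1/2) *\<^sub>C y + (1/2) *\<^sub>C y = y" for y :: 'b
    by (simp flip: scaleC_add_left)
  then have "dz X u p + dzb X u p = frechet_derivative u (at p) (X, 0)"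
    by (simp add: dz_def dzb_def cderiv_def scaleC_simps algebra_simps)
  ultimately show ?thesis
    by (simp add: L_def Lb_def dT_def cderiv_def scaleC_simps scaleC_of_real algebra_simps)
qed

context transversal_map
begin

lemma lam_pos: "p \<in> W \<Longrightarrow> lam p = of_real (Re (lam p))" "p \<in> W \<Longrightarrow> Re (lam p) > 0"
  using lam_eq[of p] lam_nz[of p] by (auto simp: complex_eq_iff less_le)

lemma rho_expand: assumes p: "p \<in> W" shows "rho (dy a) p = (\<Sum>j\<in>UNIV. a $ j * rj j p)"
  unfolding rho_def L_dy_expand[OF p sm_lam, of a] by (simp add: sum_divide_distrib sum_negf)

lemma energy_eq: assumes p: "p \<in> W"
  shows "energy p = of_real ((1 + (cmod (tau p))\<^sup>2 + (cmod (rho dw p))\<^sup>2 + (\<Sum>j\<in>UNIV. (cmod (rj j p))\<^sup>2)) / Re (lam p))"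
proof -
  have v: "vi p = of_real (1 / Re (lam p))" unfolding vi_def by (subst lam_pos(1)[OF p]) simp
  show ?thesis
    unfolding energy_def v complex_norm_square[symmetric]
    by (simp add: add_divide_distrib sum_divide_distrib)
qed

lemma energy_real: "p \<in> W \<Longrightarrow> energy p = of_real (Re (energy p))"
  by (subst (1 2) energy_eq) simp_all

lemma energy_ge: assumes p: "p \<in> W" shows "1 / Re (lam p) \<le> Re (energy p)"
  unfolding energy_eq[OF p] using lam_pos(2)[OF p]
  by (simp add: divide_right_mono sum_nonneg add.assoc)

lemma weighted_le_energy:
  assumes p: "p \<in> W" and u: "(cmod u)\<^sup>2 \<le> 1 + (cmod (tau p))\<^sup>2 + (cmod (rho dw p))\<^sup>2 + (\<Sum>j\<in>UNIV. (cmod (rj j p))\<^sup>2)"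
    and v: "(cmod v)\<^sup>2 \<le> 1 + (cmod (tau p))\<^sup>2 + (cmod (rho dw p))\<^sup>2 + (\<Sum>j\<in>UNIV. (cmod (rj j p))\<^sup>2)"
  shows "cmod (vi p * u * cnj v) \<le> Re (energy p)"
proof -
  have "2 * (cmod u * cmod v) \<le> (cmod u)\<^sup>2 + (cmod v)\<^sup>2" using sum_squares_bound[of "cmod u" "cmod v"] by simp
  then have "cmod u * cmod v \<le> 1 + (cmod (tau p))\<^sup>2 + (cmod (rho dw p))\<^sup>2 + (\<Sum>j\<in>UNIV. (cmod (rj j p))\<^sup>2)"
    using u v by linarith
  moreover have "cmod (vi p) = 1 / Re (lam p)"
    unfolding vi_def using lam_pos(2)[OF p] by (subst lam_pos(1)[OF p]) (simp add: norm_divide)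
  ultimately show ?thesis unfolding energy_eq[OF p] using lam_pos(2)[OF p]
    by (simp add: norm_mult divide_right_mono)
qed

lemma energy_terms:
  assumes "p \<in> W"
  shows "(cmod 1)\<^sup>2 \<le> 1 + (cmod (tau p))\<^sup>2 + (cmod (rho dw p))\<^sup>2 + (\<Sum>j\<in>UNIV. (cmod (rj j p))\<^sup>2)"
    and "(cmod (tau p))\<^sup>2 \<le> 1 + (cmod (tau p))\<^sup>2 + (cmod (rho dw p))\<^sup>2 + (\<Sum>j\<in>UNIV. (cmod (rj j p))\<^sup>2)"
    and "(cmod (rho dw p))\<^sup>2 \<le> 1 + (cmod (tau p))\<^sup>2 + (cmod (rho dw p))\<^sup>2 + (\<Sum>j\<in>UNIV. (cmod (rj j p))\<^sup>2)"
    and "(cmod (rj i p))\<^sup>2 \<le> 1 + (cmod (tau p))\<^sup>2 + (cmod (rho dw p))\<^sup>2 + (\<Sum>j\<in>UNIV. (cmod (rj j p))\<^sup>2)"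
proof -
  have "(cmod (rj i p))\<^sup>2 \<le> (\<Sum>j\<in>UNIV. (cmod (rj j p))\<^sup>2)" by (rule member_le_sum) auto
  then show "(cmod (rj i p))\<^sup>2 \<le> 1 + (cmod (tau p))\<^sup>2 + (cmod (rho dw p))\<^sup>2 + (\<Sum>j\<in>UNIV. (cmod (rj j p))\<^sup>2)"
    by (smt (verit) zero_le_power2)
qed (simp_all add: sum_nonneg add_nonneg_nonneg)

text \<open>The bound on the coefficients must hold up to the zeros of \<^term>\<open>lam\<close>, hence the larger
  set \<open>W0\<close> on which only the geometry of the hypersurface has to be continuous.\<close>

lemma energy_dominated:
  assumes W0: "W \<subseteq> W0"
    and cont: "\<And>X. continuous_on W0 (P X)" "\<And>X. continuous_on W0 (Pb X)" "\<And>a. continuous_on W0 (al a)"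
      "\<And>X Y. continuous_on W0 (g X Y)" "continuous_on W0 hp" "continuous_on W0 (\<lambda>p. hw (wc p) / hp p)"
  shows "dominated W0 W (\<lambda>p. Re (energy p)) (\<lambda>p. frechet_derivative energy (at p) r)"
proof -
  let ?dom = "dominated W0 W (\<lambda>p. Re (energy p))"
  note D = dominated_add dominated_diff dominated_sum dominated_minus dominated_mult[OF _ _ W0]
  have base: "?dom (\<lambda>p. vi p * u p * cnj (v p))" if "u \<in> {\<lambda>p. 1, tau, rho dw} \<union> range rj" "v \<in> {\<lambda>p. 1, tau, rho dw} \<union> range rj" for u v
  proof -
    have "(cmod (u p))\<^sup>2 \<le> 1 + (cmod (tau p))\<^sup>2 + (cmod (rho dw p))\<^sup>2 + (\<Sum>j\<in>UNIV. (cmod (rj j p))\<^sup>2)" if p: "p \<in> W" and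
      u: "u \<in> {\<lambda>p. 1, tau, rho dw} \<union> range rj" for u p
      using u energy_terms[OF p] by blast
    then show ?thesis using that by (intro dominated_self weighted_le_energy) auto
  qed
  note b = base[of "\<lambda>p. 1" "\<lambda>p. 1"] base[of "tau" "\<lambda>p. 1"] base[of "\<lambda>p. 1" tau] base[of "rho dw" "\<lambda>p. 1"] base[of "rho dw" tau] base[of "rho dw" "rho dw"]
  have rj: "?dom (\<lambda>p. vi p * rho (dy a) p * cnj (v p))" if "v \<in> {\<lambda>p. 1, tau, rho dw} \<union> range rj" for a v
  proof (rule dominated_cong)
    show "?dom (\<lambda>p. \<Sum>j\<in>UNIV. a $ j * (vi p * rj j p * cnj (v p)))"
      by (intro D base that continuous_on_const) auto
    show "(\<Sum>j\<in>UNIV. a $ j * (vi p * rj j p * cnj (v p))) = vi p * rho (dy a) p * cnj (v p)" if "p \<in> W" for p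
      unfolding rho_expand[OF that, of a] by (simp add: sum_distrib_left sum_distrib_right mult_ac)
  qed
  have Ldw: "?dom (L dw energy)"
  proof (rule dominated_cong[OF energy_derivs(1)[symmetric]])
    show "?dom (\<lambda>p. vi p * rho dw p * cnj 1 + vi p * rho dw p * cnj (tau p) + hw (wc p) / hp p * (vi p * rho dw p * cnj (rho dw p))
      + hp p * (vi p * rho dw p * cnj (tau p)))"
      by (intro dominated_add dominated_mult[OF _ _ W0] b cont) auto
  qed
  have Ldy: "?dom (L (dy a) energy)" for a
  proof (rule dominated_cong[OF energy_derivs(2)[symmetric]])
    have cg: "continuous_on W0 (\<lambda>p. cnj (g X Y p))" for X Y by (intro continuous_on_cnj cont)
    have ca: "continuous_on W0 (\<lambda>p. - al a p)" for a by (intro continuous_on_minus cont)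
    show "?dom (\<lambda>p. vi p * rho (dy a) p * cnj 1
      + (\<Sum>j\<in>UNIV. - al a p * (vi p * rj j p * cnj (rj j p)) - al (axis j 1) p * (vi p * rho (dy a) p * cnj (rj j p))
          + cnj (g (dy (axis j 1)) (dy a) p) * (vi p * rj j p * cnj (tau p) - vi p * rj j p * cnj 1)))"
      by (intro dominated_add dominated_sum dominated_diff dominated_mult[OF _ _ W0] rj[of "\<lambda>p. 1"] rj base[of _ "\<lambda>p. 1"] base cg ca cont) auto
  qed
  have dTE: "?dom (dT energy)"
  proof (rule dominated_cong)
    show "?dom (\<lambda>p. - \<i> * (vi p * tau p * cnj 1 - vi p * 1 * cnj (tau p)))"
      by (intro dominated_diff dominated_mult[OF _ _ W0] b continuous_on_const) auto
    show "- \<i> * (vi p * tau p * cnj 1 - vi p * 1 * cnj (tau p)) = dT energy p" if "p \<in> W" for p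
      unfolding energy_derivs(3)[OF that, symmetric] by simp
  qed
  obtain a c t where r: "r = ((a, c), t)" by (metis surj_pair)
  have LX: "?dom (L (a, c) energy)"
  proof (rule dominated_cong)
    show "?dom (\<lambda>p. L (dy a) energy p + c * L dw energy p)"
      by (intro dominated_add dominated_mult[OF _ _ W0] Ldy Ldw continuous_on_const)
    show "L (dy a) energy p + c * L dw energy p = L (a, c) energy p" if "p \<in> W" for p
      using L_linear(1)[OF that sm_energy, of "dy a" "c *\<^sub>C dw"] L_linear(2)[OF that sm_energy, of c dw]
      by (simp add: scaleC_prod_def)
  qed
  have Lb: "cnj (L X energy p) = Lb X energy p" if p: "p \<in> W" for X p
  proof -
    have "Lb X energy p = Lb X (\<lambda>p. cnj (energy p)) p"
      by (rule Lb_cong[OF p]) (metis energy_real complex_cnj_complex_of_real)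
    then show ?thesis using Lb_cnj[OF p sm_energy] by simp
  qed
  show ?thesis
  proof (rule dominated_cong)
    show "?dom (\<lambda>p. L (a, c) energy p + cnj (L (a, c) energy p) + (of_real t - \<i>/2 * P (a, c) p + \<i>/2 * Pb (a, c) p) * dT energy p)"
      by (intro dominated_add dominated_cnj dominated_mult[OF _ _ W0] LX dTE continuous_intros cont)
    show "L (a, c) energy p + cnj (L (a, c) energy p) + (of_real t - \<i>/2 * P (a, c) p + \<i>/2 * Pb (a, c) p) * dT energy p =
        frechet_derivative energy (at p) r" if "p \<in> W" for p
      unfolding r total_derivative[OF that sm_energy] using Lb[OF that] by simp
  qed
qed

end

context revolution_map
begin

lemma sm_al: "sm (al a)" unfolding al_def[abs_def] by (intro sm_mult sm_chart)

text \<open>The set \<open>W1\<close> where \<open>lam\<close> is nonzero carries the structure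
  equations. Up to the first zero of \<open>lam\<close> on the segment the energy is bounded by a
  constant fixed in advance, hence so is 1/\<open>lam\<close>, against continuity at that
  zero.\<close>

lemma lam_propagates:
  assumes seg: "closed_segment x z \<subseteq> W" and x: "lam x \<noteq> 0"
  shows "lam z \<noteq> 0"
proof
  assume z0: "lam z = 0"
  define W1 where "W1 = {p \<in> W. lam p \<noteq> 0}"
  have clam: "continuous_on W lam" by (rule smooth_on_imp_continuous_on[OF sm_lam])
  have oW1: "open W1"
  proof -
    have "open (W \<inter> lam -` (- {0}))" by (rule continuous_open_preimage[OF clam open_W]) auto
    then show ?thesis by (simp add: W1_def Int_def vimage_def)
  qed
  have sub: "W1 \<subseteq> W" by (auto simp: W1_def)
  interpret t: transversal_map H \<psi> W1 U f
    by unfold_locales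
      (use sub oW1 smooth_on_subset[OF smooth_Psi sub] posH open_U smooth_psi W_dom h_pos smooth_on_subset[OF sm_f sub]
        Lb_f f_f hom dims dim2 curvature_le in \<open>auto simp: W1_def\<close>)
  have c: "continuous_on W (P X)" "continuous_on W (Pb X)" "continuous_on W (al a)"
      "continuous_on W (g X Y)" "continuous_on W (\<lambda>p. h (wc p))" "continuous_on W (\<lambda>p. hw (wc p) / h (wc p))" for X Y a
  proof -
    have "sm (\<lambda>p. hw (wc p) / h (wc p))"
      by (rule sm_divide[OF sm_wc[OF smooth_h(3)] sm_wc[OF smooth_h(2)]]) (use h_real(2) in fastforce)
    then show "continuous_on W (\<lambda>p. hw (wc p) / h (wc p))" by (rule smooth_on_imp_continuous_on)
  qed (rule smooth_on_imp_continuous_on sm_P sm_Pb sm_al sm_g sm_wc smooth_h)+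
  define S where "S p = Re (t.energy p)" for p
  have "\<exists>k. continuous_on W k \<and> (\<forall>p\<in>W1. cmod (frechet_derivative t.energy (at p) b) \<le> k p * S p)" for b
    using t.energy_dominated[OF sub c, of b] unfolding dominated_def S_def .
  then obtain k where k: "\<And>b. continuous_on W (k b)"
    "\<And>b p. p \<in> W1 \<Longrightarrow> cmod (frechet_derivative t.energy (at p) b) \<le> k b p * S p" by metis
  have smS: "smooth_on S W1" unfolding S_def by (rule smooth_on_bounded_linear[OF bounded_linear_Re oW1 t.sm_energy])
  have bnd: "\<bar>frechet_derivative S (at p) b\<bar> \<le> k b p * S p" if "p \<in> W1" for p b
  proof -
    have "frechet_derivative S (at p) b = Re (frechet_derivative t.energy (at p) b)"
      unfolding S_def by (rule frechet_derivative_bounded_linear[OF bounded_linear_Re t.sm_energy that])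
    then show ?thesis using k(2)[OF that, of b] abs_Re_le_cmod order_trans by metis
  qed
  have Sge: "1 / Re (lam p) \<le> S p" "0 < Re (lam p)" "0 < S p" if "p \<in> W1" for p
    using t.energy_ge[OF that] t.lam_pos(2)[OF that] unfolding S_def by (auto intro: less_le_trans[of 0 "1 / Re (lam p)"])
  obtain C where C: "C > 0" "\<And>t. 0 \<le> t \<Longrightarrow> t \<le> 1 \<Longrightarrow> (\<And>s. 0 \<le> s \<Longrightarrow> s \<le> t \<Longrightarrow> x + s *\<^sub>R (z - x) \<in> W1) \<Longrightarrow>
    S (x + t *\<^sub>R (z - x)) \<le> C * S x"
    by (rule segment_gronwall[OF seg k(1), of W1 S])
      (use bnd Sge(3) smS in \<open>auto simp: less_imp_le differentiable_def intro: smooth_on_has_derivative\<close>)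
  let ?c = "\<lambda>s. x + s *\<^sub>R (z - x)"
  have cW: "?c s \<in> W" if "0 \<le> s" "s \<le> 1" for s
    using segment_point[OF that] seg by blast
  have xW1: "x \<in> W1" using x cW[of 0] by (simp add: W1_def)
  define l where "l s = Re (lam (?c s))" for s
  have cl: "continuous_on {0..1} l"
    unfolding l_def
    by (intro continuous_on_Re continuous_on_compose2[OF clam]) (auto intro!: continuous_intros cW)
  define Z where "Z = {s \<in> {0..1}. l s = 0}"
  have "closed Z" unfolding Z_def by (rule continuous_closed_preimage_constant[OF cl]) simp
  then have "compact ({0..1} \<inter> Z)" by (rule compact_Int_closed[OF compact_Icc])
  moreover have "{0..1} \<inter> Z = Z" by (auto simp: Z_def)
  ultimately have "compact Z" by simp
  moreover have "1 \<in> Z" using z0 by (simp add: Z_def l_def)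
  ultimately obtain t where t: "t \<in> Z" "\<And>s. s \<in> Z \<Longrightarrow> t \<le> s" using compact_attains_inf[of Z] by blast
  have t01: "0 \<le> t" "t \<le> 1" "l t = 0" using t(1) by (auto simp: Z_def)
  have inW1: "?c s \<in> W1" if "0 \<le> s" "s < t" for s
  proof -
    have "s \<notin> Z" using t(2)[of s] that by auto
    then have "l s \<noteq> 0" using that t01 by (simp add: Z_def)
    then show ?thesis using cW[of s] that t01 by (auto simp: W1_def l_def)
  qed
  \<comment> \<open>Before the first zero 1/\<open>lam\<close> is at most \<open>C * S x\<close>, so
    \<open>lam\<close> cannot fall below this value.\<close>
  define \<epsilon> where "\<epsilon> = 1 / (C * S x)"
  have eps: "\<epsilon> > 0" using C(1) Sge(3)[OF xW1] by (simp add: \<epsilon>_def)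
  have lge: "\<epsilon> \<le> l s" if "0 \<le> s" "s < t" for s
  proof -
    have "S (?c s) \<le> C * S x" using that t01 by (intro C(2) inW1) auto
    then have "1 / l s \<le> C * S x" using Sge(1)[OF inW1[OF that]] unfolding l_def by linarith
    moreover have "l s > 0" using Sge(2)[OF inW1[OF that]] unfolding l_def .
    moreover have "C * S x > 0" using C(1) Sge(3)[OF xW1] by simp
    ultimately show ?thesis unfolding \<epsilon>_def by (simp add: field_simps)
  qed
  have "t \<noteq> 0" using t01(3) Sge(2)[OF xW1] by (auto simp: l_def)
  then have tpos: "t > 0" using t01 by simp
  obtain d where d: "d > 0" "\<And>s. s \<in> {0..1} \<Longrightarrow> dist s t < d \<Longrightarrow> dist (l s) (l t) < \<epsilon>"
    using cl[unfolded continuous_on_iff, rule_format, of t \<epsilon>] eps t01 by auto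
  define s where "s = max 0 (t - d / 2)"
  have s: "0 \<le> s" "s < t" "dist s t < d" using d(1) tpos by (auto simp: s_def dist_real_def)
  then have "dist (l s) (l t) < \<epsilon>" using d(2)[of s] t01 by auto
  then show False using lge[OF s(1,2)] t01(3) by (simp add: dist_real_def)
qed

end

section \<open>Constancy of the span of the tangent vectors\<close>

context transversal_map
begin

text \<open>For fixed \<open>e\<close> the pairings of \<open>L X f\<close> and \<open>G\<close>
  with \<open>e\<close> solve a homogeneous linear first-order system, so they stay zero along the
  segment. Testing with all \<open>e\<close> replaces the transport of a subspace by that of
  scalars.\<close>

lemma annihilator_propagates:
  assumes seg: "closed_segment x z \<subseteq> W"
    and x: "\<And>X. hip (L X f x) e = 0" "hip (G x) e = 0"
  shows "hip (L X f z) e = 0" "hip (G z) e = 0" "hip (f z) e = hip (f x) e"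
proof -
  define yG where "yG p = hip (G p) e" for p
  define y where "y X p = hip (L X f p) e" for X p
  define N where "N p = cmod (yG p) + cmod (y dw p) + (\<Sum>j\<in>UNIV. cmod (y (dy (axis j 1)) p))" for p
  let ?dom = "dominated W W N"
  have smy: "sm yG" "sm (y X)" for X
    unfolding yG_def[abs_def] y_def[abs_def] by (intro sm_hip sm_G sm_L sm_f sm_const)+
  have sk: "sm (\<lambda>p. hw (wc p) / hp p)" by (rule sm_divide[OF sm_hp(2,1) hp_nz])
  have ct: "continuous_on W u" if "sm u" for u :: "_ \<Rightarrow> complex" by (rule smooth_on_imp_continuous_on[OF that])
  have Dm: "?dom (\<lambda>p. c p * u p)" if "?dom u" "sm c" for c u
    by (rule dominated_mult[OF that(1) ct[OF that(2)] order_refl])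
  have dG: "?dom yG" and dwd: "?dom (y dw)" and dj: "?dom (y (dy (axis j 1)))" for j
  proof -
    have "cmod (y (dy (axis j 1)) p) \<le> (\<Sum>j\<in>UNIV. cmod (y (dy (axis j 1)) p))" for p by (rule member_le_sum) auto
    then have "cmod (y (dy (axis j 1)) p) \<le> N p" for p
      unfolding N_def using norm_ge_zero[of "yG p"] norm_ge_zero[of "y dw p"] by (simp add: add_increasing)
    then show "?dom (y (dy (axis j 1)))" by (intro dominated_self)
  qed (auto intro!: dominated_self simp: N_def sum_nonneg)
  have dyd: "?dom (y (dy a))" for a
  proof (rule dominated_cong)
    show "?dom (\<lambda>p. \<Sum>j\<in>UNIV. a $ j * y (dy (axis j 1)) p)"
      by (intro dominated_sum Dm dj sm_const)
    show "(\<Sum>j\<in>UNIV. a $ j * y (dy (axis j 1)) p) = y (dy a) p" if "p \<in> W" for p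
      unfolding y_def L_dy_expand[OF that sm_f, of a]
      by (simp add: hip_sum_left hip_scaleC_left)
  qed
  have dec: "L X u p = L (dy (fst X)) u p + snd X *\<^sub>C L dw u p" "Lb X u p = Lb (dy (fst X)) u p + cnj (snd X) *\<^sub>C Lb dw u p"
    if "p \<in> W" "sm u" for X p and u :: "_ \<Rightarrow> 'x::complex_normed_space"
  proof -
    have "X = dy (fst X) + snd X *\<^sub>C dw" by (simp add: prod_eq_iff scaleC_prod_def)
    then show "L X u p = L (dy (fst X)) u p + snd X *\<^sub>C L dw u p" "Lb X u p = Lb (dy (fst X)) u p + cnj (snd X) *\<^sub>C Lb dw u p"
      using L_linear[OF that] by metis+
  qed
  have Lhip: "L X (\<lambda>p. hip (F p) e) p = hip (L X F p) e" "Lb X (\<lambda>p. hip (F p) e) p = hip (Lb X F p) e"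
    "dT (\<lambda>p. hip (F p) e) p = hip (dT F p) e" if "p \<in> W" "sm F" for F X p
    using that by (simp_all add: L_hip Lb_hip T_hip sm_const)
  have LG: "?dom (\<lambda>p. hip (L X G p) e)" for X
  proof (rule dominated_cong)
    show "?dom (\<lambda>p. (- (rho (dy (fst X)) p) * yG p - tau p * y (dy (fst X)) p) + snd X * (- (rho dw p) * yG p + (1 - tau p) * y dw p))"
      by (intro dominated_add dominated_diff Dm dG dyd dwd sm_const sm_minus sm_rho sm_tau sm_diff)
    show "(- (rho (dy (fst X)) p) * yG p - tau p * y (dy (fst X)) p) + snd X * (- (rho dw p) * yG p + (1 - tau p) * y dw p) = hip (L X G p) e"
      if "p \<in> W" for p
      unfolding dec[OF that sm_G, of X] Ga[OF that] Gw[OF that] by (simp add: hip_simps y_def yG_def)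
  qed
  have tot: "?dom (\<lambda>p. frechet_derivative (\<lambda>p. hip (F p) e) (at p) r)"
    if F: "sm F" "\<And>X. ?dom (\<lambda>p. hip (L X F p) e)" "\<And>X. ?dom (\<lambda>p. hip (Lb X F p) e)" "?dom (\<lambda>p. hip (dT F p) e)" for F r
  proof (rule dominated_cong)
    obtain X t where r: "r = (X, t)" by (metis surj_pair)
    show "?dom (\<lambda>p. hip (L (fst r) F p) e + hip (Lb (fst r) F p) e + (of_real (snd r) - \<i>/2 * P (fst r) p + \<i>/2 * Pb (fst r) p) * hip (dT F p) e)"
      by (intro dominated_add Dm F sm_add sm_diff sm_mult sm_const sm_P sm_Pb)
    show "hip (L (fst r) F p) e + hip (Lb (fst r) F p) e + (of_real (snd r) - \<i>/2 * P (fst r) p + \<i>/2 * Pb (fst r) p) * hip (dT F p) e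
      = frechet_derivative (\<lambda>p. hip (F p) e) (at p) r" if p: "p \<in> W" for p
      unfolding r total_derivative[OF p sm_hip[OF F(1) sm_const]] by (simp add: Lhip[OF p F(1)])
  qed
  have iT: "hip (dT (L X f) p) e = - \<i> * hip (L X G p) e" if "p \<in> W" for X p
    unfolding L_G[OF that] by (simp add: hip_simps)
  have DG: "?dom (\<lambda>p. frechet_derivative yG (at p) r)" for r
    unfolding yG_def[abs_def]
  proof (rule tot[OF sm_G LG])
    show "?dom (\<lambda>p. hip (Lb X G p) e)" for X
      by (rule dominated_cong[OF _ dominated_zero]) (simp add: Lb_G)
    show "?dom (\<lambda>p. hip (dT G p) e)"
    proof (rule dominated_cong)
      show "?dom (\<lambda>p. (- \<i> * (1 - 2 * tau p)) * yG p)"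
        by (intro Dm dG sm_mult sm_diff sm_const sm_tau)
      show "(- \<i> * (1 - 2 * tau p)) * yG p = hip (dT G p) e" if "p \<in> W" for p
        using arg_cong[OF TG[OF that], of "\<lambda>v. - \<i> * hip v e"] by (simp add: hip_simps yG_def)
    qed
  qed
  have Lf: "?dom (\<lambda>p. hip (L X (L dw f) p) e)" "?dom (\<lambda>p. hip (L X (L (dy b) f) p) e)" for X b
  proof -
    have wa: "L dw (L (dy b) f) p = L (dy b) (L dw f) p" if "p \<in> W" for p by (rule L_L[OF sm_f that])
    have ww: "?dom (\<lambda>p. hip (L dw (L dw f) p) e)"
    proof (rule dominated_cong)
      show "?dom (\<lambda>p. (- 2 * rho dw p + hw (wc p) / hp p) * y dw p)"
        by (intro Dm dwd sm_add sm_mult sm_const sm_rho sk)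
    qed (simp add: Fww hip_simps y_def)
    have aw: "?dom (\<lambda>p. hip (L (dy a) (L dw f) p) e)" for a
    proof (rule dominated_cong)
      show "?dom (\<lambda>p. - (rho (dy a) p) * y dw p - rho dw p * y (dy a) p)"
        by (intro Dm dominated_diff dwd dyd sm_minus sm_rho)
    qed (simp add: Faw hip_simps y_def)
    have ab: "?dom (\<lambda>p. hip (L (dy a) (L (dy b) f) p) e)" for a
    proof (rule dominated_cong)
      show "?dom (\<lambda>p. - (rho (dy a) p) * y (dy b) p - rho (dy b) p * y (dy a) p - al a p * y (dy b) p - al b p * y (dy a) p)"
        by (intro Dm dominated_diff dyd sm_minus sm_rho sm_al)
    qed (simp add: Fab hip_simps y_def)
    show "?dom (\<lambda>p. hip (L X (L dw f) p) e)"
      by (rule dominated_cong[OF _ dominated_add[OF aw[of "fst X"] Dm[OF ww sm_const[of "snd X"]]]])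
        (simp add: dec(1)[OF _ sm_L[OF sm_f], of _ X] hip_simps)
    show "?dom (\<lambda>p. hip (L X (L (dy b) f) p) e)"
      by (rule dominated_cong[OF _ dominated_add[OF ab[of "fst X"] Dm[OF aw[of b] sm_const[of "snd X"]]]])
        (simp add: dec(1)[OF _ sm_L[OF sm_f], of _ X] hip_simps wa)
  qed
  have DY: "?dom (\<lambda>p. frechet_derivative (y Z) (at p) r)" if Z: "\<And>X. ?dom (\<lambda>p. hip (L X (L Z f) p) e)" for Z r
    unfolding y_def[abs_def]
  proof (rule tot[OF sm_L[OF sm_f] Z])
    show "?dom (\<lambda>p. hip (Lb X (L Z f) p) e)" for X
    proof (rule dominated_cong)
      show "?dom (\<lambda>p. g Z X p * yG p)" by (intro Dm dG sm_g)
    qed (simp add: Lb_Lf hip_simps yG_def)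
    show "?dom (\<lambda>p. hip (dT (L Z f) p) e)"
    proof (rule dominated_cong)
      show "?dom (\<lambda>p. (- \<i>) * hip (L Z G p) e)" by (intro Dm LG sm_const)
    qed (simp add: iT)
  qed
  \<comment> \<open>The number of summands of \<open>N\<close>, for the Cauchy-Schwarz inequality
    between \<open>N\<close> and the sum of squares \<open>S\<close>. The sum \<open>S\<close> is
    needed because \<open>N\<close> need not be differentiable at its zeros.\<close>
  define m :: real where "m = 2 + CARD('n)"
  define S where "S p = Re (yG p * cnj (yG p)) + Re (y dw p * cnj (y dw p)) + (\<Sum>j\<in>UNIV. Re (y (dy (axis j 1)) p * cnj (y (dy (axis j 1)) p)))" for p
  have Ssq: "S p = (cmod (yG p))\<^sup>2 + (cmod (y dw p))\<^sup>2 + (\<Sum>j\<in>UNIV. (cmod (y (dy (axis j 1)) p))\<^sup>2)" for p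
    unfolding S_def Re_mult_cnj ..
  have NS: "(N p)\<^sup>2 \<le> m * S p" for p
  proof -
    let ?u = "\<lambda>i :: 'n option option. case i of None \<Rightarrow> cmod (yG p) | Some None \<Rightarrow> cmod (y dw p) | Some (Some j) \<Rightarrow> cmod (y (dy (axis j 1)) p)"
    have sumO: "(\<Sum>i\<in>UNIV. k i) = k None + (\<Sum>i\<in>UNIV. k (Some i))" for k :: "('a::finite) option \<Rightarrow> real"
      by (simp add: UNIV_option_conv sum.reindex)
    have "(\<Sum>i\<in>UNIV. ?u i * 1)\<^sup>2 \<le> (\<Sum>i\<in>UNIV. (?u i)\<^sup>2) * (\<Sum>i\<in>(UNIV :: 'n option option set). 1\<^sup>2)"
      by (rule Cauchy_Schwarz_ineq_sum)
    then show ?thesis unfolding sumO by (simp add: N_def Ssq m_def algebra_simps)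
  qed
  have sqterm: "\<exists>k. continuous_on W k \<and> (\<forall>p\<in>W. \<bar>frechet_derivative (\<lambda>p. Re (u p * cnj (u p))) (at p) b\<bar> \<le> k p * S p)"
    if u: "sm u" "?dom (\<lambda>p. frechet_derivative u (at p) b)" "\<And>p. cmod (u p) \<le> N p" for u b
  proof -
    obtain k where k: "continuous_on W k" "\<And>p. p \<in> W \<Longrightarrow> cmod (frechet_derivative u (at p) b) \<le> k p * N p"
      using u(2) unfolding dominated_def by blast
    have "\<bar>frechet_derivative (\<lambda>p. Re (u p * cnj (u p))) (at p) b\<bar> \<le> (2 * \<bar>k p\<bar> * m) * S p" if p: "p \<in> W" for p
    proof -
      let ?D = "frechet_derivative u (at p) b"
      have "frechet_derivative (\<lambda>p. Re (u p * cnj (u p))) (at p) b = Re (u p * cnj ?D + ?D * cnj (u p))"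
        using frechet_derivative_bounded_linear[OF bounded_linear_Re sm_mult[OF u(1) sm_cnj[OF u(1)]] p]
          frechet_derivative_bilinear[OF bounded_bilinear_mult u(1) sm_cnj[OF u(1)] p]
          frechet_derivative_bounded_linear[OF bounded_linear_cnj u(1) p] by simp
      also have "\<bar>\<dots>\<bar> \<le> 2 * (cmod (u p) * cmod ?D)"
        by (rule order_trans[OF abs_Re_le_cmod norm_triangle_le]) (simp add: norm_mult)
      also have "cmod (u p) * cmod ?D \<le> N p * (\<bar>k p\<bar> * N p)"
      proof (rule mult_mono[OF u(3)])
        have "N p \<ge> 0" using u(3)[of p] norm_ge_zero order_trans by blast
        then show "cmod ?D \<le> \<bar>k p\<bar> * N p"
          using k(2)[OF p] by (meson abs_ge_self mult_right_mono order_trans)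
        show "0 \<le> N p" by fact
      qed simp
      also have "N p * (\<bar>k p\<bar> * N p) = \<bar>k p\<bar> * (N p)\<^sup>2" by (simp add: power2_eq_square)
      also have "\<dots> \<le> \<bar>k p\<bar> * (m * S p)" by (intro mult_left_mono NS) simp
      finally show ?thesis by (simp add: mult_ac)
    qed
    moreover have "continuous_on W (\<lambda>p. 2 * \<bar>k p\<bar> * m)" by (intro continuous_intros k(1))
    ultimately show ?thesis by blast
  qed
  have Nle: "cmod (yG p) \<le> N p" "cmod (y dw p) \<le> N p" "cmod (y (dy (axis j 1)) p) \<le> N p" for p j
  proof -
    have "cmod (y (dy (axis j 1)) p) \<le> (\<Sum>j\<in>UNIV. cmod (y (dy (axis j 1)) p))" for p by (rule member_le_sum) auto
    then show "cmod (y (dy (axis j 1)) p) \<le> N p"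
      unfolding N_def using norm_ge_zero[of "yG p"] norm_ge_zero[of "y dw p"] by (simp add: add_increasing)
  qed (auto simp: N_def sum_nonneg)
  have smR: "smooth_on (\<lambda>p. Re (u p * cnj (u p))) W" if "sm u" for u
    by (rule smooth_on_bounded_linear[OF bounded_linear_Re open_W sm_mult[OF that sm_cnj[OF that]]])
  have smS: "smooth_on S W" unfolding S_def[abs_def]
    by (intro sm_add sm_sum smR smy)
  have "\<exists>k. continuous_on W k \<and> (\<forall>p\<in>W. \<bar>frechet_derivative S (at p) b\<bar> \<le> k p * S p)" for b
  proof -
    obtain k1 where k1: "continuous_on W k1" "\<And>p. p \<in> W \<Longrightarrow> \<bar>frechet_derivative (\<lambda>p. Re (yG p * cnj (yG p))) (at p) b\<bar> \<le> k1 p * S p"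
      using sqterm[OF smy(1) DG Nle(1)] by blast
    obtain k2 where k2: "continuous_on W k2" "\<And>p. p \<in> W \<Longrightarrow> \<bar>frechet_derivative (\<lambda>p. Re (y dw p * cnj (y dw p))) (at p) b\<bar> \<le> k2 p * S p"
      using sqterm[OF smy(2) DY[OF Lf(1)] Nle(2)] by blast
    have "\<forall>j. \<exists>k. continuous_on W k \<and> (\<forall>p\<in>W. \<bar>frechet_derivative (\<lambda>p. Re (y (dy (axis j 1)) p * cnj (y (dy (axis j 1)) p))) (at p) b\<bar> \<le> k p * S p)"
      using sqterm[OF smy(2) DY[OF Lf(2)] Nle(3)] by blast
    from choice[OF this] obtain k3 where "\<forall>j. continuous_on W (k3 j) \<and> (\<forall>p\<in>W. \<bar>frechet_derivative (\<lambda>p. Re (y (dy (axis j 1)) p * cnj (y (dy (axis j 1)) p))) (at p) b\<bar> \<le> k3 j p * S p)"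
      by (elim exE)
    then have k3: "\<And>j. continuous_on W (k3 j)" "\<And>j p. p \<in> W \<Longrightarrow> \<bar>frechet_derivative (\<lambda>p. Re (y (dy (axis j 1)) p * cnj (y (dy (axis j 1)) p))) (at p) b\<bar> \<le> k3 j p * S p"
      by simp_all
    have sumD: "frechet_derivative (\<lambda>p. \<Sum>j\<in>J. v j p) (at p) b = (\<Sum>j\<in>J. frechet_derivative (v j) (at p) b)"
      if "finite J" "\<And>j. smooth_on (v j) W" "p \<in> W" for J and v :: "'n \<Rightarrow> _ \<Rightarrow> real" and p
      using that(1)
    proof (induction J)
      case (insert i J)
      have "smooth_on (\<lambda>p. \<Sum>j\<in>J. v j p) W" by (rule smooth_on_sum[OF open_W that(2)])
      from frechet_derivative_add[OF that(2) this that(3), of i b] show ?case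
        using insert by simp
    qed simp
    have "\<bar>frechet_derivative S (at p) b\<bar> \<le> (k1 p + k2 p + (\<Sum>j\<in>UNIV. k3 j p)) * S p" if p: "p \<in> W" for p
    proof -
      have "frechet_derivative S (at p) b = frechet_derivative (\<lambda>p. Re (yG p * cnj (yG p))) (at p) b
          + frechet_derivative (\<lambda>p. Re (y dw p * cnj (y dw p))) (at p) b
          + (\<Sum>j\<in>UNIV. frechet_derivative (\<lambda>p. Re (y (dy (axis j 1)) p * cnj (y (dy (axis j 1)) p))) (at p) b)"
        unfolding S_def[abs_def] sumD[OF finite_class.finite_UNIV smR[OF smy(2)] p, symmetric]
        by (simp only: frechet_derivative_add[OF _ _ p] smR smy sm_add sm_sum)
      moreover have "\<bar>\<Sum>j\<in>UNIV. frechet_derivative (\<lambda>p. Re (y (dy (axis j 1)) p * cnj (y (dy (axis j 1)) p))) (at p) b\<bar> \<le> (\<Sum>j\<in>UNIV. k3 j p) * S p"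
        unfolding sum_distrib_right by (rule order_trans[OF sum_abs sum_mono[OF k3(2)[OF p]]])
      ultimately show ?thesis using k1(2)[OF p] k2(2)[OF p] by (simp add: distrib_right)
    qed
    moreover have "continuous_on W (\<lambda>p. k1 p + k2 p + (\<Sum>j\<in>UNIV. k3 j p))"
      by (intro continuous_intros k1 k2 k3)
    ultimately show ?thesis by blast
  qed
  then have "\<forall>b. \<exists>k. continuous_on W k \<and> (\<forall>p\<in>W. \<bar>frechet_derivative S (at p) b\<bar> \<le> k p * S p)" by blast
  from choice[OF this] obtain k where "\<forall>b. continuous_on W (k b) \<and> (\<forall>p\<in>W. \<bar>frechet_derivative S (at p) b\<bar> \<le> k b p * S p)"
    by (elim exE)
  then have k: "\<And>b. continuous_on W (k b)" "\<And>b p. p \<in> W \<Longrightarrow> \<bar>frechet_derivative S (at p) b\<bar> \<le> k b p * S p"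
    by blast+
  have Snn: "S p \<ge> 0" for p unfolding Ssq by (simp add: sum_nonneg)
  obtain C where C: "C > 0" "\<And>t. 0 \<le> t \<Longrightarrow> t \<le> 1 \<Longrightarrow> (\<And>s. 0 \<le> s \<Longrightarrow> s \<le> t \<Longrightarrow> x + s *\<^sub>R (z - x) \<in> W) \<Longrightarrow>
    S (x + t *\<^sub>R (z - x)) \<le> C * S x"
    by (rule segment_gronwall[OF seg k(1), of W S])
      (use k(2) Snn smS in \<open>auto simp: differentiable_def intro: smooth_on_has_derivative\<close>)
  have Sx: "S x = 0" unfolding Ssq y_def yG_def using x by simp
  have all0: "S p = 0" if p: "p \<in> closed_segment x z" for p
  proof -
    obtain t where t: "0 \<le> t" "t \<le> 1" "p = x + t *\<^sub>R (z - x)" using p by (auto simp: in_segment algebra_simps)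
    have "x + s *\<^sub>R (z - x) \<in> W" if "0 \<le> s" "s \<le> t" for s
      using segment_point[of s x z] that t seg by auto
    then have "S p \<le> C * S x" unfolding t(3) using t by (intro C(2)) auto
    then show ?thesis using Sx Snn[of p] by simp
  qed
  have y0: "yG p = 0" "y X p = 0" if p: "p \<in> closed_segment x z" for p X
  proof -
    have pW: "p \<in> W" using p seg by blast
    have s: "(\<Sum>j\<in>UNIV. (cmod (y (dy (axis j 1)) p))\<^sup>2) = 0" and 0: "yG p = 0" "y dw p = 0"
      using all0[OF p] sum_nonneg[of UNIV "\<lambda>j. (cmod (y (dy (axis j 1)) p))\<^sup>2"] unfolding Ssq
      by (smt (verit) zero_le_power2 norm_eq_zero power_eq_0_iff)+
    then have j0: "y (dy (axis j 1)) p = 0" for j by (simp add: sum_nonneg_eq_0_iff)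
    have "y (dy a) p = 0" for a
      unfolding y_def L_dy_expand[OF pW sm_f, of a]
      using j0 by (simp add: hip_sum_left hip_scaleC_left y_def)
    then show "y X p = 0" using 0(2) unfolding y_def dec(1)[OF pW sm_f, of X] by (simp add: hip_simps)
    show "yG p = 0" by fact
  qed
  show "hip (L X f z) e = 0" "hip (G z) e = 0" using y0[of z] by (simp_all add: y_def yG_def)
  have "\<exists>c. \<forall>p\<in>closed_segment x z. hip (f p) e = c"
  proof (rule has_derivative_zero_constant)
    fix p assume p: "p \<in> closed_segment x z"
    then have pW: "p \<in> W" using seg by blast
    have sm: "sm (\<lambda>p. hip (f p) e)" by (intro sm_hip sm_f sm_const)
    have "hip (dT f p) e = - \<i> * yG p" by (simp add: yG_def G_def hip_simps)
    then have "frechet_derivative (\<lambda>p. hip (f p) e) (at p) r = 0" for r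
      using total_derivative[OF pW sm, of "fst r" "snd r"] y0[OF p]
      by (simp add: Lhip[OF pW sm_f] Lb_f[OF pW] y_def)
    then have "frechet_derivative (\<lambda>p. hip (f p) e) (at p) = (\<lambda>r. 0)" by auto
    then show "((\<lambda>p. hip (f p) e) has_derivative (\<lambda>r. 0)) (at p within closed_segment x z)"
      using smooth_on_has_derivative[OF sm pW] has_derivative_at_withinI by metis
  qed simp
  then show "hip (f z) e = hip (f x) e" by auto
qed

end

section \<open>From local to global\<close>

text \<open>\<open>M\<close> is not open, and a segment between two of its points may leave it. The
  segments are drawn in the open set \<open>W\<close> instead, in which \<open>M\<close> sits at
  parameter 0.\<close>

lemma section_induct:
  fixes M :: "'a::real_normed_vector set"
  assumes M: "connected M" "\<And>m. m \<in> M \<Longrightarrow> (m, 0::real) \<in> W" and W: "open W"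
    and step: "\<And>x z. closed_segment x z \<subseteq> W \<Longrightarrow> Q x \<Longrightarrow> Q z"
    and m: "m \<in> M" "m' \<in> M" "Q (m, 0)"
  shows "Q (m', 0)"
proof (rule connected_induction_simple[OF M(1) m(1,2), where P="\<lambda>m. Q (m, 0)"])
  fix a assume a: "a \<in> M"
  then obtain e where e: "e > 0" "ball (a, 0) e \<subseteq> W" using M(2) W open_contains_ball by blast
  let ?T = "M \<inter> {m. (m, 0::real) \<in> ball (a, 0) e}"
  have "open ((\<lambda>m. (m, 0::real)) -` ball (a, 0) e)" by (rule open_vimage) (auto intro!: continuous_intros)
  then have "openin (top_of_set M) ?T" unfolding vimage_def by (rule openin_open_Int)
  moreover have "Q (x, 0) \<longrightarrow> Q (y, 0)" if "x \<in> ?T" "y \<in> ?T" for x y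
  proof -
    have "closed_segment (x, 0::real) (y, 0) \<subseteq> ball (a, 0) e" using that by (intro closed_segment_subset) auto
    then show ?thesis using step e(2) by blast
  qed
  moreover have "a \<in> ?T" using a e(1) by simp
  ultimately show "\<exists>T. openin (top_of_set M) T \<and> a \<in> T \<and> (\<forall>x\<in>T. \<forall>y\<in>T. Q (x, 0) \<longrightarrow> Q (y, 0))" by blast
qed (use m in auto)

text \<open>\<open>B\<close> is the orthogonal projection onto the complement of \<open>V\<close>;
  it provides the transverse coordinates in \<open>local_image_open\<close>.\<close>

lemma orthogonal_projection_exists:
  fixes V :: "'a::euclidean_space set"
  assumes "subspace V"
  obtains B where "linear B" "\<And>x v. v \<in> V \<Longrightarrow> B x \<bullet> v = 0" "\<And>x. x - B x \<in> V" "\<And>x. (\<And>v. v \<in> V \<Longrightarrow> x \<bullet> v = 0) \<Longrightarrow> B x = x"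
proof -
  obtain b where b: "b \<subseteq> V" "pairwise orthogonal b" "\<And>x. x \<in> b \<Longrightarrow> norm x = 1" "independent b" "span b = V"
    using orthonormal_basis_subspace[OF assms] by metis
  have fin: "finite b" using b(4) independent_imp_finite by blast
  define B where "B x = x - (\<Sum>u\<in>b. (x \<bullet> u) *\<^sub>R u)" for x
  have lin: "linear B"
    unfolding B_def by (intro linear_compose_sub linear_id linear_compose_sum ballI)
      (auto intro!: linearI simp: inner_add_left scaleR_add_left)
  have Bu: "B x \<bullet> u = 0" if u: "u \<in> b" for x u
  proof -
    have "(\<Sum>v\<in>b. (x \<bullet> v) *\<^sub>R v) \<bullet> u = (\<Sum>v\<in>b. (x \<bullet> v) * (v \<bullet> u))" by (simp add: inner_sum_left)
    also have "\<dots> = (\<Sum>v\<in>b. if v = u then x \<bullet> u else 0)"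
      using b(2) b(3)[OF u] u by (intro sum.cong) (auto simp: pairwise_def orthogonal_def norm_eq_1)
    also have "\<dots> = x \<bullet> u" using fin u by simp
    finally show ?thesis by (simp add: B_def inner_diff_left)
  qed
  have orth: "B x \<bullet> v = 0" if "v \<in> V" for x v
  proof -
    have "v \<in> span b" using that b(5) by simp
    then show ?thesis
      by (induction rule: span_induct_alt) (simp_all add: inner_add_right Bu)
  qed
  have diff: "x - B x \<in> V" for x
    unfolding B_def b(5)[symmetric] by (simp add: span_sum span_scale span_base)
  have fixB: "B x = x" if x: "\<And>v. v \<in> V \<Longrightarrow> x \<bullet> v = 0" for x
    using x b(1) by (simp add: B_def subset_iff)
  show thesis by (rule that[OF lin orth diff fixB])
qed

context transversal_map
begin

text \<open>The value \<open>t0\<close> cancels the \<open>dT\<close> term of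
  \<open>total_derivative\<close>. Of the complex line of \<open>G\<close> only the imaginary
  multiples are reached; the real ones point out of the sphere.\<close>

lemma frechet_f: assumes p: "p \<in> W"
  shows "\<exists>r. frechet_derivative f (at p) r = L X f p" "\<exists>r. frechet_derivative f (at p) r = t *\<^sub>R (\<i> *\<^sub>C G p)"
proof -
  define t0 where "t0 = Re (\<i>/2 * P X p - \<i>/2 * Pb X p)"
  have "of_real t0 - \<i>/2 * P X p + \<i>/2 * Pb X p = 0"
    unfolding t0_def cnj_P[OF p, symmetric] by (simp add: complex_eq_iff)
  then have "frechet_derivative f (at p) (X, t0) = L X f p"
    unfolding total_derivative[OF p sm_f] by (simp add: Lb_f[OF p])
  then show "\<exists>r. frechet_derivative f (at p) r = L X f p" by blast
  have "L 0 f p = 0" "P 0 p = 0" "Pb 0 p = 0"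
    using L_linear(2)[OF p sm_f, of 0 0] P_linear(2,4)[OF p, of 0 0] by simp_all
  then have "frechet_derivative f (at p) (0, - t) = t *\<^sub>R (\<i> *\<^sub>C G p)"
    unfolding total_derivative[OF p sm_f] G_def
    by (simp add: Lb_f[OF p] scaleC_scaleC scaleC_minus_left scaleC_of_real)
  then show "\<exists>r. frechet_derivative f (at p) r = t *\<^sub>R (\<i> *\<^sub>C G p)" by blast
qed

lemma local_image_open:
  assumes p: "p \<in> W" and V: "subspace V" and Vt: "V = {v. \<exists>X c. v = L X f p + c *\<^sub>C G p}"
    and a: "\<And>v. v \<in> V \<Longrightarrow> hip v a = 0" and fV: "\<And>p'. p' \<in> W \<Longrightarrow> f p' - a \<in> V"
  shows "\<exists>d>0. \<forall>e. e - a \<in> V \<longrightarrow> norm e = 1 \<longrightarrow> dist (f p) e < d \<longrightarrow> e \<in> f ` W"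
proof -
  obtain B where B: "linear B" "\<And>x v. v \<in> V \<Longrightarrow> B x \<bullet> v = 0" "\<And>x. x - B x \<in> V"
    "\<And>x. (\<And>v. v \<in> V \<Longrightarrow> x \<bullet> v = 0) \<Longrightarrow> B x = x"
    using orthogonal_projection_exists[OF V] by blast
  have bB: "bounded_linear B" using B(1) linear_conv_bounded_linear by blast
  define u where "u = f p - a"
  have uV: "u \<in> V" using fV[OF p] by (simp add: u_def)
  have LV: "L X f p \<in> V" and GV: "G p \<in> V" for X
  proof -
    have "L X f p = L X f p + 0 *\<^sub>C G p" by simp
    then show "L X f p \<in> V" unfolding Vt by blast
    have "G p = L 0 f p + 1 *\<^sub>C G p" using L_linear(2)[OF p sm_f, of 0 0] by simp
    then show "G p \<in> V" unfolding Vt by blast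
  qed
  have Gu: "hip (G p) u = - lam p" unfolding u_def by (simp add: hip_diff_right a[OF GV] lam_def)
  have Lu: "hip (L X f p) u = 0" for X unfolding u_def by (simp add: hip_diff_right a[OF LV] Lf_f[OF p])
  have u0: "u \<noteq> 0" using Gu lam_nz[OF p] by auto
  \<comment> \<open>The coefficient \<open>\<mu>\<close> turns out real and nonzero, so the
    rescaling direction \<open>u\<close> supplies the real multiples of \<open>G\<close> that the
    derivative of \<open>f\<close> misses.\<close>
  obtain Z \<mu> where u: "u = L Z f p + \<mu> *\<^sub>C G p" using uV unfolding Vt by blast
  have "hip u u = \<mu> * - lam p" by (subst u) (simp add: hip_simps Lu Gu)
  then have "\<mu> = - of_real ((norm u)\<^sup>2) / lam p" using lam_nz[OF p] by (simp add: hip_self field_simps)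
  also have "\<dots> = of_real (- (norm u)\<^sup>2 / Re (lam p))" by (subst lam_pos(1)[OF p]) simp
  finally obtain m :: real where m: "\<mu> = of_real m" by blast
  have m0: "m \<noteq> 0" using u0 \<open>hip u u = \<mu> * - lam p\<close> by (auto simp: m)
  let ?D = "frechet_derivative f (at p)"
  note dlin = frechet_derivative_linear[OF sm_f p]
  define \<Theta> where "\<Theta> x = a + fst (snd x) *\<^sub>R (f (fst x) - a) + B (snd (snd x))" for x :: "(((complex ^ 'n) \<times> complex) \<times> real) \<times> real \<times> (complex ^ 'm)"
  define \<Theta>' where "\<Theta>' x = ?D (fst x) + fst (snd x) *\<^sub>R u + B (snd (snd x))" for x :: "(((complex ^ 'n) \<times> complex) \<times> real) \<times> real \<times> (complex ^ 'm)"
  have dT: "(\<Theta> has_derivative \<Theta>') (at (p, 1, 0))"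
  proof -
    have 1: "((\<lambda>x. f (fst x)) has_derivative (\<lambda>x. ?D (fst x))) (at (p, 1, 0))"
      by (rule has_derivative_compose[OF has_derivative_fst[OF has_derivative_ident]])
        (simp add: smooth_on_has_derivative[OF sm_f p])
    have 2: "((\<lambda>x. fst (snd x)) has_derivative (\<lambda>x. fst (snd x))) (at (p, 1, 0))"
      by (intro has_derivative_fst has_derivative_snd has_derivative_ident)
    have 3: "((\<lambda>x. B (snd (snd x))) has_derivative (\<lambda>x. B (snd (snd x)))) (at (p, 1, 0))"
      by (intro bounded_linear.has_derivative[OF bB] has_derivative_snd has_derivative_ident)
    note has_derivative_add[OF has_derivative_add[OF has_derivative_const has_derivative_scaleR[OF 2
        has_derivative_diff[OF 1 has_derivative_const]]] 3, of a a]
    then show ?thesis unfolding \<Theta>_def[abs_def] \<Theta>'_def[abs_def] by (simp add: u_def)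
  qed
  have linT: "linear \<Theta>'" using has_derivative_linear[OF dT] .
  have "\<exists>x. \<Theta>' x = y" for y :: "complex ^ 'm"
  proof -
    obtain X c where Xc: "y - B y = L X f p + c *\<^sub>C G p" using B(3)[of y] unfolding Vt by blast
    have G: "G p = (1 / m) *\<^sub>R (u - L Z f p)" using m0 by (subst u) (simp add: m scaleC_of_real)
    have "c *\<^sub>C G p = Re c *\<^sub>R G p + Im c *\<^sub>R (\<i> *\<^sub>C G p)"
      using linear_complex_expand[OF bounded_linear.linear[OF bounded_bilinear.bounded_linear_left[OF
              bounded_bilinear_scaleC, of "G p"]], of c] by (simp add: scaleC_of_real)
    then have y: "y - B y = L X f p + (Re c / m) *\<^sub>R (u - L Z f p) + Im c *\<^sub>R (\<i> *\<^sub>C G p)"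
      unfolding Xc by (subst (asm) (2) G) simp
    obtain r1 r2 r3 where r: "?D r1 = L X f p" "?D r2 = L Z f p" "?D r3 = Im c *\<^sub>R (\<i> *\<^sub>C G p)"
      using frechet_f[OF p] by metis
    have BB: "B y = B (B y)" using B(4)[of "B y"] B(2)[of _ y] by simp
    have "\<Theta>' (r1 - (Re c / m) *\<^sub>R r2 + r3, Re c / m, B y) = y"
      unfolding \<Theta>'_def using y BB
      by (simp add: linear_add[OF dlin] linear_diff[OF dlin] linear_cmul[OF dlin] r algebra_simps)
    then show "\<exists>x. \<Theta>' x = y" by blast
  qed
  then have "surj \<Theta>'" unfolding surj_def by metis
  then obtain g' where g': "linear g'" "\<Theta>' \<circ> g' = id" using linear_surjective_right_inverse[OF linT] by blast
  have bg: "bounded_linear g'" using g'(1) linear_conv_bounded_linear by blast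
  \<comment> \<open>The lower bound keeps \<open>\<rho>\<close> positive, so that comparing norms
    later yields \<open>\<rho> = 1\<close>.\<close>
  define T where "T = W \<times> {1/2<..<2::real} \<times> (UNIV :: (complex ^ 'm) set)"
  have oT: "open T" unfolding T_def by (intro open_Times open_W) auto
  have xT: "(p, 1, 0) \<in> T" using p by (simp add: T_def)
  have cT: "continuous_on T \<Theta>"
  proof -
    have "continuous_on T (\<lambda>x. f (fst x))"
      by (rule continuous_on_compose2[OF smooth_on_imp_continuous_on[OF sm_f]]) (auto simp: T_def intro!: continuous_intros)
    moreover have "continuous_on T (\<lambda>x. B (snd (snd x)))"
      by (intro bounded_linear.continuous_on[OF bB] continuous_intros)
    ultimately show ?thesis unfolding \<Theta>_def[abs_def] by (intro continuous_intros)
  qed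
  have "\<Theta> (p, 1, 0) \<in> interior (\<Theta> ` T)"
    by (rule sussmann_open_mapping[OF oT cT xT dT bg g'(2) order_refl]) (use xT oT in \<open>simp add: interior_open\<close>)
  moreover have "\<Theta> (p, 1, 0) = f p" by (simp add: \<Theta>_def linear_0[OF B(1)])
  ultimately obtain d where d: "d > 0" "ball (f p) d \<subseteq> \<Theta> ` T" by (metis mem_interior)
  have rad: "(norm (e - a))\<^sup>2 = 1 - (norm a)\<^sup>2" if "e - a \<in> V" "norm e = 1" for e
  proof -
    have "orthogonal (e - a) a" using a[OF that(1)] by (simp add: Re_hip[symmetric] orthogonal_def)
    then have "(norm ((e - a) + a))\<^sup>2 = (norm (e - a))\<^sup>2 + (norm a)\<^sup>2" by (rule norm_add_Pythagorean)
    then show ?thesis using that(2) by simp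
  qed
  have nf: "norm (f p') = 1" if "p' \<in> W" for p'
  proof -
    have "complex_of_real ((norm (f p'))\<^sup>2) = of_real 1" using f_f[OF that] by (simp add: hip_self)
    then have "(norm (f p'))\<^sup>2 = 1" by (simp only: of_real_eq_iff)
    then show ?thesis by (simp add: power2_eq_1_iff) (smt (verit) norm_ge_zero)
  qed
  have "e \<in> f ` W" if e: "e - a \<in> V" "norm e = 1" "dist (f p) e < d" for e
  proof -
    obtain p' \<rho> x where px: "p' \<in> W" "1/2 < \<rho>" "e = a + \<rho> *\<^sub>R (f p' - a) + B x"
      using d(2) e(3) by (fastforce simp: T_def \<Theta>_def subset_iff)
    have f': "f p' - a \<in> V" by (rule fV[OF px(1)])
    have "B x = (e - a) - \<rho> *\<^sub>R (f p' - a)" using px(3) by simp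
    then have "B x \<in> V" using e(1) f' V by (simp add: subspace_diff subspace_scale)
    then have "B x = 0" using B(2)[of "B x" x] by simp
    then have ea: "e - a = \<rho> *\<^sub>R (f p' - a)" using px(3) by simp
    have "norm (f p' - a) = norm (e - a)"
      using rad[OF e(1,2)] rad[OF f' nf[OF px(1)]] by (simp add: power2_eq_iff_nonneg flip: power2_eq_iff_nonneg)
    moreover have "norm (e - a) = norm u"
      using rad[OF e(1,2)] rad[OF fV[OF p] nf[OF p]] unfolding u_def by (simp add: power2_eq_iff_nonneg flip: power2_eq_iff_nonneg)
    moreover have "norm (e - a) = \<rho> * norm (f p' - a)" unfolding ea using px(2) by simp
    ultimately have "\<rho> = 1" using u0 by simp
    then show ?thesis using ea px(1) by simp
  qed
  then show ?thesis using d(1) by blast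
qed

end

section \<open>Complex subspaces and the dimension of the tangent span\<close>

lemma range_complex_linear:
  fixes K :: "complex ^ 'a \<Rightarrow> complex ^ 'm"
  assumes K: "\<And>x y. K (x + y) = K x + K y" "\<And>c x. K (c *\<^sub>C x) = c *\<^sub>C K x" "\<And>x. K x = 0 \<Longrightarrow> x = 0"
  shows "vec.subspace (range K)" "vec.dim (range K) = CARD('a)"
proof -
  have lin: "Vector_Spaces.linear (*s) (*s) K"
    by unfold_locales (simp_all add: K(1) K(2)[unfolded scaleC_eq_vector_scalar_mult])
  have inj: "inj K"
  proof (rule injI)
    fix x y assume "K x = K y"
    then have "K (x + (-1) *\<^sub>C y) = 0" unfolding K(1,2) by (simp add: scaleC_minus_left)
    from K(3)[OF this] show "x = y" by (simp add: scaleC_minus_left)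
  qed
  show "vec.subspace (range K)"
    by (rule vec.linear_subspace_image[OF lin vec.subspace_UNIV])
  show "vec.dim (range K) = CARD('a)"
    using vec.dim_image_eq[OF lin, of UNIV] inj vec_dim_card by (metis vec.span_UNIV)
qed

lemma complex_subspaceD:
  fixes V :: "(complex ^ 'm) set"
  assumes V: "vec.subspace V"
  shows "subspace V" "\<And>c v. v \<in> V \<Longrightarrow> c *\<^sub>C v \<in> V"
proof -
  show 1: "c *\<^sub>C v \<in> V" if "v \<in> V" for c v
    unfolding scaleC_eq_vector_scalar_mult by (rule vec.subspace_scale[OF V that])
  have "r *\<^sub>R v \<in> V" if "v \<in> V" for r v
    using 1[OF that, of "of_real r"] by (simp add: scaleC_of_real)
  then show "subspace V"
    by (intro subspaceI vec.subspace_0[OF V] vec.subspace_add[OF V])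
qed

lemma complex_orthogonal_decomposition:
  fixes V :: "(complex ^ 'm) set"
  assumes V: "vec.subspace V"
  obtains a where "\<And>v. v \<in> V \<Longrightarrow> hip v a = 0" "x - a \<in> V"
proof -
  note sub = complex_subspaceD[OF V]
  obtain B where B: "\<And>x v. v \<in> V \<Longrightarrow> B x \<bullet> v = 0" "\<And>x. x - B x \<in> V"
    using orthogonal_projection_exists[OF sub(1)] by metis
  show thesis
  proof (rule that[OF _ B(2)])
    show "hip v (B x) = 0" if "v \<in> V" for v
      unfolding hip_eq_0_commute[of v]
      by (rule hip_eq_0_if_inner_eq_0) (rule B(1)[OF that], rule B(1)[OF sub(2)[OF that]])
  qed
qed

context revolution_map
begin

definition TV where "TV p = {v. \<exists>X c. v = L X f p + c *\<^sub>C G p}"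

text \<open>The radial component, which \<open>L\<close> ignores, serves as the coefficient of
  \<open>G\<close>. In this way the source \<open>C^n x C\<close> maps isomorphically onto
  \<open>TV p\<close>.\<close>

lemma TV_dim: assumes p: "p \<in> W" and lam0: "lam p \<noteq> 0"
  shows "vec.subspace (TV p)" "vec.dim (TV p) = CARD('n) + 1"
proof -
  define K where "K x = L (\<chi> i. x $ Some i, x $ None) f p + herm H (\<chi> i. x $ Some i) (yc p) *\<^sub>C G p" for x :: "complex ^ 'n option"
  have fst_add: "(\<chi> i. (x + y) $ Some i, (x + y) $ None) = (\<chi> i. x $ Some i, x $ None) + (\<chi> i. y $ Some i, y $ None)" for x y :: "complex ^ 'n option"
    by (simp add: vec_eq_iff)
  have s_add: "(\<chi> i. (x + y) $ Some i) = (\<chi> i. x $ Some i) + (\<chi> i. y $ Some i)" for x y :: "complex ^ 'n option"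
    by (simp add: vec_eq_iff)
  have fst_sc: "(\<chi> i. (c *\<^sub>C x) $ Some i, (c *\<^sub>C x) $ None) = c *\<^sub>C (\<chi> i. x $ Some i, x $ None)" for c and x :: "complex ^ 'n option"
    by (simp add: vec_eq_iff scaleC_prod_def)
  have s_sc: "(\<chi> i. (c *\<^sub>C x) $ Some i) = c *\<^sub>C (\<chi> i. x $ Some i)" for c and x :: "complex ^ 'n option"
    by (simp add: vec_eq_iff)
  have add: "K (x + y) = K x + K y" for x y
    unfolding K_def fst_add unfolding s_add L_linear[OF p sm_f] herm_simps scaleC_add_left by simp
  have sc: "K (c *\<^sub>C x) = c *\<^sub>C K x" for c x
    unfolding K_def fst_sc unfolding s_sc L_linear[OF p sm_f] herm_simps scaleC_add_right scaleC_scaleC by simp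
  have K0: "x = 0" if "K x = 0" for x
  proof -
    have "(\<chi> i. x $ Some i) = 0 \<and> x $ None = 0" by (rule tangent_injective[OF p lam0 that[unfolded K_def]])
    then have "x $ i = 0" for i by (cases i) (auto simp: vec_eq_iff)
    then show ?thesis by (simp add: vec_eq_iff)
  qed
  have "TV p = range K"
  proof (intro subset_antisym subsetI)
    fix v assume "v \<in> TV p"
    then obtain a c b where v: "v = L (a, c) f p + b *\<^sub>C G p" unfolding TV_def by auto
    define a' where "a' = (a - al a p *\<^sub>C yc p) + (b * iN p) *\<^sub>C yc p"
    have h: "herm H a' (yc p) = b"
      unfolding a'_def herm_add_left split_radial(2)[OF p] using N_neq_0[OF p] by (simp add: herm_simps iN_def)
    have "(a', c) = (a - al a p *\<^sub>C yc p, c) + (b * iN p) *\<^sub>C (yc p, 0)" by (simp add: a'_def scaleC_prod_def)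
    then have "L (a', c) f p = L (a, c) f p"
      unfolding L_linear[OF p sm_f] hom[OF p] L_tangential(1)[OF p] by (simp add: L_linear[OF p sm_f] hom[OF p] L_tangential(1)[OF p])
    then have "v = K (emb a' c)" unfolding K_def v by (simp add: emb_def h)
    then show "v \<in> range K" by blast
  qed (auto simp: K_def TV_def)
  then show "vec.subspace (TV p)" "vec.dim (TV p) = CARD('n) + 1"
    using range_complex_linear[of K, OF add sc K0] by simp_all
qed

text \<open>One zero-free point of the section propagates to all of it, and by \<open>base\<close>
  to \<open>W\<close>. In the other case the Gram identity kills \<open>L X f\<close>, then
  \<open>Lb_Lf\<close> with \<open>h > 0\<close> kills \<open>G\<close>, so \<open>f\<close> would
  be constant along the section.\<close>

lemma lam_neq_0_or_constant:
  assumes conn: "connected M" and MW: "\<And>m. m \<in> M \<Longrightarrow> (m, 0) \<in> W"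
    and base: "\<And>p. p \<in> W \<Longrightarrow> \<exists>m\<in>M. lam p = lam (m, 0)"
    and nc: "\<not> (\<lambda>m. f (m, 0)) constant_on M" and p: "p \<in> W"
  shows "lam p \<noteq> 0"
proof (cases "\<exists>m\<in>M. lam (m, 0) \<noteq> 0")
  case True
  then obtain m0 where m0: "m0 \<in> M" "lam (m0, 0) \<noteq> 0" by blast
  obtain m where m: "m \<in> M" "lam p = lam (m, 0)" using base[OF p] by blast
  have "lam (m, 0) \<noteq> 0"
    by (rule section_induct[where Q="\<lambda>p. lam p \<noteq> 0", OF conn MW open_W lam_propagates m0(1) m(1) m0(2)])
  then show ?thesis by (simp add: m)
next
  case False
  then have lam0: "lam x = 0" if "x \<in> W" for x using base[OF that] by auto
  have Lf0: "L X f x = 0" if "x \<in> W" for x X using gram[OF that, of X X] lam0[OF that] by simp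
  have G0: "G x = 0" if x: "x \<in> W" for x
  proof -
    have "g dw dw x *\<^sub>C G x = Lb dw (\<lambda>_. 0) x"
      unfolding Lb_Lf[OF x, of dw dw, symmetric] by (rule Lb_cong[OF x Lf0])
    moreover have "g dw dw x \<noteq> 0" using g_eq[OF x, of 0 1 0 1] h_real(2)[OF x] by auto
    ultimately show ?thesis
      using norm_scaleC[of "g dw dw x" "G x"] by simp
  qed
  have T0: "dT f x = 0" if "x \<in> W" for x
    using G0[OF that] norm_scaleC[of \<i> "dT f x"] by (simp add: G_def)
  have d0: "(f has_derivative (\<lambda>_. 0)) (at x)" if x: "x \<in> W" for x
  proof -
    have "frechet_derivative f (at x) r = 0" for r
      by (cases r) (simp only: total_derivative[OF x sm_f] Lf0[OF x] Lb_f[OF x] T0[OF x], simp)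
    then have "frechet_derivative f (at x) = (\<lambda>_. 0)" by (rule ext)
    then show ?thesis using smooth_on_has_derivative[OF sm_f x] by simp
  qed
  have step: "f z = c" if "closed_segment x z \<subseteq> W" "f x = c" for x z c
  proof -
    have "\<exists>c. \<forall>y\<in>closed_segment x z. f y = c"
      by (rule has_derivative_zero_constant[OF convex_closed_segment has_derivative_at_withinI[OF d0]]) (use that(1) in blast)
    then show ?thesis using that(2) by (metis ends_in_segment)
  qed
  have "f (m', 0) = f (m, 0)" if "m \<in> M" "m' \<in> M" for m m'
    by (rule section_induct[where Q="\<lambda>p. f p = f (m, 0)", OF conn MW open_W step that refl])
  then have "(\<lambda>m. f (m, 0)) constant_on M" unfolding constant_on_def by metis
  then show ?thesis using nc by blast
qed

end

lemma sphere_function_tangent: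
  fixes x :: "complex ^ 'm"
  assumes "v \<in> complex_tangent_space sphere_function x"
  shows "x \<bullet> v = 0"
proof -
  have "(sphere_function has_derivative (\<lambda>v. 2 * (x \<bullet> v))) (at x)"
    unfolding sphere_function_def[abs_def] power2_norm_eq_inner
    by (auto intro!: derivative_eq_intros simp: inner_commute)
  from frechet_derivative_at[OF this] have "frechet_derivative sphere_function (at x) = (\<lambda>v. 2 * (x \<bullet> v))" by simp
  then show ?thesis using assms by (simp add: complex_tangent_space_def tangent_space_def)
qed

text \<open>Equality of the spaces \<open>TV (m, 0)\<close> is proved through annihilators: by
  \<open>memI\<close> a complex subspace is recovered from the vectors orthogonal to it, and these
  are transported by \<open>annihilator_propagates\<close>. The base point \<open>a\<close> is the
  part of \<open>F m0\<close> orthogonal to \<open>V\<close>, so the slice of the sphere is a sphere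
  about \<open>a\<close>.\<close>

lemma (in transversal_map) image_totally_geodesic:
  assumes conn: "connected M" and MW: "\<And>m. m \<in> M \<Longrightarrow> (m, 0) \<in> W"
    and F: "\<And>m. m \<in> M \<Longrightarrow> F m = f (m, 0)" and fW: "f ` W \<subseteq> F ` M" and m0: "m0 \<in> M"
  shows "totally_geodesic_in_sphere (CARD('n) + 1) (F ` M)"
proof -
  define V where "V = TV (m0, 0)"
  note V = TV_dim[OF MW[OF m0] lam_nz[OF MW[OF m0]], folded V_def]
  note sub = complex_subspaceD[OF V(1)]
  obtain a where a: "\<And>v. v \<in> V \<Longrightarrow> hip v a = 0" "F m0 - a \<in> V"
    using complex_orthogonal_decomposition[OF V(1)] by blast
  have ann: "(\<forall>v\<in>TV p. hip v e = 0) \<longleftrightarrow> (\<forall>X. hip (L X f p) e = 0) \<and> hip (G p) e = 0" if p: "p \<in> W" for p e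
  proof -
    have 1: "L X f p \<in> TV p" for X unfolding TV_def by (rule CollectI, rule exI[of _ X], rule exI[of _ 0]) simp
    have "L 0 f p = 0" using L_linear(2)[OF p sm_f, of 0 0] by simp
    then have "G p = L 0 f p + 1 *\<^sub>C G p" by simp
    then have 2: "G p \<in> TV p" unfolding TV_def by blast
    show ?thesis
    proof
      show "\<forall>v\<in>TV p. hip v e = 0 \<Longrightarrow> (\<forall>X. hip (L X f p) e = 0) \<and> hip (G p) e = 0" using 1 2 by blast
    qed (auto simp: TV_def hip_simps)
  qed
  have propag: "(\<forall>v\<in>TV (m', 0). hip v e = 0) \<and> hip (f (m', 0)) e = c"
    if "m \<in> M" "m' \<in> M" "\<forall>v\<in>TV (m, 0). hip v e = 0" "hip (f (m, 0)) e = c" for m m' e c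
  proof -
    have "((\<forall>X. hip (L X f (m', 0)) e = 0) \<and> hip (G (m', 0)) e = 0) \<and> hip (f (m', 0)) e = c"
    proof (rule section_induct[where Q="\<lambda>p. ((\<forall>X. hip (L X f p) e = 0) \<and> hip (G p) e = 0) \<and> hip (f p) e = c", OF conn MW open_W _ that(1,2)])
      show "((\<forall>X. hip (L X f z) e = 0) \<and> hip (G z) e = 0) \<and> hip (f z) e = c"
        if s: "closed_segment x z \<subseteq> W" and q: "((\<forall>X. hip (L X f x) e = 0) \<and> hip (G x) e = 0) \<and> hip (f x) e = c" for x z
        using annihilator_propagates[OF s, of e] q by simp
      show "((\<forall>X. hip (L X f (m, 0)) e = 0) \<and> hip (G (m, 0)) e = 0) \<and> hip (f (m, 0)) e = c"
        using that(3,4) ann[OF MW[OF that(1)]] by simp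
    qed
    then show ?thesis using ann[OF MW[OF that(2)]] by simp
  qed
  have memI: "x \<in> V'" if V': "vec.subspace V'" and e: "\<And>e. \<forall>v\<in>V'. hip v e = 0 \<Longrightarrow> hip x e = 0" for x and V' :: "(complex ^ 'm) set"
  proof -
    obtain b where b: "\<And>v. v \<in> V' \<Longrightarrow> hip v b = 0" "x - b \<in> V'" using complex_orthogonal_decomposition[OF V'] by blast
    have "hip x b = 0" using e b(1) by blast
    moreover have "hip x b - hip b b = 0" using b(1)[OF b(2)] by (simp add: hip_simps)
    ultimately have "b = 0" by simp
    then show ?thesis using b(2) by simp
  qed
  have V_eq: "TV (m, 0) = V" if m: "m \<in> M" for m
  proof (intro subset_antisym subsetI)
    fix x assume x: "x \<in> TV (m, 0)"
    show "x \<in> V"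
    proof (rule memI[OF V(1)])
      show "hip x e = 0" if "\<forall>v\<in>V. hip v e = 0" for e
        using propag[OF m0 m that[unfolded V_def] refl] x by blast
    qed
  next
    fix x assume x: "x \<in> V"
    show "x \<in> TV (m, 0)"
    proof (rule memI[OF TV_dim(1)[OF MW[OF m] lam_nz[OF MW[OF m]]]])
      show "hip x e = 0" if "\<forall>v\<in>TV (m, 0). hip v e = 0" for e
        using propag[OF m m0 that refl] x unfolding V_def by blast
    qed
  qed
  have FV: "F m - a \<in> V" if m: "m \<in> M" for m
  proof -
    have "F m - F m0 \<in> V"
    proof (rule memI[OF V(1)])
      show "hip (F m - F m0) e = 0" if "\<forall>v\<in>V. hip v e = 0" for e
        using propag[OF m0 m that[unfolded V_def] refl] by (simp add: F[OF m] F[OF m0] hip_simps)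
    qed
    then have "(F m - F m0) + (F m0 - a) \<in> V" by (rule subspace_add[OF sub(1) _ a(2)])
    then show ?thesis by simp
  qed
  define E where "E = (\<lambda>v. a + v) ` V"
  have E: "x \<in> E \<longleftrightarrow> x - a \<in> V" for x
    unfolding E_def by (auto intro!: image_eqI[of _ _ "x - a"])
  have "complex_affine_subspace E V" using V(1) E_def by (auto simp: complex_affine_subspace_def)
  moreover have "CR_transversal_sphere E V"
    unfolding CR_transversal_sphere_def
  proof (intro ballI notI)
    fix x assume x: "x \<in> E \<inter> sphere 0 1" and s: "V \<subseteq> complex_tangent_space sphere_function x"
    have xa: "x - a \<in> V" using x E by blast
    \<comment> \<open>Without transversality the affine space would touch the sphere at
      \<open>x = a\<close>. Then \<open>a\<close> has norm 1, which forces \<open>F m0 = a\<close>,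
      and \<open>G\<close> orthogonal to \<open>a\<close> means \<open>lam = 0\<close>.\<close>
    have "x \<bullet> (x - a) = 0" using s xa by (blast intro: sphere_function_tangent)
    moreover have "(x - a) \<bullet> a = 0" using a(1)[OF xa] by (simp flip: Re_hip)
    ultimately have "(x - a) \<bullet> (x - a) = 0" by (simp add: inner_diff_left inner_diff_right inner_commute)
    then have "x = a" by simp
    then have na: "norm a = 1" using x by simp
    have "hip (F m0 - a) a = 0" by (rule a(1)[OF a(2)])
    then have "hip (F m0) a = 1" by (simp add: hip_simps hip_self na)
    moreover have "hip (F m0) (F m0) = 1" using f_f[OF MW[OF m0]] by (simp add: F[OF m0])
    moreover have "hip a (F m0) = 1" using calculation(1) cnj_hip[of "F m0" a] by simp
    moreover have "hip a a = 1" by (simp add: hip_self na)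
    ultimately have "hip (F m0 - a) (F m0 - a) = 0" unfolding hip_diff_left hip_diff_right by simp
    then have Fa: "F m0 = a" by simp
    have "\<forall>v\<in>TV (m0, 0). hip v a = 0" using a(1) V_def by blast
    then have "hip (G (m0, 0)) a = 0" using ann[OF MW[OF m0]] by blast
    then have "lam (m0, 0) = 0" unfolding lam_def F[OF m0, symmetric] Fa by simp
    then show False using lam_nz[OF MW[OF m0]] by blast
  qed
  moreover have "openin (top_of_set (E \<inter> sphere 0 1)) (F ` M)"
    unfolding openin_euclidean_subtopology_iff
  proof (intro conjI ballI)
    have "norm (F m) = 1" if "m \<in> M" for m
      using f_f[OF MW[OF that]] norm_ge_zero[of "F m"] unfolding F[OF that, symmetric] hip_self
      by (simp add: power2_eq_1_iff flip: of_real_power)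
    then show "F ` M \<subseteq> E \<inter> sphere 0 1" using E FV by auto
    fix y assume "y \<in> F ` M"
    then obtain m where m: "m \<in> M" "y = F m" by blast
    have fV: "f p - a \<in> V" if p: "p \<in> W" for p
    proof -
      have "f p \<in> F ` M" using fW imageI[OF p, of f] by (rule subsetD)
      then obtain m where m: "m \<in> M" "f p = F m" by (rule imageE)
      show ?thesis unfolding m(2) by (rule FV[OF m(1)])
    qed
    have "\<exists>d>0. \<forall>e. e - a \<in> V \<longrightarrow> norm e = 1 \<longrightarrow> dist (f (m, 0)) e < d \<longrightarrow> e \<in> f ` W"
      by (rule local_image_open[OF MW[OF m(1)] sub(1) V_eq[OF m(1), symmetric, unfolded TV_def] a(1) fV])
    then obtain d where d: "d > 0" "\<forall>e. e - a \<in> V \<longrightarrow> norm e = 1 \<longrightarrow> dist (f (m, 0)) e < d \<longrightarrow> e \<in> f ` W"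
      by (elim exE conjE) (rule that)
    show "\<exists>e>0. \<forall>x'\<in>E \<inter> sphere 0 1. dist x' y < e \<longrightarrow> x' \<in> F ` M"
    proof (intro exI[of _ d] conjI ballI impI d(1))
      fix x' assume "x' \<in> E \<inter> sphere 0 1" "dist x' y < d"
      then have "x' \<in> f ` W" using E F[OF m(1)] m(2) by (intro d(2)[rule_format]) (auto simp: dist_commute)
      then show "x' \<in> F ` M" using fW by blast
    qed
  qed
  ultimately show ?thesis using V(2) unfolding totally_geodesic_in_sphere_def by blast
qed

section \<open>Levi form and curvature of a hypersurface of revolution\<close>

lemma dhol_cderiv: "dhol v u = cderiv (1/2) (- \<i>/2) v (\<i> *\<^sub>C v) u"
  and dbar_cderiv: "dbar v u = cderiv (1/2) (\<i>/2) v (\<i> *\<^sub>C v) u"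
  by (simp_all add: fun_eq_iff cderiv_def dhol_def dbar_def field_simps)

lemma cderiv_ln:
  assumes "smooth_on \<rho> U" "w \<in> U" "\<rho> w > 0"
  shows "of_real (\<rho> w) * cderiv a b r s (\<lambda>u. complex_of_real (ln (\<rho> u))) w = cderiv a b r s (\<lambda>u. of_real (\<rho> u)) w"
proof -
  note d = smooth_on_has_derivative[OF assms(1,2)]
  have "((\<lambda>u. ln (\<rho> u)) has_derivative (\<lambda>v. 1 / \<rho> w * frechet_derivative \<rho> (at w) v)) (at w)"
    using has_derivative_compose[OF d DERIV_ln[OF assms(3), unfolded has_field_derivative_def]]
    by (simp add: divide_inverse)
  then have "((\<lambda>u. complex_of_real (ln (\<rho> u))) has_derivative (\<lambda>v. of_real (1 / \<rho> w * frechet_derivative \<rho> (at w) v))) (at w)"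
    by (rule bounded_linear.has_derivative[OF bounded_linear_of_real])
  then have 1: "frechet_derivative (\<lambda>u. complex_of_real (ln (\<rho> u))) (at w) = (\<lambda>v. of_real (1 / \<rho> w * frechet_derivative \<rho> (at w) v))"
    using frechet_derivative_at by metis
  have 2: "frechet_derivative (\<lambda>u. complex_of_real (\<rho> u)) (at w) = (\<lambda>v. of_real (frechet_derivative \<rho> (at w) v))"
    using frechet_derivative_at[OF bounded_linear.has_derivative[OF bounded_linear_of_real d]] by metis
  show ?thesis using assms(3) unfolding cderiv_def 1 2 by (simp add: algebra_simps)
qed

text \<open>Clearing the denominators avoids the quotient rule: the identity
  \<open>\<rho> * dbar y (ln \<rho>) = dbar y \<rho>\<close> is differentiated once. It is applied
  both to \<open>- q\<close> and to \<open>h\<close>.\<close>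

lemma log_hessian:
  assumes U: "open U" "smooth_on \<rho> U" "w \<in> U" and pos: "\<And>u. u \<in> U \<Longrightarrow> \<rho> u > 0"
  shows "(of_real (\<rho> w))\<^sup>2 * dhol x (dbar y (\<lambda>u. complex_of_real (ln (\<rho> u)))) w =
    of_real (\<rho> w) * dhol x (dbar y (\<lambda>u. of_real (\<rho> u))) w - dhol x (\<lambda>u. of_real (\<rho> u)) w * dbar y (\<lambda>u. of_real (\<rho> u)) w"
proof -
  let ?R = "\<lambda>u. complex_of_real (\<rho> u)" and ?l = "\<lambda>u. complex_of_real (ln (\<rho> u))"
  have sR: "smooth_on ?R U" by (rule smooth_on_bounded_linear[OF bounded_linear_of_real U(1,2)])
  have sl: "smooth_on ?l U" by (rule smooth_on_bounded_linear[OF bounded_linear_of_real U(1) smooth_on_ln[OF U(1,2) pos]])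
  have 1: "?R u * dbar y ?l u = dbar y ?R u" if "u \<in> U" for u
    unfolding dbar_cderiv by (rule cderiv_ln[OF U(2) that pos[OF that]])
  have "dhol x (\<lambda>u. ?R u *\<^sub>C dbar y ?l u) w = dhol x (dbar y ?R) w"
    unfolding dhol_cderiv by (rule cderiv_cong[OF U(1,3)]) (simp add: 1)
  also have "dhol x (\<lambda>u. ?R u *\<^sub>C dbar y ?l u) w = ?R w * dhol x (dbar y ?l) w + dhol x ?R w * dbar y ?l w"
    unfolding dhol_cderiv using cderiv_scaleC[OF sR smooth_on_dbar[OF U(1) sl] U(3)] by simp
  finally have "?R w * (?R w * dhol x (dbar y ?l) w + dhol x ?R w * dbar y ?l w) = ?R w * dhol x (dbar y ?R) w" by simp
  moreover have "?R w * (dhol x ?R w * dbar y ?l w) = dhol x ?R w * dbar y ?R w"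
    unfolding 1[OF U(3), symmetric] by (simp only: mult.left_commute)
  ultimately show ?thesis by (simp add: algebra_simps power2_eq_square)
qed

lemma dhol_bounded_linear_compose:
  fixes k :: "complex \<Rightarrow> complex"
  assumes "smooth_on k U" "snd x \<in> U"
  shows "dhol (a, c) (\<lambda>x. herm H (fst x) b + e * k (snd x)) x = herm H a b + e * (c * dhol 1 k (snd x))"
proof -
  have d: "((\<lambda>x. herm H (fst x) b + e * k (snd x)) has_derivative
      (\<lambda>v. herm H (fst v) b + e * frechet_derivative k (at (snd x)) (snd v))) (at x)"
    by (intro has_derivative_add bounded_linear.has_derivative[OF bounded_linear_mult_right]
        bounded_linear.has_derivative[OF bounded_bilinear.bounded_linear_left[OF bounded_bilinear_herm]]
        has_derivative_compose[OF has_derivative_snd[OF has_derivative_ident] smooth_on_has_derivative[OF assms]]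
        has_derivative_fst[OF has_derivative_ident])
  have fd: "frechet_derivative (\<lambda>x. herm H (fst x) b + e * k (snd x)) (at x) =
      (\<lambda>v. herm H (fst v) b + e * frechet_derivative k (at (snd x)) (snd v))"
    using frechet_derivative_at[OF d] by simp
  have "dhol (a, c) (\<lambda>x. herm H (fst x) b + e * k (snd x)) x = herm H a b
    + e * (frechet_derivative k (at (snd x)) c - \<i> * frechet_derivative k (at (snd x)) (\<i> * c)) / 2"
    unfolding dhol_def fd by (simp add: scaleC_prod_def herm_simps algebra_simps add_divide_distrib diff_divide_distrib)
  also have "\<dots> = herm H a b + e * (c * dhol 1 k (snd x))"
    unfolding linear_complex_wirtinger(1)[OF has_derivative_linear[OF smooth_on_has_derivative[OF assms]]]
    by (simp add: dhol_def)
  finally show ?thesis .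
qed

lemma revolution_has_derivative:
  assumes posH: "positive_definite_hermitian H" and q: "smooth_on q UNIV"
  shows "(revolution_function H q has_derivative
    (\<lambda>v. 2 * Re (herm H (fst v) (fst x)) + frechet_derivative q (at (snd x)) (snd v))) (at x)"
proof -
  have d: "((\<lambda>x. Re (herm H (fst x) (fst x)) + q (snd x)) has_derivative
      (\<lambda>v. Re (herm H (fst x) (fst v) + herm H (fst v) (fst x)) + frechet_derivative q (at (snd x)) (snd v))) (at x)"
    by (intro has_derivative_add bounded_linear.has_derivative[OF bounded_linear_Re]
        bounded_bilinear.FDERIV[OF bounded_bilinear_herm]
        has_derivative_compose[OF has_derivative_snd[OF has_derivative_ident] smooth_on_has_derivative[OF q UNIV_I]]
        has_derivative_fst[OF has_derivative_ident])
  have e: "Re (herm H (fst x) (fst v) + herm H (fst v) (fst x)) = 2 * Re (herm H (fst v) (fst x))" for v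
    using arg_cong[OF cnj_herm[OF posH, of "fst v" "fst x"], of Re] by simp
  show ?thesis
    unfolding revolution_function_def hermitian_form_eq case_prod_beta' by (rule d[unfolded e])
qed

text \<open>Membership of \<open>v\<close> in i times the tangent space is tangency of
  \<open>- (\<i> *\<^sub>C v)\<close>; linearity of the derivative allows the other sign.\<close>

lemma complex_tangent_spaceI:
  assumes "frechet_derivative r (at x) v = 0" "frechet_derivative r (at x) (\<i> *\<^sub>C v) = 0"
    and "r differentiable (at x)"
  shows "v \<in> complex_tangent_space r x"
proof -
  have "linear (frechet_derivative r (at x))" using assms(3) frechet_derivative_works has_derivative_linear by blast
  then have "- (\<i> *\<^sub>C v) \<in> tangent_space r x" using assms(2) by (simp add: tangent_space_def linear_neg)
  moreover have "v = \<i> *\<^sub>C (- (\<i> *\<^sub>C v))" by (simp add: scaleC_minus_right scaleC_scaleC scaleC_minus_left)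
  ultimately show ?thesis using assms(1) unfolding complex_tangent_space_def
    by (intro IntI image_eqI[of _ _ "- (\<i> *\<^sub>C v)"]) (auto simp: tangent_space_def)
qed

lemma levi_form_revolution:
  assumes posH: "positive_definite_hermitian H" and q: "smooth_on q UNIV"
  shows "levi_form (revolution_function H q) x (a, c) =
    herm H a a + cnj c * (c * dhol 1 (dbar 1 (\<lambda>u. of_real (q u))) (snd x))"
proof -
  let ?r = "\<lambda>y. complex_of_real (revolution_function H q y)"
  let ?qC = "\<lambda>u. complex_of_real (q u)"
  have qC: "smooth_on ?qC UNIV" by (rule smooth_on_bounded_linear[OF bounded_linear_of_real open_UNIV q])
  have "dbar (a, c) ?r y = herm H (fst y) a + cnj c * dbar 1 ?qC (snd y)" for y
  proof -
    have fr: "frechet_derivative ?r (at y) = (\<lambda>v. of_real (2 * Re (herm H (fst v) (fst y)) + frechet_derivative q (at (snd y)) (snd v)))"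
      by (rule frechet_derivative_at[OF bounded_linear.has_derivative[OF bounded_linear_of_real revolution_has_derivative[OF posH q]], symmetric])
    have fq: "frechet_derivative ?qC (at (snd y)) v = of_real (frechet_derivative q (at (snd y)) v)" for v
      by (rule frechet_derivative_bounded_linear[OF bounded_linear_of_real q UNIV_I])
    note lin = has_derivative_linear[OF smooth_on_has_derivative[OF qC UNIV_I, of "snd y"]]
    have h: "of_real (2 * Re (herm H b (fst y))) = herm H b (fst y) + herm H (fst y) b" for b
      using cnj_herm[OF posH, of b "fst y", symmetric] by (simp add: complex_eq_iff)
    have "dbar (a, c) ?r y = ((herm H a (fst y) + herm H (fst y) a) + \<i> * (herm H (\<i> *\<^sub>C a) (fst y) + herm H (fst y) (\<i> *\<^sub>C a))) / 2
      + (frechet_derivative ?qC (at (snd y)) c + \<i> * frechet_derivative ?qC (at (snd y)) (\<i> * c)) / 2"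
      unfolding dbar_def fr of_real_add h fq by (simp add: scaleC_prod_def add_divide_distrib algebra_simps)
    also have "\<dots> = herm H (fst y) a + cnj c * dbar 1 ?qC (snd y)"
      unfolding linear_complex_wirtinger(2)[OF lin] by (simp add: dbar_def herm_simps algebra_simps)
    finally show ?thesis .
  qed
  then have "dbar (a, c) ?r = (\<lambda>y. herm H (fst y) a + cnj c * dbar 1 ?qC (snd y))" by (rule ext)
  then show ?thesis
    unfolding levi_form_def
    using dhol_bounded_linear_compose[OF smooth_on_dbar[OF open_UNIV qC, of 1] UNIV_I, of a c H a "cnj c" x] by simp
qed

lemma strongly_pseudoconvex_imp_density_pos:
  assumes posH: "positive_definite_hermitian H" and q: "smooth_on q UNIV"
    and U: "open U" "\<And>u. u \<in> U \<Longrightarrow> q u < 0" and w: "w \<in> U"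
    and z: "Re (herm H z z) + q w = 0"
    and spc: "strongly_pseudoconvex_at (revolution_function H q) (z, w)"
  shows "Re (dhol 1 (dbar 1 (\<lambda>u. of_real (- ln (- q u)))) w) > 0"
proof -
  define Q where "Q = - q w"
  have Q: "Q > 0" using U(2)[OF w] by (simp add: Q_def)
  let ?D = "frechet_derivative q (at w)"
  let ?qC = "\<lambda>u. complex_of_real (q u)"
  have qC: "smooth_on ?qC UNIV" by (rule smooth_on_bounded_linear[OF bounded_linear_of_real open_UNIV q])
  have fq: "frechet_derivative ?qC (at w) v = of_real (?D v)" for v
    by (rule frechet_derivative_bounded_linear[OF bounded_linear_of_real q UNIV_I])
  define qw where "qw = dhol 1 ?qC w"
  have qw: "qw = Complex (?D 1 / 2) (- ?D \<i> / 2)" "dbar 1 ?qC w = cnj qw"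
    unfolding qw_def dhol_def dbar_def fq by (simp_all add: complex_eq_iff)
  have "Re (herm H z z) = Q" using z by (simp add: Q_def)
  then have hz: "herm H z z = of_real Q" using herm_self_real[OF posH, of z] by (simp only:)
  \<comment> \<open>The complex tangent vector with \<open>w\<close> component 1 whose first
    component is a multiple of \<open>z\<close>. Its Levi form is \<open>|q_w|^2 / Q\<close> plus
    the mixed second derivative of \<open>q\<close>, which is \<open>Q\<close> times the density
    \<open>h\<close>.\<close>
  define v where "v = ((- qw / of_real Q) *\<^sub>C z, 1 :: complex)"
  have fr: "frechet_derivative (revolution_function H q) (at (z, w)) = (\<lambda>v. 2 * Re (herm H (fst v) z) + ?D (snd v))"
    using frechet_derivative_at[OF revolution_has_derivative[OF posH q, of "(z, w)"]] by simp
  have "v \<in> complex_tangent_space (revolution_function H q) (z, w)"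
  proof (rule complex_tangent_spaceI)
    show "revolution_function H q differentiable at (z, w)"
      using revolution_has_derivative[OF posH q] differentiable_def by blast
  qed (use Q in \<open>simp_all add: fr v_def herm_simps hz qw scaleC_prod_def Re_divide Im_divide power2_eq_square\<close>)
  moreover have "v \<noteq> 0" by (simp add: v_def zero_prod_def)
  ultimately have "Re (levi_form (revolution_function H q) (z, w) v) > 0"
    using spc unfolding strongly_pseudoconvex_at_def by blast
  then have levi: "(cmod qw)\<^sup>2 / Q + Re (dhol 1 (dbar 1 ?qC) w) > 0"
  proof -
    have "herm H ((- qw / of_real Q) *\<^sub>C z) ((- qw / of_real Q) *\<^sub>C z) = of_real ((cmod qw)\<^sup>2 / Q)"
      unfolding of_real_divide complex_norm_square using Q by (simp add: herm_simps hz)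
    then show ?thesis
      using \<open>Re (levi_form _ _ v) > 0\<close> unfolding v_def levi_form_revolution[OF posH q] by simp
  qed
  have neg: "cderiv a b r s (\<lambda>u. - k u) w = - cderiv a b r s k w" if "smooth_on k U" for a b r s and k :: "complex \<Rightarrow> complex"
    using cderiv_const_scaleC[OF that w, where c="-1"] by simp
  have qU: "smooth_on ?qC U" "smooth_on (\<lambda>u. - q u) U"
    using smooth_on_subset[OF qC] smooth_on_minus[OF U(1) smooth_on_subset[OF q]] by auto
  have pos: "- q u > 0" if "u \<in> U" for u using U(2)[OF that] by simp
  have sl: "smooth_on (\<lambda>u. complex_of_real (ln (- q u))) U"
    by (rule smooth_on_bounded_linear[OF bounded_linear_of_real U(1) smooth_on_ln[OF U(1) qU(2) pos]])
  have n1: "dbar 1 (\<lambda>u. complex_of_real (- q u)) u = - dbar 1 ?qC u" if "u \<in> U" for u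
    unfolding dbar_cderiv using cderiv_const_scaleC[OF qU(1) that, where c="-1"] by simp
  have n2: "dhol 1 (\<lambda>u. complex_of_real (- q u)) w = - qw"
    unfolding dhol_cderiv qw_def using neg[OF qU(1)] by simp
  have n3: "dhol 1 (dbar 1 (\<lambda>u. complex_of_real (- q u))) w = - dhol 1 (dbar 1 ?qC) w"
    using cderiv_cong[OF U(1) w n1] neg[OF smooth_on_dbar[OF U(1) qU(1)]] unfolding dhol_cderiv by simp
  have n4: "dbar 1 (\<lambda>u. complex_of_real (- ln (- q u))) u = - dbar 1 (\<lambda>u. complex_of_real (ln (- q u))) u" if "u \<in> U" for u
    unfolding dbar_cderiv using cderiv_const_scaleC[OF sl that, where c="-1"] by simp
  have n5: "dhol 1 (dbar 1 (\<lambda>u. complex_of_real (- ln (- q u)))) w = - dhol 1 (dbar 1 (\<lambda>u. complex_of_real (ln (- q u)))) w"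
    using cderiv_cong[OF U(1) w n4] neg[OF smooth_on_dbar[OF U(1) sl]] unfolding dhol_cderiv by simp
  have "(complex_of_real Q)\<^sup>2 * dhol 1 (dbar 1 (\<lambda>u. complex_of_real (- ln (- q u)))) w
      = of_real Q * dhol 1 (dbar 1 ?qC) w + qw * cnj qw"
    using log_hessian[OF U(1) qU(2) w pos, of 1 1]
    unfolding n5 n3 n2 n1[OF w] qw(2) by (simp add: Q_def algebra_simps)
  then have "complex_of_real (Q * Q) * dhol 1 (dbar 1 (\<lambda>u. complex_of_real (- ln (- q u)))) w
      = of_real Q * dhol 1 (dbar 1 ?qC) w + of_real ((cmod qw)\<^sup>2)"
    unfolding complex_norm_square by (simp add: power2_eq_square)
  from arg_cong[OF this, of Re]
  have "Q * Q * Re (dhol 1 (dbar 1 (\<lambda>u. complex_of_real (- ln (- q u)))) w)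
      = Q * Re (dhol 1 (dbar 1 ?qC) w) + (cmod qw)\<^sup>2"
    by (simp del: of_real_mult of_real_power)
  also have "\<dots> = Q * ((cmod qw)\<^sup>2 / Q + Re (dhol 1 (dbar 1 ?qC) w))" using Q by (simp add: field_simps)
  also have "\<dots> > 0" using Q levi by simp
  finally show ?thesis using Q by (simp add: zero_less_mult_iff)
qed

lemma (in revolution_chart) gauss_curvature_eq:
  assumes psi: "\<And>w. w \<in> U \<Longrightarrow> \<psi> w = - ln \<bar>q w\<bar>"
    and hU: "\<And>w. w \<in> U \<Longrightarrow> h w = of_real (Re (h w))" and w: "w \<in> U"
  shows "gauss_curvature (metric_density q) w = - (Re (h w * hwb w - hw w * hb w) / Re (h w) ^ 3)"
proof -
  have pos: "Re (h u) > 0" if "u \<in> U" for u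
    using h_pos[OF that] by (simp add: h_def psib_def)
  have neg: "cderiv a b r s (\<lambda>u. - k u) u = - cderiv a b r s k u" if "smooth_on k U" "u \<in> U" for a b r s u and k :: "complex \<Rightarrow> complex"
    using cderiv_const_scaleC[OF that, where c="-1"] by simp
  let ?l = "\<lambda>u. complex_of_real (ln \<bar>q u\<bar>)"
  have sl: "smooth_on ?l U"
  proof (rule smooth_on_cong[OF open_U])
    show "smooth_on (\<lambda>u. - complex_of_real (\<psi> u)) U" by (rule smooth_on_minus[OF open_U smooth_psi_C])
  qed (simp add: psi)
  have md: "metric_density q u = Re (h u)" if u: "u \<in> U" for u
  proof -
    have 1: "psib v = - dbar 1 ?l v" if v: "v \<in> U" for v
    proof -
      have "psib v = cderiv (1/2) (\<i>/2) 1 (\<i> *\<^sub>C 1) (\<lambda>u. - ?l u) v"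
        unfolding psib_def dbar_cderiv by (rule cderiv_cong[OF open_U v]) (simp add: psi)
      then show ?thesis unfolding dbar_cderiv neg[OF sl v] .
    qed
    have "h u = dhol 1 (\<lambda>v. - dbar 1 ?l v) u"
      unfolding h_def dhol_cderiv by (rule cderiv_cong[OF open_U u 1])
    also have "\<dots> = - dhol 1 (dbar 1 ?l) u"
      unfolding dhol_cderiv by (rule neg[OF smooth_on_dbar[OF open_U sl] u])
    finally show ?thesis by (simp add: metric_density_def)
  qed
  define \<rho> where "\<rho> u = Re (h u)" for u
  have sr: "smooth_on \<rho> U" unfolding \<rho>_def by (rule smooth_on_bounded_linear[OF bounded_linear_Re open_U smooth_h(2)])
  have rp: "\<rho> u > 0" if "u \<in> U" for u using pos[OF that] by (simp add: \<rho>_def)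
  have rh: "complex_of_real (\<rho> u) = h u" if "u \<in> U" for u using hU[OF that] by (simp add: \<rho>_def)
  have b: "dbar 1 (\<lambda>u. complex_of_real (\<rho> u)) u = hb u" if "u \<in> U" for u
    unfolding hb_def dbar_cderiv by (rule cderiv_cong[OF open_U that rh])
  have "dhol 1 (dbar 1 (\<lambda>u. complex_of_real (\<rho> u))) w = dhol 1 hb w"
    unfolding dhol_cderiv by (rule cderiv_cong[OF open_U w b])
  also have "\<dots> = hwb w"
    unfolding hb_def hwb_def hw_def dhol_cderiv dbar_cderiv by (rule cderiv_commute[OF open_U smooth_h(2) w])
  finally have hess: "dhol 1 (dbar 1 (\<lambda>u. complex_of_real (\<rho> u))) w = hwb w" .
  have hol: "dhol 1 (\<lambda>u. complex_of_real (\<rho> u)) w = hw w"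
    unfolding hw_def dhol_cderiv by (rule cderiv_cong[OF open_U w rh])
  have "dbar 1 (\<lambda>u. complex_of_real (ln (metric_density q u))) u = dbar 1 (\<lambda>u. complex_of_real (ln (\<rho> u))) u" if "u \<in> U" for u
    unfolding dbar_cderiv by (rule cderiv_cong[OF open_U that]) (simp add: md \<rho>_def)
  then have "dhol 1 (dbar 1 (\<lambda>u. complex_of_real (ln (metric_density q u)))) w = dhol 1 (dbar 1 (\<lambda>u. complex_of_real (ln (\<rho> u)))) w" (is "?K = ?X")
    unfolding dhol_cderiv[of 1 "dbar _ _"] by (rule cderiv_cong[OF open_U w])
  moreover have "complex_of_real (\<rho> w * \<rho> w) * ?X = h w * hwb w - hw w * hb w"
    using log_hessian[OF open_U sr w rp, of 1 1] unfolding hess hol b[OF w] rh[OF w, symmetric]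
    by (simp add: power2_eq_square)
  then have "\<rho> w * \<rho> w * Re ?X = Re (h w * hwb w - hw w * hb w)"
    using arg_cong[of _ _ Re] by (metis Re_complex_of_real mult_cancel_left2 Re_divide_of_real Im_complex_of_real
      diff_zero mult_zero_left times_complex.sel(1))
  ultimately show ?thesis
    unfolding gauss_curvature_def md[OF w] using rp[OF w]
    by (simp add: \<rho>_def[symmetric] field_simps power3_eq_cube)
qed

section \<open>The normalized circle bundle over a hypersurface of revolution\<close>

locale revolution_setting =
  fixes H :: "complex ^ 'n ^ 'n" and q :: "complex \<Rightarrow> real" and U :: "complex set"
    and M0 :: "((complex ^ 'n) \<times> complex) set" and F :: "(complex ^ 'n) \<times> complex \<Rightarrow> complex ^ 'm"
  assumes posH: "positive_definite_hermitian H" and smooth_q: "smooth_on q UNIV"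
    and open_U: "open U" and q_neg: "\<And>w. w \<in> U \<Longrightarrow> q w < 0"
    and openin_M0: "openin (top_of_set (revolution_hypersurface H q)) M0" and snd_M0: "snd ` M0 = U"
    and CR: "smooth_CR_map (revolution_function H q) M0 sphere_function F"
begin

definition psi where "psi w = - ln (- q w)"

abbreviation Pot where "Pot \<equiv> revolution_potential H psi"

text \<open>The modulus rescales an arbitrary nonzero \<open>y\<close> to the length that
  \<open>q w\<close> prescribes on the hypersurface; the phase is the circle coordinate.\<close>

definition E where "E p = exp (\<i> * of_real (snd p) - of_real (Pot (fst p)) / 2)"

definition Phi where "Phi p = (E p *\<^sub>C fst (fst p), snd (fst p))"

definition f where "f p = F (Phi p)"

definition W0 :: "(((complex ^ 'n) \<times> complex) \<times> real) set" where "W0 = {p. fst (fst p) \<noteq> 0 \<and> snd (fst p) \<in> U}"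

definition W where "W = {p \<in> W0. Phi p \<in> M0}"

lemma open_W0: "open W0"
proof -
  have "W0 = ((\<lambda>p. fst (fst p)) -` (- {0})) \<inter> ((\<lambda>p. snd (fst p)) -` U)" by (auto simp: W0_def)
  then show ?thesis using open_U by (auto intro!: open_Int open_vimage continuous_intros)
qed

lemma smooth_psi: "smooth_on psi U"
  unfolding psi_def[abs_def]
  by (intro smooth_on_minus smooth_on_ln open_U smooth_on_subset[OF smooth_q]) (use q_neg in auto)

lemma sm_coord:
  "smooth_on (\<lambda>p :: ((complex ^ 'n) \<times> complex) \<times> real. fst (fst p)) W0"
  "smooth_on (\<lambda>p :: ((complex ^ 'n) \<times> complex) \<times> real. snd (fst p)) W0"
  "smooth_on (\<lambda>p :: ((complex ^ 'n) \<times> complex) \<times> real. snd p) W0"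
  by (rule smooth_on_bounded_linear[OF _ open_W0 smooth_on_ident[OF open_W0]],
      simp add: bounded_linear_compose[OF bounded_linear_fst bounded_linear_fst, unfolded o_def]
        bounded_linear_compose[OF bounded_linear_snd bounded_linear_fst, unfolded o_def] bounded_linear_snd)+

lemma smooth_Pot: "smooth_on (\<lambda>p. Pot (fst p)) W0"
  unfolding revolution_potential_def
proof (intro smooth_on_add open_W0 smooth_on_ln)
  show "smooth_on (\<lambda>x. Re (herm H (fst (fst x)) (fst (fst x)))) W0"
    by (rule smooth_on_bounded_linear[OF bounded_linear_Re open_W0
          smooth_on_bilinear[OF bounded_bilinear_herm open_W0 sm_coord(1) sm_coord(1)]])
  show "0 < Re (herm H (fst (fst x)) (fst (fst x)))" if "x \<in> W0" for x
    using that Re_herm_pos[OF posH] by (simp add: W0_def)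
  show "smooth_on (\<lambda>x. psi (snd (fst x))) W0"
    by (rule smooth_on_compose[OF open_W0 open_U _ sm_coord(2) smooth_psi]) (auto simp: W0_def)
qed

lemma smooth_E: "smooth_on E W0"
  unfolding E_def[abs_def]
  by (intro smooth_on_exp smooth_on_diff smooth_on_mult smooth_on_divide smooth_on_const open_W0
      smooth_on_bounded_linear[OF bounded_linear_of_real] sm_coord(3) smooth_Pot) simp_all

lemma smooth_Phi: "smooth_on Phi W0"
proof -
  have 1: "bounded_linear (\<lambda>a. (a, 0 :: complex))" for a :: "complex ^ 'n"
    by (intro bounded_linear_Pair bounded_linear_ident bounded_linear_zero)
  have 2: "bounded_linear (\<lambda>b. (0 :: complex ^ 'n, b))"
    by (intro bounded_linear_Pair bounded_linear_ident bounded_linear_zero)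
  have "smooth_on (\<lambda>p. (E p *\<^sub>C fst (fst p), 0) + (0, snd (fst p))) W0"
    by (rule smooth_on_add[OF open_W0
      smooth_on_bounded_linear[OF 1 open_W0 smooth_on_bilinear[OF bounded_bilinear_scaleC open_W0 smooth_E sm_coord(1)]]
      smooth_on_bounded_linear[OF 2 open_W0 sm_coord(2)]])
  then show ?thesis by (simp add: Phi_def[abs_def])
qed

lemma norm_E: "cmod (E p) = exp (- Pot (fst p) / 2)"
  by (simp add: E_def norm_exp_eq_Re)

lemma Phi_herm: assumes "p \<in> W0"
  shows "Re (herm H (fst (Phi p)) (fst (Phi p))) = - q (snd (fst p))"
proof -
  let ?y = "fst (fst p)"
  have pos: "Re (herm H ?y ?y) > 0" and qn: "- q (snd (fst p)) > 0"
    using assms Re_herm_pos[OF posH] q_neg by (auto simp: W0_def)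
  have "herm H (fst (Phi p)) (fst (Phi p)) = of_real ((cmod (E p))\<^sup>2) * herm H ?y ?y"
    unfolding Phi_def complex_norm_square by (simp add: herm_simps)
  then have "Re (herm H (fst (Phi p)) (fst (Phi p))) = (cmod (E p))\<^sup>2 * Re (herm H ?y ?y)"
    by (simp del: of_real_power)
  also have "(cmod (E p))\<^sup>2 = exp (- Pot (fst p))"
    unfolding norm_E by (simp add: power2_eq_square flip: exp_add)
  also have "\<dots> = (- q (snd (fst p))) / Re (herm H ?y ?y)"
    unfolding revolution_potential_def psi_def using pos qn by (simp add: exp_diff exp_minus ln_div field_simps)
  finally show ?thesis using pos by simp
qed

lemma Pot_Phi: assumes "p \<in> W0" shows "Pot (Phi p) = 0"
  unfolding revolution_potential_def Phi_herm[OF assms] by (simp add: psi_def Phi_def)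

text \<open>The potential vanishes at \<open>Phi p\<close>, so restarting there only adds a rotation
  by \<open>t\<close>.\<close>

lemma Phi_flow: assumes "p \<in> W0" shows "Phi (fst p, snd p + t) = Phi (Phi p, t)"
proof -
  have "E (fst p, snd p + t) = E (Phi p, t) * E p"
    unfolding E_def fst_conv snd_conv Pot_Phi[OF assms] by (simp add: algebra_simps flip: exp_add)
  then show ?thesis by (simp add: Phi_def scaleC_scaleC)
qed

text \<open>Because the potential vanishes on the hypersurface, \<open>M0\<close> sits in the bundle
  as the section at parameter 0, on which \<open>Phi\<close> is the identity.\<close>

lemma M0_W: assumes "m \<in> M0" shows "(m, 0) \<in> W" "Phi (m, 0) = m"
proof -
  have U: "snd m \<in> U" using snd_M0 assms by auto
  have "m \<in> revolution_hypersurface H q" using openin_imp_subset[OF openin_M0] assms by blast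
  then have r: "Re (herm H (fst m) (fst m)) = - q (snd m)"
    by (simp add: revolution_hypersurface_def revolution_function_def hermitian_form_eq case_prod_beta')
  then have y: "fst m \<noteq> 0" using q_neg[OF U] by auto
  have "Pot m = 0" unfolding revolution_potential_def r by (simp add: psi_def)
  then show P: "Phi (m, 0) = m" by (simp add: Phi_def E_def)
  show "(m, 0) \<in> W" using U y assms by (simp add: W_def W0_def P)
qed

lemma open_W: "open W"
proof -
  obtain S where S: "open S" "M0 = revolution_hypersurface H q \<inter> S" using openin_M0 openin_open by blast
  have "Phi p \<in> revolution_hypersurface H q" if "p \<in> W0" for p
    using Phi_herm[OF that]
    by (simp add: revolution_hypersurface_def revolution_function_def hermitian_form_eq case_prod_beta') (simp add: Phi_def)
  then have "Phi p \<in> M0 \<longleftrightarrow> Phi p \<in> S" if "p \<in> W0" for p using S(2) that by blast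
  then have "W = W0 \<inter> Phi -` S" unfolding W_def by blast
  then show ?thesis using continuous_open_preimage[OF smooth_on_imp_continuous_on[OF smooth_Phi] open_W0 S(1)] by simp
qed

lemma W_sub: "W \<subseteq> W0" by (auto simp: W_def)

lemma smooth_f: "smooth_on f W"
proof (rule smooth_on_local[OF open_W])
  fix p assume p: "p \<in> W"
  then have pM: "Phi p \<in> M0" by (simp add: W_def)
  have "smooth_on_subset F M0" using CR by (simp add: smooth_CR_map_def)
  from bspec[OF this[unfolded smooth_on_subset_def] pM] obtain V G where V: "open V" "Phi p \<in> V" "smooth_on G V" "\<And>y. y \<in> V \<inter> M0 \<Longrightarrow> G y = F y"
    apply (elim exE conjE) apply (rule that) apply assumption+ apply blast done
  have sP: "smooth_on Phi W" by (rule smooth_on_subset[OF smooth_Phi W_sub])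
  let ?N = "W \<inter> Phi -` V"
  have oN: "open ?N" by (rule continuous_open_preimage[OF smooth_on_imp_continuous_on[OF sP] open_W V(1)])
  have "smooth_on (\<lambda>p. G (Phi p)) ?N"
    by (rule smooth_on_compose[OF oN V(1) _ smooth_on_subset[OF sP] V(3)]) auto
  then have "smooth_on f ?N"
    by (rule smooth_on_cong[OF oN, rotated]) (use V(4) in \<open>auto simp: f_def W_def\<close>)
  then show "\<exists>V. open V \<and> p \<in> V \<and> smooth_on f V" using oN p V(2) by blast
qed

section \<open>The derivative of the parametrization and the CR condition\<close>

lemma Pot_derivative: assumes "p \<in> W0"
  shows "(Pot has_derivative (\<lambda>v. 2 * Re (herm H (fst v) (fst (fst p))) / Re (herm H (fst (fst p)) (fst (fst p)))
    + frechet_derivative psi (at (snd (fst p))) (snd v))) (at (fst p))"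
proof -
  let ?x = "fst p"
  have y: "fst ?x \<noteq> 0" and w: "snd ?x \<in> U" using assms by (auto simp: W0_def)
  have d: "((\<lambda>x. Re (herm H (fst x) (fst x))) has_derivative
      (\<lambda>v. Re (herm H (fst ?x) (fst v) + herm H (fst v) (fst ?x)))) (at ?x)"
    by (intro bounded_linear.has_derivative[OF bounded_linear_Re] bounded_bilinear.FDERIV[OF bounded_bilinear_herm]
        has_derivative_fst[OF has_derivative_ident])
  have e: "Re (herm H (fst ?x) v + herm H v (fst ?x)) = 2 * Re (herm H v (fst ?x))" for v
    using arg_cong[OF cnj_herm[OF posH, of v "fst ?x"], of Re] by simp
  have "((\<lambda>x. ln (Re (herm H (fst x) (fst x)))) has_derivative
      (\<lambda>v. 2 * Re (herm H (fst v) (fst ?x)) / Re (herm H (fst ?x) (fst ?x)))) (at ?x)"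
    using has_derivative_compose[OF d[unfolded e] DERIV_ln[OF Re_herm_pos[OF posH y], unfolded has_field_derivative_def]]
    by (simp add: divide_inverse mult_ac)
  moreover have "((\<lambda>x. psi (snd x)) has_derivative (\<lambda>v. frechet_derivative psi (at (snd ?x)) (snd v))) (at ?x)"
    by (rule has_derivative_compose[OF has_derivative_snd[OF has_derivative_ident] smooth_on_has_derivative[OF smooth_psi w]])
  ultimately show ?thesis unfolding revolution_potential_def by (rule has_derivative_add)
qed

lemma Phi_derivative: assumes P: "(Pot has_derivative D) (at (fst p))"
  shows "(Phi has_derivative (\<lambda>r. (E p *\<^sub>C fst (fst r) + (E p * (\<i> * of_real (snd r) - of_real (D (fst r)) / 2)) *\<^sub>C fst (fst p), snd (fst r)))) (at p)"
proof -
  have fst': "((\<lambda>p. fst (fst p)) has_derivative (\<lambda>r. fst (fst r))) (at p)" "((\<lambda>p. snd (fst p)) has_derivative (\<lambda>r. snd (fst r))) (at p)"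
     "((\<lambda>p. snd p) has_derivative (\<lambda>r. snd r)) (at p)"
    by (intro has_derivative_fst has_derivative_snd has_derivative_ident)+
  have "((\<lambda>p. Pot (fst p)) has_derivative (\<lambda>r. D (fst r))) (at p)"
    by (rule has_derivative_compose[OF has_derivative_fst[OF has_derivative_ident] P])
  then have "((\<lambda>p. complex_of_real (Pot (fst p)) * (1/2)) has_derivative (\<lambda>r. of_real (D (fst r)) * (1/2))) (at p)"
    by (intro bounded_linear.has_derivative[OF bounded_linear_mult_left] bounded_linear.has_derivative[OF bounded_linear_of_real])
  from has_derivative_diff[OF bounded_linear.has_derivative[OF bounded_linear_mult_right
        bounded_linear.has_derivative[OF bounded_linear_of_real fst'(3)], of \<i>] this]
  have "((\<lambda>p. \<i> * of_real (snd p) - of_real (Pot (fst p)) / 2) has_derivative (\<lambda>r. \<i> * of_real (snd r) - of_real (D (fst r)) / 2)) (at p)"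
    by simp
  from has_derivative_compose[OF this DERIV_exp[unfolded has_field_derivative_def]]
  have "(E has_derivative (\<lambda>r. E p * (\<i> * of_real (snd r) - of_real (D (fst r)) / 2))) (at p)"
    unfolding E_def[abs_def] by simp
  from has_derivative_Pair[OF bounded_bilinear.FDERIV[OF bounded_bilinear_scaleC this fst'(1)] fst'(2)]
  show ?thesis unfolding Phi_def[abs_def] .
qed

text \<open>The derivative \<open>D'\<close> of \<open>F\<close> exists within \<open>M0\<close>
  only and is complex linear only on complex tangent vectors. A vector \<open>u\<close> qualifies
  once both \<open>u\<close> and \<open>\<i> *\<^sub>C u\<close> are images under the derivative of
  \<open>Phi\<close>, which is why that derivative is spelled out for two arguments \<open>s\<close>
  and \<open>t\<close>.\<close>

lemma f_derivative: assumes p: "p \<in> W"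
  shows "\<exists>D D'. (Pot has_derivative D) (at (fst p)) \<and> linear D'
    \<and> frechet_derivative f (at p) = (\<lambda>r. D' (E p *\<^sub>C fst (fst r) + (E p * (\<i> * of_real (snd r) - of_real (D (fst r)) / 2)) *\<^sub>C fst (fst p), snd (fst r)))
    \<and> D (fst (fst p), 0) = 2 \<and> D (\<i> *\<^sub>C fst (fst p), 0) = 0
    \<and> (\<forall>u v s t. v = \<i> *\<^sub>C u \<longrightarrow>
        u = (E p *\<^sub>C fst (fst s) + (E p * (\<i> * of_real (snd s) - of_real (D (fst s)) / 2)) *\<^sub>C fst (fst p), snd (fst s)) \<longrightarrow>
        v = (E p *\<^sub>C fst (fst t) + (E p * (\<i> * of_real (snd t) - of_real (D (fst t)) / 2)) *\<^sub>C fst (fst p), snd (fst t)) \<longrightarrow>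
        D' v = \<i> *\<^sub>C D' u)"
proof -
  have pW0: "p \<in> W0" and PM: "Phi p \<in> M0" using p by (auto simp: W_def)
  have pos: "Re (herm H (fst (fst p)) (fst (fst p))) > 0"
    using pW0 Re_herm_pos[OF posH] by (simp add: W0_def)
  obtain D where D: "(Pot has_derivative D) (at (fst p))"
    "D = (\<lambda>v. 2 * Re (herm H (fst v) (fst (fst p))) / Re (herm H (fst (fst p)) (fst (fst p))) + frechet_derivative psi (at (snd (fst p))) (snd v))"
    using Pot_derivative[OF pW0] by blast
  define L where "L r = (E p *\<^sub>C fst (fst r) + (E p * (\<i> * of_real (snd r) - of_real (D (fst r)) / 2)) *\<^sub>C fst (fst p), snd (fst r))" for r
  have dP: "(Phi has_derivative L) (at p)" unfolding L_def by (rule Phi_derivative[OF D(1)])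
  have "\<forall>x\<in>M0. \<exists>D. (F has_derivative D) (at x within M0) \<and>
      (\<forall>v\<in>complex_tangent_space (revolution_function H q) x.
        D v \<in> complex_tangent_space sphere_function (F x) \<and> D (\<i> *\<^sub>C v) = \<i> *\<^sub>C D v)"
    using CR unfolding smooth_CR_map_def by (elim conjE)
  from bspec[OF this PM] obtain D' where D': "(F has_derivative D') (at (Phi p) within M0)"
    "\<And>v. v \<in> complex_tangent_space (revolution_function H q) (Phi p) \<Longrightarrow> D' (\<i> *\<^sub>C v) = \<i> *\<^sub>C D' v"
    apply (elim exE conjE) apply (rule that) apply assumption+ apply blast done
  have "(F has_derivative D') (at (Phi p) within Phi ` W)"
    by (rule has_derivative_subset[OF D'(1)]) (auto simp: W_def)
  from has_derivative_in_compose[OF has_derivative_at_withinI[OF dP] this]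
  have df: "(f has_derivative (\<lambda>r. D' (L r))) (at p)"
    unfolding f_def[abs_def] at_within_open[OF p open_W] .
  have fd: "frechet_derivative f (at p) = (\<lambda>r. D' (L r))" using frechet_derivative_at[OF df] by simp
  have psi0: "frechet_derivative psi (at (snd (fst p))) 0 = 0"
    using linear_0[OF has_derivative_linear[OF smooth_on_has_derivative[OF smooth_psi]]] pW0 by (simp add: W0_def)
  have v1: "D (fst (fst p), 0) = 2" using pos by (simp add: D(2) psi0)
  have v2: "D (\<i> *\<^sub>C fst (fst p), 0) = 0"
    using herm_self_real[OF posH, of "fst (fst p)"] by (simp add: D(2) psi0 herm_simps) (metis Im_complex_of_real)
  have dr: "(revolution_function H q has_derivative frechet_derivative (revolution_function H q) (at (Phi p))) (at (Phi p))"
    using revolution_has_derivative[OF posH smooth_q, of "Phi p"] frechet_derivative_works differentiable_def by blast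
  have "((\<lambda>p. revolution_function H q (Phi p)) has_derivative (\<lambda>r. frechet_derivative (revolution_function H q) (at (Phi p)) (L r))) (at p)"
    by (rule has_derivative_compose[OF dP dr])
  moreover have "((\<lambda>p. revolution_function H q (Phi p)) has_derivative (\<lambda>r. 0)) (at p)"
  proof (rule has_derivative_transform_within_open[OF has_derivative_const open_W0 pW0])
    show "0 = revolution_function H q (Phi x)" if "x \<in> W0" for x
      using Phi_herm[OF that] by (simp add: revolution_function_def hermitian_form_eq case_prod_beta') (simp add: Phi_def)
  qed
  ultimately have "(\<lambda>r. frechet_derivative (revolution_function H q) (at (Phi p)) (L r)) = (\<lambda>r. 0)"
    by (rule has_derivative_unique)
  then have tan: "frechet_derivative (revolution_function H q) (at (Phi p)) (L r) = 0" for r by metis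
  have "D' v = \<i> *\<^sub>C D' u" if "v = \<i> *\<^sub>C u" "u = L s" "v = L t" for u v s t
  proof -
    have "u \<in> complex_tangent_space (revolution_function H q) (Phi p)"
    proof (rule complex_tangent_spaceI)
      show "frechet_derivative (revolution_function H q) (at (Phi p)) u = 0" unfolding that(2) by (rule tan)
      show "frechet_derivative (revolution_function H q) (at (Phi p)) (\<i> *\<^sub>C u) = 0"
        unfolding that(1)[symmetric] that(3) by (rule tan)
      show "revolution_function H q differentiable at (Phi p)" using dr differentiable_def by blast
    qed
    from D'(2)[OF this] show ?thesis by (simp add: that(1))
  qed
  then show ?thesis
    using D(1) fd v1 v2 has_derivative_linear[OF D'(1)] unfolding L_def by blast
qed

lemma f_f: assumes "p \<in> W" shows "hip (f p) (f p) = 1"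
proof -
  have "sphere_function (F (Phi p)) = 0" using assms CR by (simp add: W_def smooth_CR_map_def)
  then show ?thesis by (simp add: f_def hip_self sphere_function_def)
qed

sublocale circle_bundle Pot W
  by unfold_locales (use open_W smooth_on_subset[OF smooth_on_bounded_linear[OF bounded_linear_of_real open_W0 smooth_Pot] W_sub] in auto)

lemma P_Pb: assumes "(Pot has_derivative D) (at (fst p))"
  shows "P X p = (of_real (D X) - \<i> * of_real (D (\<i> *\<^sub>C X))) / 2" "Pb X p = (of_real (D X) + \<i> * of_real (D (\<i> *\<^sub>C X))) / 2"
  unfolding P_def Pb_def base_derivative(4,5)[OF bounded_linear.has_derivative[OF bounded_linear_of_real assms]] by simp_all

lemma Lb_f: assumes p: "p \<in> W" shows "Lb X f p = 0" and hom_f: "L (fst (fst p), 0) f p = 0"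
proof -
  obtain D D' where D: "(Pot has_derivative D) (at (fst p))" "linear D'"
    "frechet_derivative f (at p) = (\<lambda>r. D' (E p *\<^sub>C fst (fst r) + (E p * (\<i> * of_real (snd r) - of_real (D (fst r)) / 2)) *\<^sub>C fst (fst p), snd (fst r)))"
    "D (fst (fst p), 0) = 2" "D (\<i> *\<^sub>C fst (fst p), 0) = 0"
    "\<And>u v s t. v = \<i> *\<^sub>C u \<Longrightarrow>
        u = (E p *\<^sub>C fst (fst s) + (E p * (\<i> * of_real (snd s) - of_real (D (fst s)) / 2)) *\<^sub>C fst (fst p), snd (fst s)) \<Longrightarrow>
        v = (E p *\<^sub>C fst (fst t) + (E p * (\<i> * of_real (snd t) - of_real (D (fst t)) / 2)) *\<^sub>C fst (fst p), snd (fst t)) \<Longrightarrow>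
        D' v = \<i> *\<^sub>C D' u"
    using f_derivative[OF p] apply (elim exE conjE) apply (rule that) apply assumption+ apply blast done
  let ?D = "frechet_derivative f (at p)"
  note lin = frechet_derivative_linear[OF smooth_f p]
  have linD: "linear D" by (rule has_derivative_linear[OF D(1)])
  have sp: "?D (Y, t) = ?D (Y, 0) + t *\<^sub>R ?D (0, 1)" for Y t
    using linear_add[OF lin, of "(Y, 0)" "t *\<^sub>R (0, 1)"] linear_cmul[OF lin, of t "(0, 1)"] by simp
  \<comment> \<open>Lifts of \<open>X\<close> and \<open>\<i> *\<^sub>C X\<close> whose images under
    the derivative of \<open>Phi\<close> differ by the factor i; the circle components compensate
    the change of the potential.\<close>
  let ?s = "(X, D (\<i> *\<^sub>C X) / 2)" and ?t = "(\<i> *\<^sub>C X, - D X / 2)"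
  have DiX: "D (\<i> *\<^sub>C \<i> *\<^sub>C X) = - D X"
    using linear_neg[OF linD, of X] by (simp add: scaleC_scaleC scaleC_minus_left)
  have "?D ?t = \<i> *\<^sub>C ?D ?s"
    unfolding D(3)
  proof (rule D(6)[of _ _ ?s ?t, OF _ refl refl])
    show "(E p *\<^sub>C fst (fst ?t) + (E p * (\<i> * of_real (snd ?t) - of_real (D (fst ?t)) / 2)) *\<^sub>C fst (fst p), snd (fst ?t)) =
        \<i> *\<^sub>C (E p *\<^sub>C fst (fst ?s) + (E p * (\<i> * of_real (snd ?s) - of_real (D (fst ?s)) / 2)) *\<^sub>C fst (fst p), snd (fst ?s))"
      by (simp add: scaleC_prod_def scaleC_add_right scaleC_scaleC algebra_simps)
        (rule arg_cong[where f="\<lambda>c. c *\<^sub>C fst (fst p)"], simp)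
  qed
  then have e: "?D (\<i> *\<^sub>C X, 0) + (- D X / 2) *\<^sub>R ?D (0, 1) = \<i> *\<^sub>C (?D (X, 0) + (D (\<i> *\<^sub>C X) / 2) *\<^sub>R ?D (0, 1))"
    using sp[of X] sp[of "\<i> *\<^sub>C X"] by metis
  have "Lb X f p = (1/2) *\<^sub>C ((?D (X, 0) + (D (\<i> *\<^sub>C X) / 2) *\<^sub>R ?D (0, 1)) + \<i> *\<^sub>C (?D (\<i> *\<^sub>C X, 0) + (- D X / 2) *\<^sub>R ?D (0, 1)))"
    unfolding Lb_def dzb_def dT_def cderiv_def P_Pb[OF D(1)] scaleC_of_real[symmetric]
    by (simp add: scaleC_simps add_divide_distrib algebra_simps)
  also have "\<dots> = 0" unfolding e by (simp add: scaleC_scaleC scaleC_minus_left)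
  finally show "Lb X f p = 0" .
  \<comment> \<open>\<open>Phi\<close> is unchanged by positive scaling of \<open>y\<close>, and
    rotating \<open>y\<close> has the effect of moving \<open>t\<close>. In
    \<open>L (fst (fst p), 0)\<close> the rotation cancels against the \<open>dT\<close>
    correction.\<close>
  have 1: "?D ((fst (fst p), 0), 0) = 0"
    unfolding D(3) using D(4) linear_0[OF D(2)] by (simp flip: zero_prod_def scaleC_add_left)
  have D0: "D 0 = 0" by (rule linear_0[OF linD])
  have 2: "?D ((\<i> *\<^sub>C fst (fst p), 0), 0) = ?D (0, 1)"
    unfolding D(3) using D(5) D0 by (simp add: scaleC_scaleC)
  have i0: "\<i> *\<^sub>C (fst (fst p), 0 :: complex) = (\<i> *\<^sub>C fst (fst p), 0)" by (simp add: scaleC_prod_def)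
  show "L (fst (fst p), 0) f p = 0"
    unfolding L_def dz_def dT_def cderiv_def P_Pb[OF D(1)] i0 1 2 D(4,5) by (simp flip: scaleC_add_left)
qed

text \<open>By \<open>Phi_flow\<close> the circle through \<open>p\<close> and the one through
  \<open>(Phi p, 0)\<close> have the same image. Hence \<open>lam\<close> on \<open>W\<close> is
  determined by its values on the section.\<close>

lemma dT_invariant: assumes p: "p \<in> W" shows "dT f p = dT f (Phi p, 0)"
proof -
  have pW0: "p \<in> W0" and pM: "Phi p \<in> M0" using p by (auto simp: W_def)
  have d: "((\<lambda>t. f (p' + t *\<^sub>R (0, 1))) has_derivative (\<lambda>t. t *\<^sub>R frechet_derivative f (at p') (0, 1))) (at 0)" if "p' \<in> W" for p'
  proof -
    have a: "((\<lambda>t. p' + t *\<^sub>R (0, 1)) has_derivative (\<lambda>t. t *\<^sub>R (0, 1))) (at 0)"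
      by (auto intro!: derivative_eq_intros)
    have b: "(f has_derivative frechet_derivative f (at p')) (at (p' + 0 *\<^sub>R (0, 1)))"
      using smooth_on_has_derivative[OF smooth_f that] by (simp flip: zero_prod_def)
    show ?thesis
      using has_derivative_compose[OF a b] unfolding linear_cmul[OF frechet_derivative_linear[OF smooth_f that]] .
  qed
  have "f (p + t *\<^sub>R (0, 1)) = f ((Phi p, 0) + t *\<^sub>R (0, 1))" for t
    using Phi_flow[OF pW0, of t] by (cases p) (simp add: f_def)
  then have e: "(\<lambda>t. f (p + t *\<^sub>R (0, 1))) = (\<lambda>t. f ((Phi p, 0) + t *\<^sub>R (0, 1)))" by (rule ext)
  have "(\<lambda>t. t *\<^sub>R frechet_derivative f (at p) (0, 1)) = (\<lambda>t. t *\<^sub>R frechet_derivative f (at (Phi p, 0)) (0, 1))"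
    by (rule has_derivative_unique[OF d[OF p, unfolded e] d[OF M0_W(1)[OF pM]]])
  from fun_cong[OF this, of 1] show ?thesis by (simp add: dT_def cderiv_def)
qed

end

theorem theorem1p1:
  fixes n N :: nat
    and H :: "complex ^ 'n ^ 'n"
    and q :: "complex \<Rightarrow> real"
    and w\<^sub>0 :: complex
    and D\<^sub>0 U\<^sub>0 :: "complex set"
    and M M\<^sub>0 :: "((complex ^ 'n) \<times> complex) set"
    and F :: "(complex ^ 'n) \<times> complex \<Rightarrow> complex ^ 'm"
  assumes "CARD('n) = n" and "CARD('m) = N + 1"
    and "2 \<le> n" and "n \<le> N" and "N \<le> 2 * n - 2"
    and "positive_definite_hermitian H"
    and "smooth_on q UNIV"
    and "\<And>w. q w = 0 \<Longrightarrow> frechet_derivative q (at w) \<noteq> (\<lambda>v. 0)"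
    and "M = revolution_hypersurface H q"
    and "D\<^sub>0 = {w. q w < 0}"
    and "w\<^sub>0 \<in> D\<^sub>0" and "open U\<^sub>0" and "w\<^sub>0 \<in> U\<^sub>0" and "U\<^sub>0 \<subseteq> D\<^sub>0"
    and "\<And>z w. (z, w) \<in> M \<Longrightarrow> w \<in> U\<^sub>0 \<Longrightarrow> strongly_pseudoconvex_at (revolution_function H q) (z, w)"
    and "openin (top_of_set M) M\<^sub>0" and "connected M\<^sub>0" and "snd ` M\<^sub>0 = U\<^sub>0"
    and "\<And>w. w \<in> U\<^sub>0 \<Longrightarrow> gauss_curvature (metric_density q) w \<ge> - 2"
    and "smooth_CR_map (revolution_function H q) M\<^sub>0 sphere_function F"
    and "\<not> F constant_on M\<^sub>0"
  shows "(\<forall>w\<in>U\<^sub>0. gauss_curvature (metric_density q) w = - 2) \<and>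
         totally_geodesic_in_sphere (n + 1) (F ` M\<^sub>0)"
proof -
  have q_neg: "q w < 0" if "w \<in> U\<^sub>0" for w using assms(10,14) that by blast
  have op: "openin (top_of_set (revolution_hypersurface H q)) M\<^sub>0" using assms(9,16) by simp
  interpret S: revolution_setting H q U\<^sub>0 M\<^sub>0 F
    by (rule revolution_setting.intro[OF assms(6,7,12) q_neg op assms(18,20)])
  have lift: "\<exists>m\<in>M\<^sub>0. snd m = w" if "w \<in> U\<^sub>0" for w using assms(18) that by auto
  have h_pos: "Re (dhol 1 (dbar 1 (\<lambda>u. of_real (S.psi u))) w) > 0" if w: "w \<in> U\<^sub>0" for w
  proof -
    obtain m where m: "m \<in> M\<^sub>0" "snd m = w" using lift[OF w] by blast
    have mM: "m \<in> revolution_hypersurface H q" using openin_imp_subset[OF op] m(1) by blast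
    then have 1: "Re (herm H (fst m) (fst m)) + q w = 0"
      by (simp add: revolution_hypersurface_def revolution_function_def hermitian_form_eq case_prod_beta' m(2))
    have "(fst m, w) = m" using m(2) by (cases m) simp
    then have "strongly_pseudoconvex_at (revolution_function H q) (fst m, w)"
      by (intro assms(15)) (use mM assms(9) w in simp_all)
    from strongly_pseudoconvex_imp_density_pos[OF assms(6,7,12) q_neg w 1 this]
    show ?thesis unfolding S.psi_def .
  qed
  have dom: "fst (fst p) \<noteq> 0 \<and> snd (fst p) \<in> U\<^sub>0" if "p \<in> S.W" for p
    using that S.W_sub S.W0_def by blast
  interpret C: revolution_chart H S.psi S.W U\<^sub>0
    by unfold_locales (use assms(6,12) S.smooth_psi dom h_pos in auto)
  have hU: "C.h w = of_real (Re (C.h w))" "Re (C.h w) > 0" if w: "w \<in> U\<^sub>0" for w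
  proof -
    obtain m where m: "m \<in> M\<^sub>0" "snd m = w" using lift[OF w] by blast
    show "C.h w = of_real (Re (C.h w))" "Re (C.h w) > 0"
      using C.h_real[OF S.M0_W(1)[OF m(1)]] by (simp_all only: m(2) fst_conv)
  qed
  have K_eq: "gauss_curvature (metric_density q) w = - (Re (C.h w * C.hwb w - C.hw w * C.hb w) / Re (C.h w) ^ 3)"
    if "w \<in> U\<^sub>0" for w
    by (rule C.gauss_curvature_eq[OF _ hU(1) that]) (simp add: S.psi_def abs_of_neg[OF q_neg])
  \<comment> \<open>The bound K >= -2 multiplied by the positive cube of \<open>h\<close>, as
    \<open>revolution_map\<close> expects it.\<close>
  have K_le: "Re (C.h w * C.hwb w - C.hw w * C.hb w) \<le> 2 * Re (C.h w) ^ 3" if w: "w \<in> U\<^sub>0" for w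
    using assms(19)[OF w] hU(2)[OF w] unfolding K_eq[OF w] by (simp add: divide_le_eq)
  interpret R: revolution_map H S.psi S.W U\<^sub>0 S.f
  proof unfold_locales
    show "CARD('m) + 1 \<le> 2 * CARD('n)" "2 \<le> CARD('n)" using assms(1-5) by auto
    show "Re (C.h (snd (fst p)) * C.hwb (snd (fst p)) - C.hw (snd (fst p)) * C.hb (snd (fst p)))
      \<le> 2 * Re (C.h (snd (fst p))) ^ 3" if "p \<in> S.W" for p
      using K_le dom[OF that] by blast
  qed (use S.smooth_f S.Lb_f S.f_f S.hom_f in blast)+
  have fF: "F m = S.f (m, 0)" if "m \<in> M\<^sub>0" for m by (simp add: S.f_def S.M0_W(2)[OF that])
  \<comment> \<open>The section point over \<open>p\<close> is \<open>Phi p\<close>;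
    \<open>f\<close> and \<open>dT f\<close> agree at both, hence so does
    \<open>lam\<close>.\<close>
  have base: "\<exists>m\<in>M\<^sub>0. R.lam p = R.lam (m, 0)" if p: "p \<in> S.W" for p
  proof
    show m: "S.Phi p \<in> M\<^sub>0" using p by (simp add: S.W_def)
    have "S.f p = S.f (S.Phi p, 0)" by (simp add: S.f_def S.M0_W(2)[OF m])
    then show "R.lam p = R.lam (S.Phi p, 0)"
      unfolding R.lam_def R.G_def S.dT_invariant[OF p] by simp
  qed
  have nc: "\<not> (\<lambda>m. S.f (m, 0)) constant_on M\<^sub>0"
    using assms(21) fF unfolding constant_on_def by metis
  \<comment> \<open>Here the nonconstancy of \<open>F\<close> is spent: it gives transversality on
    all of \<open>W\<close>, so the structure equations hold everywhere and not only off a zero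
    set.\<close>
  have lam: "R.lam p \<noteq> 0" if "p \<in> S.W" for p
    by (rule R.lam_neq_0_or_constant[OF assms(17) S.M0_W(1) base nc that])
  interpret T: transversal_map H S.psi S.W U\<^sub>0 S.f
    by unfold_locales (rule lam)
  have "gauss_curvature (metric_density q) w = - 2" if w: "w \<in> U\<^sub>0" for w
  proof -
    obtain m where m: "m \<in> M\<^sub>0" "snd m = w" using lift[OF w] by blast
    have "C.h w * C.hwb w - C.hw w * C.hb w = 2 * C.h w ^ 3"
      using R.second_fundamental_form_zero(2)[OF S.M0_W(1)[OF m(1)] lam[OF S.M0_W(1)[OF m(1)]]] by (simp only: m(2) fst_conv)
    also have "\<dots> = of_real (2 * Re (C.h w) ^ 3)" by (subst hU(1)[OF w]) simp
    finally show ?thesis unfolding K_eq[OF w] using hU(2)[OF w] by simp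
  qed
  moreover have fW: "S.f ` S.W \<subseteq> F ` M\<^sub>0" by (auto simp: S.f_def S.W_def)
  obtain m0 where "m0 \<in> M\<^sub>0" using lift[OF assms(13)] by blast
  from T.image_totally_geodesic[OF assms(17) S.M0_W(1) fF fW this]
  have "totally_geodesic_in_sphere (n + 1) (F ` M\<^sub>0)" by (simp add: assms(1))
  ultimately show ?thesis by blast
qed

end
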